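(* Let $A$ be a ring with center $C$ and let $n$ be a positive integer. 1. If $A$ is a ring of finite characteristic $s$ (this is the case if the ring $A$ is finite), then $\Lambda(A^n)$ is a centrally essential ring if and only if $A$ is a centrally essential ring and at least one of the following conditions holds: (a) $s=2^m$ for some $m\in\mathbb{N}$; (b) $n$ is an odd integer. 2. If $A$ is a ring without zero-divisors, then $\Lambda(A^n)$ is a centrally essential ring if and only if $A$ is a centrally essential ring and at least one of the following conditions holds: (a) $A$ is a ring of characteristic $2$; (b) $n$ is an odd integer.
   Context: All rings are associative and unital, not necessarily commutative. A ring $R$ with center $C(R)$ is called centrally essential if the right $C(R)$-module $R_{C(R)}$ is an essential extension of its submodule $C(R)_{C(R)}$; equivalently, for every nonzero $r\in R$ there is $c\in C(R)$ with $0\neq rc\in C(R)$. For a ring $A$ with center $C$ and a positive integer $n$, the exterior algebra of the free module $A^n$ is defined as the ring $\Lambda(A^n)=A\otimes_C\Lambda(C^n)$, where $\Lambda(C^n)$ is the usual exterior algebra of the free module $C^n$ over the commutative ring $C$ (so that, if $e_1,\dots,e_n$ is a basis of $C^n$, then $e_i\wedge e_i=0$, $e_i\wedge e_j=-e_j\wedge e_i$, the products $e_{i_1}\wedge\ldots\wedge e_{i_s}$ with $0\le s\le n$, $1\le i_1<\ldots<i_s\le n$ form a basis of $\Lambda(A^n)$ over $A$, and elements of $A$ commute with the $e_i$). A ring has finite characteristic $s$ if $s$ is the least positive integer with $s\cdot 1=0$ in the ring. A ring without zero-divisors is a (not necessarily commutative) domain: $1\neq 0$, and $ab=0$ implies $a=0$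 or $b=0$. *)

theory Defs
  imports "HOL-Algebra.Subrings" "HOL-Algebra.Module" "HOL-Algebra.QuotRing" "HOL-Algebra.IntRing"
begin

section \<open>Centrally essential rings\<close>

definition center :: "('a, 'm) ring_scheme \<Rightarrow> 'a set" where
  "center R = {c \<in> carrier R. \<forall>x \<in> carrier R. c \<otimes>\<^bsub>R\<^esub> x = x \<otimes>\<^bsub>R\<^esub> c}"

definition center_ring :: "('a, 'm) ring_scheme \<Rightarrow> ('a, 'm) ring_scheme" where
  "center_ring R = R\<lparr>carrier := center R\<rparr>"

text \<open>
  The right module of a ring over its center. The library has only left modules; as the center is
  commutative, the right action of \<open>c\<close> is recorded as the (left) scalar action of \<open>c\<close>.
\<close>

definition module_over_center :: "('a, 'm) ring_scheme \<Rightarrow> ('a, 'a) module" where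
  "module_over_center R =
     \<lparr>carrier = carrier R, monoid.mult = monoid.mult R, one = one R, zero = zero R, add = add R,
      smult = (\<lambda>c r. r \<otimes>\<^bsub>R\<^esub> c)\<rparr>"

definition essential_submodule ::
    "'b set \<Rightarrow> ('a, 'm) ring_scheme \<Rightarrow> ('a, 'b, 'n) module_scheme \<Rightarrow> bool" where
  "essential_submodule N R M \<longleftrightarrow> submodule N R M \<and>
     (\<forall>H. submodule H R M \<and> H \<noteq> {\<zero>\<^bsub>M\<^esub>} \<longrightarrow> N \<inter> H \<noteq> {\<zero>\<^bsub>M\<^esub>})"

definition centrally_essential :: "('a, 'm) ring_scheme \<Rightarrow> bool" where
  "centrally_essential R \<longleftrightarrow>
     essential_submodule (center R) (center_ring R) (module_over_center R)"

lemma center_ring_cring: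
  assumes "ring R"
  shows "cring (center_ring R)"
proof -
  interpret ring R by fact
  have "subring (center R) R"
  proof (rule subringI)
    show "\<ominus>\<^bsub>R\<^esub> h \<in> center R" if "h \<in> center R" for h
      using that by (auto simp: center_def l_minus r_minus)
    show "h1 \<otimes>\<^bsub>R\<^esub> h2 \<in> center R" if h: "h1 \<in> center R" "h2 \<in> center R" for h1 h2
    proof -
      have c: "h1 \<in> carrier R" "h2 \<in> carrier R"
        and comm: "\<And>x. x \<in> carrier R \<Longrightarrow> h1 \<otimes>\<^bsub>R\<^esub> x = x \<otimes>\<^bsub>R\<^esub> h1"
          "\<And>x. x \<in> carrier R \<Longrightarrow> h2 \<otimes>\<^bsub>R\<^esub> x = x \<otimes>\<^bsub>R\<^esub> h2"
        using h unfolding center_def by blast+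
      have "h1 \<otimes>\<^bsub>R\<^esub> h2 \<otimes>\<^bsub>R\<^esub> x = x \<otimes>\<^bsub>R\<^esub> (h1 \<otimes>\<^bsub>R\<^esub> h2)" if x: "x \<in> carrier R" for x
      proof -
        have "h1 \<otimes>\<^bsub>R\<^esub> h2 \<otimes>\<^bsub>R\<^esub> x = h1 \<otimes>\<^bsub>R\<^esub> (x \<otimes>\<^bsub>R\<^esub> h2)"
          using c x m_assoc[of h1 h2 x] comm(2)[OF x] by simp
        also have "\<dots> = x \<otimes>\<^bsub>R\<^esub> h1 \<otimes>\<^bsub>R\<^esub> h2"
          using c x m_assoc[of h1 x h2] comm(1)[OF x] by simp
        finally show ?thesis using c x by (simp add: m_assoc)
      qed
      then show ?thesis using c by (simp add: center_def)
    qed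
    show "h1 \<oplus>\<^bsub>R\<^esub> h2 \<in> center R" if h: "h1 \<in> center R" "h2 \<in> center R" for h1 h2
    proof -
      have c: "h1 \<in> carrier R" "h2 \<in> carrier R"
        and comm: "\<And>x. x \<in> carrier R \<Longrightarrow> h1 \<otimes>\<^bsub>R\<^esub> x = x \<otimes>\<^bsub>R\<^esub> h1"
          "\<And>x. x \<in> carrier R \<Longrightarrow> h2 \<otimes>\<^bsub>R\<^esub> x = x \<otimes>\<^bsub>R\<^esub> h2"
        using h unfolding center_def by blast+
      have "(h1 \<oplus>\<^bsub>R\<^esub> h2) \<otimes>\<^bsub>R\<^esub> x = x \<otimes>\<^bsub>R\<^esub> (h1 \<oplus>\<^bsub>R\<^esub> h2)" if x: "x \<in> carrier R" for x
        using c x comm(1)[OF x] comm(2)[OF x] by (simp only: l_distr r_distr)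
      then show ?thesis using c by (simp add: center_def)
    qed
  qed (auto simp: center_def)
  then have "subcring (center R) R"
    by (rule subcringI) (unfold center_def, blast)
  moreover have "center R \<subseteq> carrier R"
    by (auto simp: center_def)
  ultimately show ?thesis
    unfolding center_ring_def using subcring_iff by blast
qed

lemma centrally_essential_iff:
  assumes "ring R"
  shows "centrally_essential R \<longleftrightarrow>
    (\<forall>r \<in> carrier R. r \<noteq> \<zero>\<^bsub>R\<^esub> \<longrightarrow>
      (\<exists>c \<in> center R. r \<otimes>\<^bsub>R\<^esub> c \<noteq> \<zero>\<^bsub>R\<^esub> \<and> r \<otimes>\<^bsub>R\<^esub> c \<in> center R))"
proof -
  interpret R: ring R by fact
  interpret C: cring "center_ring R" by (rule center_ring_cring) fact
  have sub: "center R \<subseteq> carrier R" by (auto simp: center_def)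
  have neg: "\<ominus>\<^bsub>module_over_center R\<^esub> x = \<ominus>\<^bsub>R\<^esub> x" for x
    by (simp add: module_over_center_def a_inv_def m_inv_def)
  have C0: "\<zero>\<^bsub>R\<^esub> \<in> center R" and C1: "\<one>\<^bsub>R\<^esub> \<in> center R"
    using C.zero_closed C.one_closed by (simp_all add: center_ring_def)
  have Cadd: "c \<oplus>\<^bsub>R\<^esub> d \<in> center R" and Cmult: "c \<otimes>\<^bsub>R\<^esub> d \<in> center R"
    if "c \<in> center R" "d \<in> center R" for c d
    using C.a_closed[of c d] C.m_closed[of c d] that by (simp_all add: center_ring_def)
  have Cneg: "\<ominus>\<^bsub>R\<^esub> c \<in> center R" if "c \<in> center R" for c
    using that sub by (auto simp: center_def R.l_minus R.r_minus)
  have simps: "carrier (center_ring R) = center R" "a \<oplus>\<^bsub>center_ring R\<^esub> b = a \<oplus>\<^bsub>R\<^esub> b"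
    "a \<otimes>\<^bsub>center_ring R\<^esub> b = a \<otimes>\<^bsub>R\<^esub> b" "\<one>\<^bsub>center_ring R\<^esub> = \<one>\<^bsub>R\<^esub>"
    "carrier (module_over_center R) = carrier R"
    "\<zero>\<^bsub>module_over_center R\<^esub> = \<zero>\<^bsub>R\<^esub>" "x \<oplus>\<^bsub>module_over_center R\<^esub> y = x \<oplus>\<^bsub>R\<^esub> y"
    "c \<odot>\<^bsub>module_over_center R\<^esub> y = y \<otimes>\<^bsub>R\<^esub> c" for x y and a b c :: 'a
    by (simp_all add: center_ring_def module_over_center_def)
  have module: "module (center_ring R) (module_over_center R)"
  proof (rule moduleI)
    show "abelian_group (module_over_center R)"
    proof (rule abelian_groupI)
      fix x assume "x \<in> carrier (module_over_center R)"
      then show "\<exists>y\<in>carrier (module_over_center R).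
          y \<oplus>\<^bsub>module_over_center R\<^esub> x = \<zero>\<^bsub>module_over_center R\<^esub>"
        unfolding simps by (intro bexI[of _ "\<ominus>\<^bsub>R\<^esub> x"]) (auto simp: R.l_neg)
    qed (auto simp: simps R.a_ac)
  next
    fix a b x
    assume "a \<in> carrier (center_ring R)" "b \<in> carrier (center_ring R)"
      "x \<in> carrier (module_over_center R)"
    then have ab: "a \<in> center R" "b \<in> center R" and x: "x \<in> carrier R"
      unfolding simps .
    have c: "a \<in> carrier R" "b \<in> carrier R" using ab sub by auto
    have comm: "a \<otimes>\<^bsub>R\<^esub> b = b \<otimes>\<^bsub>R\<^esub> a" using ab c unfolding center_def by blast
    show "(a \<oplus>\<^bsub>center_ring R\<^esub> b) \<odot>\<^bsub>module_over_center R\<^esub> x =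
      a \<odot>\<^bsub>module_over_center R\<^esub> x \<oplus>\<^bsub>module_over_center R\<^esub> b \<odot>\<^bsub>module_over_center R\<^esub> x"
      using c x by (simp add: simps R.r_distr)
    show "(a \<otimes>\<^bsub>center_ring R\<^esub> b) \<odot>\<^bsub>module_over_center R\<^esub> x =
      a \<odot>\<^bsub>module_over_center R\<^esub> (b \<odot>\<^bsub>module_over_center R\<^esub> x)"
      unfolding simps comm using c x by (simp add: R.m_assoc)
  qed (use sub C.cring_axioms in \<open>auto simp: simps R.l_distr\<close>)
  interpret module "center_ring R" "module_over_center R" by (rule module)
  have submod: "submodule (center R) (center_ring R) (module_over_center R)"
    by (rule submoduleI) (use sub C0 Cadd Cmult Cneg in \<open>auto simp: simps neg\<close>)
  show ?thesis
  proof
    assume ce: "centrally_essential R"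
    show "\<forall>r \<in> carrier R. r \<noteq> \<zero>\<^bsub>R\<^esub> \<longrightarrow>
      (\<exists>c \<in> center R. r \<otimes>\<^bsub>R\<^esub> c \<noteq> \<zero>\<^bsub>R\<^esub> \<and> r \<otimes>\<^bsub>R\<^esub> c \<in> center R)"
    proof (intro ballI impI)
      fix r assume r: "r \<in> carrier R" "r \<noteq> \<zero>\<^bsub>R\<^esub>"
      let ?H = "(\<lambda>c. r \<otimes>\<^bsub>R\<^esub> c) ` center R"
      have "submodule ?H (center_ring R) (module_over_center R)"
      proof (rule submoduleI)
        show "\<zero>\<^bsub>module_over_center R\<^esub> \<in> ?H"
          using C0 r by (auto simp: simps intro!: image_eqI[of _ _ "\<zero>\<^bsub>R\<^esub>"])
        show "\<ominus>\<^bsub>module_over_center R\<^esub> a \<in> ?H" if "a \<in> ?H" for a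
          using that Cneg r sub by (auto simp: neg R.r_minus[symmetric] subset_iff)
        show "a \<oplus>\<^bsub>module_over_center R\<^esub> b \<in> ?H" if "a \<in> ?H" "b \<in> ?H" for a b
          using that Cadd r sub by (auto simp: simps R.r_distr[symmetric] subset_iff)
        show "a \<odot>\<^bsub>module_over_center R\<^esub> x \<in> ?H" if "a \<in> carrier (center_ring R)" "x \<in> ?H" for a x
          using that Cmult r sub by (auto simp: simps R.m_assoc subset_iff)
      qed (use r sub in \<open>auto simp: simps\<close>)
      moreover have "r \<in> ?H"
        using C1 r by (auto intro!: image_eqI[of _ _ "\<one>\<^bsub>R\<^esub>"])
      ultimately have "center R \<inter> ?H \<noteq> {\<zero>\<^bsub>R\<^esub>}"
        using ce r unfolding centrally_essential_def essential_submodule_def simps by blast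
      moreover have "\<zero>\<^bsub>R\<^esub> \<in> center R \<inter> ?H"
        using C0 r by (auto intro!: image_eqI[of _ _ "\<zero>\<^bsub>R\<^esub>"])
      ultimately show "\<exists>c \<in> center R. r \<otimes>\<^bsub>R\<^esub> c \<noteq> \<zero>\<^bsub>R\<^esub> \<and> r \<otimes>\<^bsub>R\<^esub> c \<in> center R"
        by blast
    qed
  next
    assume el: "\<forall>r \<in> carrier R. r \<noteq> \<zero>\<^bsub>R\<^esub> \<longrightarrow>
      (\<exists>c \<in> center R. r \<otimes>\<^bsub>R\<^esub> c \<noteq> \<zero>\<^bsub>R\<^esub> \<and> r \<otimes>\<^bsub>R\<^esub> c \<in> center R)"
    show "centrally_essential R"
      unfolding centrally_essential_def essential_submodule_def simps
    proof (intro conjI submod allI impI)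
      fix H assume H: "submodule H (center_ring R) (module_over_center R) \<and> H \<noteq> {\<zero>\<^bsub>R\<^esub>}"
      note E = submoduleE[OF conjunct1[OF H], unfolded simps]
      obtain r where r: "r \<in> H" "r \<noteq> \<zero>\<^bsub>R\<^esub>"
        using H E(2) by blast
      then obtain c where "c \<in> center R" "r \<otimes>\<^bsub>R\<^esub> c \<noteq> \<zero>\<^bsub>R\<^esub>" "r \<otimes>\<^bsub>R\<^esub> c \<in> center R"
        using el E(1) by blast
      then show "center R \<inter> H \<noteq> {\<zero>\<^bsub>R\<^esub>}"
        using E(4)[of c r] r(1) by blast
    qed
  qed
qed


section \<open>Characteristic and zero divisors\<close>

definition has_finite_characteristic :: "('a, 'm) ring_scheme \<Rightarrow> nat \<Rightarrow> bool" where
  "has_finite_characteristic R s \<longleftrightarrow>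
     0 < s \<and> [s] \<cdot>\<^bsub>R\<^esub> \<one>\<^bsub>R\<^esub> = \<zero>\<^bsub>R\<^esub> \<and>
     (\<forall>t::nat. 0 < t \<and> t < s \<longrightarrow> [t] \<cdot>\<^bsub>R\<^esub> \<one>\<^bsub>R\<^esub> \<noteq> \<zero>\<^bsub>R\<^esub>)"

text \<open>The library locale \<open>domain\<close> requires commutativity, so it is not used here.\<close>

definition ring_without_zero_divisors :: "('a, 'm) ring_scheme \<Rightarrow> bool" where
  "ring_without_zero_divisors R \<longleftrightarrow> ring R \<and> \<one>\<^bsub>R\<^esub> \<noteq> \<zero>\<^bsub>R\<^esub> \<and>
     (\<forall>a \<in> carrier R. \<forall>b \<in> carrier R.
        a \<otimes>\<^bsub>R\<^esub> b = \<zero>\<^bsub>R\<^esub> \<longrightarrow> a = \<zero>\<^bsub>R\<^esub> \<or> b = \<zero>\<^bsub>R\<^esub>)"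


section \<open>Monoid rings\<close>

text \<open>
  Elements of \<open>R[M]\<close> are finitely supported functions on \<open>carrier M\<close>, extended by zero; the
  product is convolution.
\<close>

definition monoid_ring :: "('r, 'k) ring_scheme \<Rightarrow> ('m, 'l) monoid_scheme \<Rightarrow> ('m \<Rightarrow> 'r) ring" where
  "monoid_ring R M =
     \<lparr>carrier = {f. (\<forall>x. f x \<in> carrier R) \<and> {x. f x \<noteq> \<zero>\<^bsub>R\<^esub>} \<subseteq> carrier M \<and>
                    finite {x. f x \<noteq> \<zero>\<^bsub>R\<^esub>}},
      monoid.mult = (\<lambda>f g x. \<Oplus>\<^bsub>R\<^esub>y\<in>{y. f y \<noteq> \<zero>\<^bsub>R\<^esub>}. \<Oplus>\<^bsub>R\<^esub>z\<in>{z. g z \<noteq> \<zero>\<^bsub>R\<^esub>}.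
                if y \<otimes>\<^bsub>M\<^esub> z = x then f y \<otimes>\<^bsub>R\<^esub> g z else \<zero>\<^bsub>R\<^esub>),
      one = (\<lambda>x. if x = \<one>\<^bsub>M\<^esub> then \<one>\<^bsub>R\<^esub> else \<zero>\<^bsub>R\<^esub>),
      zero = (\<lambda>x. \<zero>\<^bsub>R\<^esub>),
      add = (\<lambda>f g x. f x \<oplus>\<^bsub>R\<^esub> g x)\<rparr>"

definition monomial :: "('r, 'k) ring_scheme \<Rightarrow> 'r \<Rightarrow> 'm \<Rightarrow> 'm \<Rightarrow> 'r" where
  "monomial R c y = (\<lambda>x. if x = y then c else \<zero>\<^bsub>R\<^esub>)"

lemma (in abelian_monoid) finsum_swap:
  assumes "finite S" "finite T" "\<And>y z. y \<in> S \<Longrightarrow> z \<in> T \<Longrightarrow> k y z \<in> carrier G"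
  shows "(\<Oplus>y\<in>S. \<Oplus>z\<in>T. k y z) = (\<Oplus>z\<in>T. \<Oplus>y\<in>S. k y z)"
  using assms(1,3)
proof (induction S)
  case empty
  then show ?case by simp
next
  case (insert a S)
  have "(\<Oplus>y\<in>insert a S. \<Oplus>z\<in>T. k y z) = (\<Oplus>z\<in>T. k a z) \<oplus> (\<Oplus>y\<in>S. \<Oplus>z\<in>T. k y z)"
    using insert by (subst finsum_insert) (auto intro!: finsum_closed)
  also have "\<dots> = (\<Oplus>z\<in>T. k a z) \<oplus> (\<Oplus>z\<in>T. \<Oplus>y\<in>S. k y z)"
    using insert by simp
  also have "\<dots> = (\<Oplus>z\<in>T. k a z \<oplus> (\<Oplus>y\<in>S. k y z))"
    using insert by (subst finsum_addf) (auto intro!: finsum_closed)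
  also have "\<dots> = (\<Oplus>z\<in>T. \<Oplus>y\<in>insert a S. k y z)"
    using insert by (intro finsum_cong') (auto intro!: finsum_closed)
  finally show ?case .
qed

lemma (in abelian_monoid) finsum2_addf:
  assumes "\<And>y z. y \<in> S \<Longrightarrow> z \<in> T \<Longrightarrow> k y z \<in> carrier G"
    "\<And>y z. y \<in> S \<Longrightarrow> z \<in> T \<Longrightarrow> l y z \<in> carrier G"
    "\<And>y z. y \<in> S \<Longrightarrow> z \<in> T \<Longrightarrow> m y z = k y z \<oplus> l y z"
  shows "(\<Oplus>y\<in>S. \<Oplus>z\<in>T. m y z) = (\<Oplus>y\<in>S. \<Oplus>z\<in>T. k y z) \<oplus> (\<Oplus>y\<in>S. \<Oplus>z\<in>T. l y z)"
proof -
  have "(\<Oplus>z\<in>T. m y z) = (\<Oplus>z\<in>T. k y z) \<oplus> (\<Oplus>z\<in>T. l y z)" if "y \<in> S" for y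
  proof -
    have "(\<Oplus>z\<in>T. m y z) = (\<Oplus>z\<in>T. k y z \<oplus> l y z)"
      using assms that by (intro finsum_cong') auto
    then show ?thesis using assms that by (simp add: finsum_addf)
  qed
  then have "(\<Oplus>y\<in>S. \<Oplus>z\<in>T. m y z) = (\<Oplus>y\<in>S. (\<Oplus>z\<in>T. k y z) \<oplus> (\<Oplus>z\<in>T. l y z))"
    using assms by (intro finsum_cong') (auto intro!: finsum_closed)
  also have "\<dots> = (\<Oplus>y\<in>S. \<Oplus>z\<in>T. k y z) \<oplus> (\<Oplus>y\<in>S. \<Oplus>z\<in>T. l y z)"
    using assms by (intro finsum_addf) (auto intro!: finsum_closed)
  finally show ?thesis .
qed

context
  fixes R :: "('r, 'k) ring_scheme" (structure) and M :: "('m, 'l) monoid_scheme"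
  assumes R: "ring R" and M: "Group.monoid M"
begin

interpretation ring R by (rule R)
interpretation M: Group.monoid M by (rule M)

lemma monoid_ring_carrierD:
  assumes "f \<in> carrier (monoid_ring R M)"
  shows "f x \<in> carrier R" "{x. f x \<noteq> \<zero>} \<subseteq> carrier M" "finite {x. f x \<noteq> \<zero>}"
    "x \<notin> carrier M \<Longrightarrow> f x = \<zero>"
  using assms by (auto simp: monoid_ring_def)

lemma monoid_ring_carrierI:
  assumes "\<And>x. f x \<in> carrier R" "{x. f x \<noteq> \<zero>} \<subseteq> S" "S \<subseteq> carrier M" "finite S"
  shows "f \<in> carrier (monoid_ring R M)"
  using assms by (auto simp: monoid_ring_def intro: finite_subset)

lemma monoid_ring_mult_eq:
  assumes f: "f \<in> carrier (monoid_ring R M)" and g: "g \<in> carrier (monoid_ring R M)"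
    and S: "finite S" "{x. f x \<noteq> \<zero>} \<subseteq> S" and T: "finite T" "{x. g x \<noteq> \<zero>} \<subseteq> T"
  shows "(f \<otimes>\<^bsub>monoid_ring R M\<^esub> g) x =
    (\<Oplus>y\<in>S. \<Oplus>z\<in>T. if y \<otimes>\<^bsub>M\<^esub> z = x then f y \<otimes> g z else \<zero>)"
proof -
  note c = monoid_ring_carrierD[OF f] monoid_ring_carrierD[OF g]
  have "(f \<otimes>\<^bsub>monoid_ring R M\<^esub> g) x =
    (\<Oplus>y\<in>{y. f y \<noteq> \<zero>}. \<Oplus>z\<in>{z. g z \<noteq> \<zero>}. if y \<otimes>\<^bsub>M\<^esub> z = x then f y \<otimes> g z else \<zero>)"
    by (simp add: monoid_ring_def)
  also have "\<dots> = (\<Oplus>y\<in>{y. f y \<noteq> \<zero>}. \<Oplus>z\<in>T. if y \<otimes>\<^bsub>M\<^esub> z = x then f y \<otimes> g z else \<zero>)"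
    using T c by (intro finsum_cong' add.finprod_mono_neutral_cong_left) (auto intro!: finsum_closed)
  also have "\<dots> = (\<Oplus>y\<in>S. \<Oplus>z\<in>T. if y \<otimes>\<^bsub>M\<^esub> z = x then f y \<otimes> g z else \<zero>)"
    using S T c by (intro add.finprod_mono_neutral_cong_left)
      (auto intro!: finsum_closed add.finprod_one_eqI)
  finally show ?thesis .
qed

lemma monoid_ring_mult_support:
  assumes f: "f \<in> carrier (monoid_ring R M)" and g: "g \<in> carrier (monoid_ring R M)"
  shows "{x. (f \<otimes>\<^bsub>monoid_ring R M\<^esub> g) x \<noteq> \<zero>} \<subseteq>
    (\<lambda>(y, z). y \<otimes>\<^bsub>M\<^esub> z) ` ({y. f y \<noteq> \<zero>} \<times> {z. g z \<noteq> \<zero>})"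
proof (rule subsetI, rule ccontr)
  fix x
  assume x: "x \<in> {x. (f \<otimes>\<^bsub>monoid_ring R M\<^esub> g) x \<noteq> \<zero>}"
    and n: "x \<notin> (\<lambda>(y, z). y \<otimes>\<^bsub>M\<^esub> z) ` ({y. f y \<noteq> \<zero>} \<times> {z. g z \<noteq> \<zero>})"
  have "(f \<otimes>\<^bsub>monoid_ring R M\<^esub> g) x = \<zero>"
    unfolding monoid_ring_def by (simp, intro add.finprod_one_eqI) (use n in auto)
  with x show False by simp
qed

lemma monoid_ring_mult_closed:
  assumes f: "f \<in> carrier (monoid_ring R M)" and g: "g \<in> carrier (monoid_ring R M)"
  shows "f \<otimes>\<^bsub>monoid_ring R M\<^esub> g \<in> carrier (monoid_ring R M)"
proof (rule monoid_ring_carrierI[OF _ monoid_ring_mult_support[OF f g]])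
  note c = monoid_ring_carrierD[OF f] monoid_ring_carrierD[OF g]
  show "(f \<otimes>\<^bsub>monoid_ring R M\<^esub> g) x \<in> carrier R" for x
    using c by (subst monoid_ring_mult_eq[OF f g c(3) order.refl c(7) order.refl])
      (auto intro!: finsum_closed)
qed (use monoid_ring_carrierD[OF f] monoid_ring_carrierD[OF g] in auto)

lemma monoid_ring_assoc:
  assumes f: "f \<in> carrier (monoid_ring R M)" and g: "g \<in> carrier (monoid_ring R M)"
    and h: "h \<in> carrier (monoid_ring R M)"
  shows "(f \<otimes>\<^bsub>monoid_ring R M\<^esub> g) \<otimes>\<^bsub>monoid_ring R M\<^esub> h =
    f \<otimes>\<^bsub>monoid_ring R M\<^esub> (g \<otimes>\<^bsub>monoid_ring R M\<^esub> h)"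
proof
  fix x
  note cf = monoid_ring_carrierD[OF f] and cg = monoid_ring_carrierD[OF g]
    and ch = monoid_ring_carrierD[OF h]
  define Y Z W where "Y = {y. f y \<noteq> \<zero>}" and "Z = {z. g z \<noteq> \<zero>}" and "W = {w. h w \<noteq> \<zero>}"
  have Y: "finite Y" "{y. f y \<noteq> \<zero>} \<subseteq> Y" "Y \<subseteq> carrier M"
    and Z: "finite Z" "{z. g z \<noteq> \<zero>} \<subseteq> Z" "Z \<subseteq> carrier M"
    and W: "finite W" "{w. h w \<noteq> \<zero>} \<subseteq> W" "W \<subseteq> carrier M"
    using cf(2,3) cg(2,3) ch(2,3) by (auto simp: Y_def Z_def W_def)
  define U where "U = (\<lambda>(y, z). y \<otimes>\<^bsub>M\<^esub> z) ` (Y \<times> Z)"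
  define V where "V = (\<lambda>(z, w). z \<otimes>\<^bsub>M\<^esub> w) ` (Z \<times> W)"
  have U: "finite U" "{x. (f \<otimes>\<^bsub>monoid_ring R M\<^esub> g) x \<noteq> \<zero>} \<subseteq> U"
    using Y Z monoid_ring_mult_support[OF f g] by (auto simp: U_def Y_def Z_def)
  have V: "finite V" "{x. (g \<otimes>\<^bsub>monoid_ring R M\<^esub> h) x \<noteq> \<zero>} \<subseteq> V"
    using W Z monoid_ring_mult_support[OF g h] by (auto simp: V_def W_def Z_def)
  note cl = cf(1) cg(1) ch(1)
  have "((f \<otimes>\<^bsub>monoid_ring R M\<^esub> g) \<otimes>\<^bsub>monoid_ring R M\<^esub> h) x =
    (\<Oplus>u\<in>U. \<Oplus>w\<in>W. if u \<otimes>\<^bsub>M\<^esub> w = x then (f \<otimes>\<^bsub>monoid_ring R M\<^esub> g) u \<otimes> h w else \<zero>)"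
    by (rule monoid_ring_mult_eq[OF monoid_ring_mult_closed[OF f g] h U W(1,2)])
  also have "\<dots> = (\<Oplus>u\<in>U. \<Oplus>w\<in>W. \<Oplus>y\<in>Y. \<Oplus>z\<in>Z.
      if u = y \<otimes>\<^bsub>M\<^esub> z then (if u \<otimes>\<^bsub>M\<^esub> w = x then f y \<otimes> g z \<otimes> h w else \<zero>) else \<zero>)"
  proof (intro finsum_cong' refl)
    fix u w
    have "(f \<otimes>\<^bsub>monoid_ring R M\<^esub> g) u \<otimes> h w =
      (\<Oplus>y\<in>Y. (\<Oplus>z\<in>Z. if y \<otimes>\<^bsub>M\<^esub> z = u then f y \<otimes> g z else \<zero>) \<otimes> h w)"
      using cl Y Z by (simp add: monoid_ring_mult_eq[OF f g Y(1,2) Z(1,2)])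
        (subst finsum_ldistr, auto intro!: finsum_closed)
    also have "\<dots> = (\<Oplus>y\<in>Y. \<Oplus>z\<in>Z. (if y \<otimes>\<^bsub>M\<^esub> z = u then f y \<otimes> g z else \<zero>) \<otimes> h w)"
      using cl Y Z by (intro finsum_cong' finsum_ldistr) (auto intro!: finsum_closed)
    also have "\<dots> = (\<Oplus>y\<in>Y. \<Oplus>z\<in>Z. if u = y \<otimes>\<^bsub>M\<^esub> z then f y \<otimes> g z \<otimes> h w else \<zero>)"
      using cl by (intro finsum_cong') (auto intro!: finsum_closed)
    finally show "(if u \<otimes>\<^bsub>M\<^esub> w = x then (f \<otimes>\<^bsub>monoid_ring R M\<^esub> g) u \<otimes> h w else \<zero>) =
      (\<Oplus>y\<in>Y. \<Oplus>z\<in>Z.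
        if u = y \<otimes>\<^bsub>M\<^esub> z then (if u \<otimes>\<^bsub>M\<^esub> w = x then f y \<otimes> g z \<otimes> h w else \<zero>) else \<zero>)"
      by (auto intro!: add.finprod_one_eqI[symmetric] add.finprod_one_eqI cong: if_cong)
  qed (use cl in \<open>auto intro!: finsum_closed\<close>)
  also have "\<dots> = (\<Oplus>w\<in>W. \<Oplus>u\<in>U. \<Oplus>y\<in>Y. \<Oplus>z\<in>Z.
      if u = y \<otimes>\<^bsub>M\<^esub> z then (if u \<otimes>\<^bsub>M\<^esub> w = x then f y \<otimes> g z \<otimes> h w else \<zero>) else \<zero>)"
    using cl U W by (intro finsum_swap) (auto intro!: finsum_closed)
  also have "\<dots> = (\<Oplus>w\<in>W. \<Oplus>y\<in>Y. \<Oplus>u\<in>U. \<Oplus>z\<in>Z.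
      if u = y \<otimes>\<^bsub>M\<^esub> z then (if u \<otimes>\<^bsub>M\<^esub> w = x then f y \<otimes> g z \<otimes> h w else \<zero>) else \<zero>)"
    using cl U Y by (intro finsum_cong' finsum_swap) (auto intro!: finsum_closed)
  also have "\<dots> = (\<Oplus>w\<in>W. \<Oplus>y\<in>Y. \<Oplus>z\<in>Z. \<Oplus>u\<in>U.
      if u = y \<otimes>\<^bsub>M\<^esub> z then (if u \<otimes>\<^bsub>M\<^esub> w = x then f y \<otimes> g z \<otimes> h w else \<zero>) else \<zero>)"
    using cl U Z by (intro finsum_cong' finsum_swap) (auto intro!: finsum_closed)
  also have "\<dots> = (\<Oplus>w\<in>W. \<Oplus>y\<in>Y. \<Oplus>z\<in>Z.
      if (y \<otimes>\<^bsub>M\<^esub> z) \<otimes>\<^bsub>M\<^esub> w = x then f y \<otimes> g z \<otimes> h w else \<zero>)"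
    using cl U(1)
    by (intro finsum_cong' refl add.finprod_singleton_swap) (auto intro!: finsum_closed simp: U_def)
  also have "\<dots> = (\<Oplus>y\<in>Y. \<Oplus>w\<in>W. \<Oplus>z\<in>Z.
      if (y \<otimes>\<^bsub>M\<^esub> z) \<otimes>\<^bsub>M\<^esub> w = x then f y \<otimes> g z \<otimes> h w else \<zero>)"
    using cl Y W by (intro finsum_swap) (auto intro!: finsum_closed)
  also have "\<dots> = (\<Oplus>y\<in>Y. \<Oplus>z\<in>Z. \<Oplus>w\<in>W.
      if (y \<otimes>\<^bsub>M\<^esub> z) \<otimes>\<^bsub>M\<^esub> w = x then f y \<otimes> g z \<otimes> h w else \<zero>)"
    using cl Z W by (intro finsum_cong' finsum_swap) (auto intro!: finsum_closed)
  finally have left: "((f \<otimes>\<^bsub>monoid_ring R M\<^esub> g) \<otimes>\<^bsub>monoid_ring R M\<^esub> h) x = \<dots>" .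
  have "(f \<otimes>\<^bsub>monoid_ring R M\<^esub> (g \<otimes>\<^bsub>monoid_ring R M\<^esub> h)) x =
    (\<Oplus>y\<in>Y. \<Oplus>v\<in>V. if y \<otimes>\<^bsub>M\<^esub> v = x then f y \<otimes> (g \<otimes>\<^bsub>monoid_ring R M\<^esub> h) v else \<zero>)"
    by (rule monoid_ring_mult_eq[OF f monoid_ring_mult_closed[OF g h] Y(1,2) V])
  also have "\<dots> = (\<Oplus>y\<in>Y. \<Oplus>v\<in>V. \<Oplus>z\<in>Z. \<Oplus>w\<in>W.
      if v = z \<otimes>\<^bsub>M\<^esub> w then (if y \<otimes>\<^bsub>M\<^esub> v = x then f y \<otimes> g z \<otimes> h w else \<zero>) else \<zero>)"
  proof (intro finsum_cong' refl)
    fix y v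
    have "f y \<otimes> (g \<otimes>\<^bsub>monoid_ring R M\<^esub> h) v =
      (\<Oplus>z\<in>Z. f y \<otimes> (\<Oplus>w\<in>W. if z \<otimes>\<^bsub>M\<^esub> w = v then g z \<otimes> h w else \<zero>))"
      using cl W Z by (simp add: monoid_ring_mult_eq[OF g h Z(1,2) W(1,2)])
        (subst finsum_rdistr, auto intro!: finsum_closed)
    also have "\<dots> = (\<Oplus>z\<in>Z. \<Oplus>w\<in>W. f y \<otimes> (if z \<otimes>\<^bsub>M\<^esub> w = v then g z \<otimes> h w else \<zero>))"
      using cl W Z by (intro finsum_cong' finsum_rdistr) (auto intro!: finsum_closed)
    also have "\<dots> = (\<Oplus>z\<in>Z. \<Oplus>w\<in>W. if v = z \<otimes>\<^bsub>M\<^esub> w then f y \<otimes> g z \<otimes> h w else \<zero>)"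
      using cl by (intro finsum_cong') (auto intro!: finsum_closed simp: m_assoc)
    finally show "(if y \<otimes>\<^bsub>M\<^esub> v = x then f y \<otimes> (g \<otimes>\<^bsub>monoid_ring R M\<^esub> h) v else \<zero>) =
      (\<Oplus>z\<in>Z. \<Oplus>w\<in>W.
        if v = z \<otimes>\<^bsub>M\<^esub> w then (if y \<otimes>\<^bsub>M\<^esub> v = x then f y \<otimes> g z \<otimes> h w else \<zero>) else \<zero>)"
      by (auto intro!: add.finprod_one_eqI[symmetric] add.finprod_one_eqI cong: if_cong)
  qed (use cl in \<open>auto intro!: finsum_closed\<close>)
  also have "\<dots> = (\<Oplus>y\<in>Y. \<Oplus>z\<in>Z. \<Oplus>v\<in>V. \<Oplus>w\<in>W.
      if v = z \<otimes>\<^bsub>M\<^esub> w then (if y \<otimes>\<^bsub>M\<^esub> v = x then f y \<otimes> g z \<otimes> h w else \<zero>) else \<zero>)"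
    using cl V Z by (intro finsum_cong' finsum_swap) (auto intro!: finsum_closed)
  also have "\<dots> = (\<Oplus>y\<in>Y. \<Oplus>z\<in>Z. \<Oplus>w\<in>W. \<Oplus>v\<in>V.
      if v = z \<otimes>\<^bsub>M\<^esub> w then (if y \<otimes>\<^bsub>M\<^esub> v = x then f y \<otimes> g z \<otimes> h w else \<zero>) else \<zero>)"
    using cl V W by (intro finsum_cong' finsum_swap) (auto intro!: finsum_closed)
  also have "\<dots> = (\<Oplus>y\<in>Y. \<Oplus>z\<in>Z. \<Oplus>w\<in>W.
      if y \<otimes>\<^bsub>M\<^esub> (z \<otimes>\<^bsub>M\<^esub> w) = x then f y \<otimes> g z \<otimes> h w else \<zero>)"
    using cl V(1)
    by (intro finsum_cong' refl add.finprod_singleton_swap) (auto intro!: finsum_closed simp: V_def)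
  also have "\<dots> = (\<Oplus>y\<in>Y. \<Oplus>z\<in>Z. \<Oplus>w\<in>W.
      if (y \<otimes>\<^bsub>M\<^esub> z) \<otimes>\<^bsub>M\<^esub> w = x then f y \<otimes> g z \<otimes> h w else \<zero>)"
    using cl Y Z W M.m_assoc by (intro finsum_cong' refl) (auto intro!: finsum_closed simp: subset_iff)
  finally show "((f \<otimes>\<^bsub>monoid_ring R M\<^esub> g) \<otimes>\<^bsub>monoid_ring R M\<^esub> h) x =
    (f \<otimes>\<^bsub>monoid_ring R M\<^esub> (g \<otimes>\<^bsub>monoid_ring R M\<^esub> h)) x"
    using left by simp
qed

lemma monoid_ring_simps:
  "\<one>\<^bsub>monoid_ring R M\<^esub> = monomial R \<one> \<one>\<^bsub>M\<^esub>"
  "\<zero>\<^bsub>monoid_ring R M\<^esub> = (\<lambda>x. \<zero>)"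
  "f \<oplus>\<^bsub>monoid_ring R M\<^esub> g = (\<lambda>x. f x \<oplus> g x)"
  by (simp_all add: monoid_ring_def monomial_def fun_eq_iff)

lemma monomial_closed:
  assumes "c \<in> carrier R" "x \<in> carrier M"
  shows "monomial R c x \<in> carrier (monoid_ring R M)"
  using assms by (intro monoid_ring_carrierI[of _ "{x}"]) (auto simp: monomial_def)

lemma monoid_ring_add_closed:
  assumes f: "f \<in> carrier (monoid_ring R M)" and g: "g \<in> carrier (monoid_ring R M)"
  shows "f \<oplus>\<^bsub>monoid_ring R M\<^esub> g \<in> carrier (monoid_ring R M)"
  using monoid_ring_carrierD[OF f] monoid_ring_carrierD[OF g]
  by (intro monoid_ring_carrierI[of _ "{x. f x \<noteq> \<zero>} \<union> {x. g x \<noteq> \<zero>}"])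
    (auto simp: monoid_ring_simps)

lemma monoid_ring_ring: "ring (monoid_ring R M)"
proof (rule ringI)
  show "abelian_group (monoid_ring R M)"
  proof (rule abelian_groupI)
    fix f assume f: "f \<in> carrier (monoid_ring R M)"
    show "\<exists>g\<in>carrier (monoid_ring R M). g \<oplus>\<^bsub>monoid_ring R M\<^esub> f = \<zero>\<^bsub>monoid_ring R M\<^esub>"
    proof (rule bexI)
      show "(\<lambda>x. \<ominus> f x) \<in> carrier (monoid_ring R M)"
        using monoid_ring_carrierD[OF f]
        by (intro monoid_ring_carrierI[of _ "{x. f x \<noteq> \<zero>}"]) auto
    qed (use monoid_ring_carrierD[OF f] in \<open>auto simp: monoid_ring_simps l_neg\<close>)
  next
    show "\<zero>\<^bsub>monoid_ring R M\<^esub> \<in> carrier (monoid_ring R M)"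
      by (intro monoid_ring_carrierI[of _ "{}"]) (auto simp: monoid_ring_simps)
  qed (auto simp: monoid_ring_add_closed, auto simp: monoid_ring_simps monoid_ring_carrierD a_ac)
next
  show "Group.monoid (monoid_ring R M)"
  proof (rule monoidI)
    fix f assume f: "f \<in> carrier (monoid_ring R M)"
    note c = monoid_ring_carrierD[OF f]
    have s: "finite {\<one>\<^bsub>M\<^esub>}" "{x. monomial R \<one> \<one>\<^bsub>M\<^esub> x \<noteq> \<zero>} \<subseteq> {\<one>\<^bsub>M\<^esub>}"
      by (auto simp: monomial_def)
    have e: "monomial R \<one> \<one>\<^bsub>M\<^esub> \<in> carrier (monoid_ring R M)"
      by (rule monomial_closed) auto
    show "\<one>\<^bsub>monoid_ring R M\<^esub> \<otimes>\<^bsub>monoid_ring R M\<^esub> f = f"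
    proof
      fix x
      let ?X = "insert x {x. f x \<noteq> \<zero>}"
      have X: "finite ?X" "{x. f x \<noteq> \<zero>} \<subseteq> ?X" using c by auto
      have l: "(if \<one>\<^bsub>M\<^esub> \<otimes>\<^bsub>M\<^esub> z = x then f z else \<zero>) = (if z = x then f z else \<zero>)" for z
        by (cases "z \<in> carrier M") (use c(4)[of z] M.l_one[of z] in auto)
      have "(\<one>\<^bsub>monoid_ring R M\<^esub> \<otimes>\<^bsub>monoid_ring R M\<^esub> f) x =
        (\<Oplus>z\<in>?X. if \<one>\<^bsub>M\<^esub> \<otimes>\<^bsub>M\<^esub> z = x then f z else \<zero>)"
        unfolding monoid_ring_simps monoid_ring_mult_eq[OF e f s X] using c X
        by (subst finsum_insert)
          (auto simp: monomial_def intro!: finsum_closed finsum_cong')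
      also have "\<dots> = (\<Oplus>z\<in>?X. if z = x then f z else \<zero>)"
        by (simp only: l)
      also have "\<dots> = f x"
        using c by (intro add.finprod_singleton_swap) auto
      finally show "(\<one>\<^bsub>monoid_ring R M\<^esub> \<otimes>\<^bsub>monoid_ring R M\<^esub> f) x = f x" .
    qed
    show "f \<otimes>\<^bsub>monoid_ring R M\<^esub> \<one>\<^bsub>monoid_ring R M\<^esub> = f"
    proof
      fix x
      let ?X = "insert x {x. f x \<noteq> \<zero>}"
      have X: "finite ?X" "{x. f x \<noteq> \<zero>} \<subseteq> ?X" using c by auto
      have l: "(if z \<otimes>\<^bsub>M\<^esub> \<one>\<^bsub>M\<^esub> = x then f z else \<zero>) = (if z = x then f z else \<zero>)" for z
        by (cases "z \<in> carrier M") (use c(4)[of z] M.r_one[of z] in auto)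
      have "(f \<otimes>\<^bsub>monoid_ring R M\<^esub> \<one>\<^bsub>monoid_ring R M\<^esub>) x =
        (\<Oplus>z\<in>?X. if z \<otimes>\<^bsub>M\<^esub> \<one>\<^bsub>M\<^esub> = x then f z else \<zero>)"
        unfolding monoid_ring_simps monoid_ring_mult_eq[OF f e X s] using c X
        by (intro finsum_cong') (auto simp: monomial_def intro!: finsum_closed)
      also have "\<dots> = (\<Oplus>z\<in>?X. if z = x then f z else \<zero>)"
        by (simp only: l)
      also have "\<dots> = f x"
        using c by (intro add.finprod_singleton_swap) auto
      finally show "(f \<otimes>\<^bsub>monoid_ring R M\<^esub> \<one>\<^bsub>monoid_ring R M\<^esub>) x = f x" .
    qed
  next
    show "\<one>\<^bsub>monoid_ring R M\<^esub> \<in> carrier (monoid_ring R M)"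
      unfolding monoid_ring_simps by (rule monomial_closed) auto
  qed (auto intro: monoid_ring_mult_closed monoid_ring_assoc)
next
  fix f g h
  assume f: "f \<in> carrier (monoid_ring R M)" and g: "g \<in> carrier (monoid_ring R M)"
    and h: "h \<in> carrier (monoid_ring R M)"
  note cf = monoid_ring_carrierD[OF f] and cg = monoid_ring_carrierD[OF g]
    and ch = monoid_ring_carrierD[OF h]
  let ?S = "{x. f x \<noteq> \<zero>} \<union> {x. g x \<noteq> \<zero>}"
  let ?T = "{x. h x \<noteq> \<zero>}"
  have S: "finite ?S" "{x. f x \<noteq> \<zero>} \<subseteq> ?S" "{x. g x \<noteq> \<zero>} \<subseteq> ?S"
      "{x. (f \<oplus>\<^bsub>monoid_ring R M\<^esub> g) x \<noteq> \<zero>} \<subseteq> ?S"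
    and T: "finite ?T" "?T \<subseteq> ?T"
    using cf cg ch by (auto simp: monoid_ring_simps)
  note fg = monoid_ring_add_closed[OF f g]
  show "(f \<oplus>\<^bsub>monoid_ring R M\<^esub> g) \<otimes>\<^bsub>monoid_ring R M\<^esub> h =
    f \<otimes>\<^bsub>monoid_ring R M\<^esub> h \<oplus>\<^bsub>monoid_ring R M\<^esub> g \<otimes>\<^bsub>monoid_ring R M\<^esub> h"
  proof
    fix x
    show "((f \<oplus>\<^bsub>monoid_ring R M\<^esub> g) \<otimes>\<^bsub>monoid_ring R M\<^esub> h) x =
      (f \<otimes>\<^bsub>monoid_ring R M\<^esub> h \<oplus>\<^bsub>monoid_ring R M\<^esub> g \<otimes>\<^bsub>monoid_ring R M\<^esub> h) x"
      unfolding monoid_ring_simps(3)[of "f \<otimes>\<^bsub>monoid_ring R M\<^esub> h"]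
        monoid_ring_mult_eq[OF fg h S(1,4) T] monoid_ring_mult_eq[OF f h S(1,2) T]
        monoid_ring_mult_eq[OF g h S(1,3) T]
      using cf(1) cg(1) ch(1)
      by (intro finsum2_addf) (simp_all add: monoid_ring_simps l_distr)
  qed
  show "h \<otimes>\<^bsub>monoid_ring R M\<^esub> (f \<oplus>\<^bsub>monoid_ring R M\<^esub> g) =
    h \<otimes>\<^bsub>monoid_ring R M\<^esub> f \<oplus>\<^bsub>monoid_ring R M\<^esub> h \<otimes>\<^bsub>monoid_ring R M\<^esub> g"
  proof
    fix x
    show "(h \<otimes>\<^bsub>monoid_ring R M\<^esub> (f \<oplus>\<^bsub>monoid_ring R M\<^esub> g)) x =
      (h \<otimes>\<^bsub>monoid_ring R M\<^esub> f \<oplus>\<^bsub>monoid_ring R M\<^esub> h \<otimes>\<^bsub>monoid_ring R M\<^esub> g) x"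
      unfolding monoid_ring_simps(3)[of "h \<otimes>\<^bsub>monoid_ring R M\<^esub> f"]
        monoid_ring_mult_eq[OF h fg T S(1,4)] monoid_ring_mult_eq[OF h f T S(1,2)]
        monoid_ring_mult_eq[OF h g T S(1,3)]
      using cf(1) cg(1) ch(1)
      by (intro finsum2_addf) (simp_all add: monoid_ring_simps r_distr)
  qed
qed

end

section \<open>The exterior algebra of a free module over a commutative ring\<close>

text \<open>
  The tensor algebra of the free module \<open>R\<^sup>n\<close> with basis \<open>e\<^sub>1, \<dots>, e\<^sub>n\<close> is the free algebra on the
  letters \<open>1, \<dots>, n\<close>, i.e. the monoid ring over \<open>R\<close> of the monoid of words; a word stands for
  the tensor of the corresponding basis vectors, and \<open>R\<^sup>n\<close> itself is the part of degree one. The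
  exterior algebra is the quotient by the ideal generated by all \<open>v \<otimes> v\<close> with \<open>v \<in> R\<^sup>n\<close>.
\<close>

definition word_monoid :: "nat \<Rightarrow> nat list monoid" where
  "word_monoid n = \<lparr>carrier = lists {1..n}, monoid.mult = (@), one = []\<rparr>"

definition tensor_algebra :: "('a, 'm) ring_scheme \<Rightarrow> nat \<Rightarrow> (nat list \<Rightarrow> 'a) ring" where
  "tensor_algebra R n = monoid_ring R (word_monoid n)"

definition degree_one_part :: "('a, 'm) ring_scheme \<Rightarrow> nat \<Rightarrow> (nat list \<Rightarrow> 'a) set" where
  "degree_one_part R n =
     {v \<in> carrier (tensor_algebra R n). \<forall>w. v w \<noteq> \<zero>\<^bsub>R\<^esub> \<longrightarrow> length w = 1}"

definition exterior_ideal :: "('a, 'm) ring_scheme \<Rightarrow> nat \<Rightarrow> (nat list \<Rightarrow> 'a) set" where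
  "exterior_ideal R n =
     Idl\<^bsub>tensor_algebra R n\<^esub> {v \<otimes>\<^bsub>tensor_algebra R n\<^esub> v | v. v \<in> degree_one_part R n}"

definition exterior_algebra :: "('a, 'm) ring_scheme \<Rightarrow> nat \<Rightarrow> (nat list \<Rightarrow> 'a) set ring" where
  "exterior_algebra R n = tensor_algebra R n Quot exterior_ideal R n"

definition exterior_scalar :: "('a, 'm) ring_scheme \<Rightarrow> nat \<Rightarrow> 'a \<Rightarrow> (nat list \<Rightarrow> 'a) set" where
  "exterior_scalar R n c = exterior_ideal R n +>\<^bsub>tensor_algebra R n\<^esub> monomial R c []"

lemma word_monoid_monoid: "Group.monoid (word_monoid n)"
  by (rule monoidI) (auto simp: word_monoid_def)

lemma tensor_algebra_ring: "ring R \<Longrightarrow> ring (tensor_algebra R n)"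
  unfolding tensor_algebra_def by (intro monoid_ring_ring word_monoid_monoid)

lemma exterior_ideal_ideal:
  assumes "ring R"
  shows "ideal (exterior_ideal R n) (tensor_algebra R n)"
proof -
  interpret T: ring "tensor_algebra R n" by (rule tensor_algebra_ring) fact
  show ?thesis unfolding exterior_ideal_def
    by (rule T.genideal_ideal) (auto simp: degree_one_part_def)
qed

lemma exterior_algebra_ring: "ring R \<Longrightarrow> ring (exterior_algebra R n)"
  unfolding exterior_algebra_def by (intro ideal.quotient_is_ring exterior_ideal_ideal)

lemma exterior_scalar_closed:
  assumes "ring R" "c \<in> carrier R"
  shows "exterior_scalar R n c \<in> carrier (exterior_algebra R n)"
proof -
  interpret T: ring "tensor_algebra R n" by (rule tensor_algebra_ring) fact
  have "monomial R c [] \<in> carrier (tensor_algebra R n)"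
    unfolding tensor_algebra_def
    by (rule monomial_closed) (use assms word_monoid_monoid in \<open>auto simp: word_monoid_def\<close>)
  then show ?thesis
    by (auto simp: exterior_scalar_def exterior_algebra_def FactRing_def A_RCOSETS_def'
        intro: a_r_coset_def[symmetric])
qed


section \<open>Tensor products of algebras\<close>

text \<open>
  Let \<open>\<alpha>\<close> and \<open>\<beta>\<close> be the structure maps of two algebras \<open>A\<close> and \<open>B\<close> over the commutative ring \<open>K\<close>
  (so their values on \<open>K\<close> are central). The additive group of \<open>A \<otimes>\<^sub>K B\<close> is the free abelian group
  on \<open>A \<times> B\<close> modulo the usual relations, with product \<open>(a \<otimes> b)(a' \<otimes> b') = aa' \<otimes> bb'\<close>. The free
  abelian group with that product is the integral monoid ring of the multiplicative monoid
  \<open>A \<times> B\<close>. The set of relations is stable under multiplication by pairs \<open>(a, b)\<close> on either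
  side, so the subgroup generated by it is already the ideal generated by it.
\<close>

definition tensor_relations ::
    "('k, 'l) ring_scheme \<Rightarrow> ('a, 'm) ring_scheme \<Rightarrow> ('k \<Rightarrow> 'a) \<Rightarrow>
     ('b, 'n) ring_scheme \<Rightarrow> ('k \<Rightarrow> 'b) \<Rightarrow> ('a \<times> 'b \<Rightarrow> int) set" where
  "tensor_relations K A \<alpha> B \<beta> =
     (let F = monoid_ring int_ring (A \<times>\<times> B);
          d = (\<lambda>a b. monomial int_ring 1 (a, b))
      in {d (a \<oplus>\<^bsub>A\<^esub> a') b \<ominus>\<^bsub>F\<^esub> (d a b \<oplus>\<^bsub>F\<^esub> d a' b) | a a' b.
            a \<in> carrier A \<and> a' \<in> carrier A \<and> b \<in> carrier B} \<union>
         {d a (b \<oplus>\<^bsub>B\<^esub> b') \<ominus>\<^bsub>F\<^esub> (d a b \<oplus>\<^bsub>F\<^esub> d a b') | a b b'.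
            a \<in> carrier A \<and> b \<in> carrier B \<and> b' \<in> carrier B} \<union>
         {d (a \<otimes>\<^bsub>A\<^esub> \<alpha> c) b \<ominus>\<^bsub>F\<^esub> d a (\<beta> c \<otimes>\<^bsub>B\<^esub> b) | a b c.
            a \<in> carrier A \<and> b \<in> carrier B \<and> c \<in> carrier K})"

definition algebra_tensor_product ::
    "('k, 'l) ring_scheme \<Rightarrow> ('a, 'm) ring_scheme \<Rightarrow> ('k \<Rightarrow> 'a) \<Rightarrow>
     ('b, 'n) ring_scheme \<Rightarrow> ('k \<Rightarrow> 'b) \<Rightarrow> ('a \<times> 'b \<Rightarrow> int) set ring" where
  "algebra_tensor_product K A \<alpha> B \<beta> =
     monoid_ring int_ring (A \<times>\<times> B) Quot
       (Idl\<^bsub>monoid_ring int_ring (A \<times>\<times> B)\<^esub> (tensor_relations K A \<alpha> B \<beta>))"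

lemma algebra_tensor_product_ring:
  assumes "ring A" "ring B" "\<alpha> \<in> carrier K \<rightarrow> carrier A" "\<beta> \<in> carrier K \<rightarrow> carrier B"
  shows "ring (algebra_tensor_product K A \<alpha> B \<beta>)"
proof -
  interpret A: ring A by fact
  interpret B: ring B by fact
  let ?F = "monoid_ring int_ring (A \<times>\<times> B)"
  have Z: "ring int_ring" using int_is_cring by (rule cring.axioms)
  have M: "Group.monoid (A \<times>\<times> B)"
    by (rule DirProd_monoid) (rule A.monoid_axioms B.monoid_axioms)+
  interpret F: ring ?F by (rule monoid_ring_ring[OF Z M])
  have d: "monomial int_ring 1 (a, b) \<in> carrier ?F" if "a \<in> carrier A" "b \<in> carrier B" for a b
    by (rule monomial_closed[OF Z M]) (use that in auto)
  have "tensor_relations K A \<alpha> B \<beta> \<subseteq> carrier ?F"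
    unfolding tensor_relations_def Let_def using assms(3,4)
    by (auto simp del: monoid.simps intro!: F.minus_closed F.a_closed d)
  then show ?thesis unfolding algebra_tensor_product_def
    by (intro ideal.quotient_is_ring F.genideal_ideal)
qed


section \<open>The exterior algebra over a ring that need not be commutative\<close>

text \<open>\<open>\<Lambda>(A\<^sup>n) = A \<otimes>\<^sub>C \<Lambda>(C\<^sup>n)\<close>, where \<open>C\<close> is the center of \<open>A\<close>.\<close>

definition exterior_algebra_nc ::
    "('a, 'm) ring_scheme \<Rightarrow> nat \<Rightarrow> ('a \<times> (nat list \<Rightarrow> 'a) set \<Rightarrow> int) set ring" where
  "exterior_algebra_nc A n =
     algebra_tensor_product (center_ring A) A (\<lambda>c. c)
       (exterior_algebra (center_ring A) n) (exterior_scalar (center_ring A) n)"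

lemma exterior_algebra_nc_ring:
  assumes "ring A"
  shows "ring (exterior_algebra_nc A n)"
proof -
  have C: "ring (center_ring A)" using center_ring_cring[OF assms] by (rule cring.axioms)
  show ?thesis unfolding exterior_algebra_nc_def
    by (intro algebra_tensor_product_ring exterior_algebra_ring assms C Pi_I exterior_scalar_closed)
      (auto simp: center_ring_def center_def)
qed

end

theory Submission
  imports Defs
begin

text \<open>
  The theorem becomes a computation once \<open>\<Lambda>(A\<^sup>n)\<close> is known to be free over \<open>A\<close> on the products \<open>e\<^sub>S\<close>
  of basis vectors, \<open>S \<subseteq> {1..n}\<close>.

  Coordinates. The ring \<open>E\<close> of functions from subsets of \<open>{1..n}\<close> to \<open>A\<close>, with the product determined by
  \<open>(a e\<^sub>S)(b e\<^sub>T) = \<plusminus> a b e\<^bsub>S \<union> T\<^esub>\<close> for disjoint \<open>S\<close> and \<open>T\<close> and zero otherwise, is constructed directly;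
  its sign is the parity of the inversions between \<open>S\<close> and \<open>T\<close>. The universal properties of the monoid
  ring and of quotients give homomorphisms from \<open>\<Lambda>(C\<^sup>n)\<close>, and then from \<open>A \<otimes>\<^sub>C \<Lambda>(C\<^sup>n)\<close>, to \<open>E\<close>. The
  second one is an isomorphism (\<open>coords_iso\<close>): sorting words shows that the \<open>e\<^sub>S\<close> span, which yields a
  left inverse, and every \<open>a e\<^sub>S\<close> is hit.

  The center. An element of \<open>E\<close> is central iff its coefficients are central in \<open>A\<close> and those on odd sets
  \<open>S \<noteq> {1..n}\<close> are killed by 2 (\<open>center_E_iff\<close>).

  Sufficiency. Given a nonzero element, multiply by one element of the center of \<open>A\<close> that makes all
  coefficients central without killing all of them. If \<open>2\<^sup>m = 0\<close> in \<open>A\<close>, a further power of 2 makes the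
  element killed by 2, hence central (\<open>central_multiple_two_power\<close>). If \<open>n\<close> is odd, multiplication by
  \<open>e\<^sub>T\<close> for a suitable even set \<open>T\<close> pushes the smallest obstructing odd component into the top degree,
  where it obstructs nothing (\<open>central_multiple_odd\<close>).

  Necessity. Multiples of \<open>r e\<^bsub>{1..n}\<^esub>\<close> show that \<open>A\<close> is centrally essential
  (\<open>centrally_essential_coefficients\<close>). If \<open>n\<close> is even and \<open>a \<noteq> 0\<close> is such that \<open>a A\<close> has no 2-torsion, then
  \<open>a e\<^sub>1\<close> has no nonzero central multiple (\<open>not_centrally_essential_even\<close>). If the characteristic is
  finite and not a power of 2, the largest power of 2 dividing it is such an \<open>a\<close>; in a ring without
  zero divisors whose characteristic is not 2, one can take \<open>a = 1\<close>.
\<close>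

section \<open>Finitely supported functions and maps out of monoid rings\<close>

text \<open>
  Additive identities on monoid rings and on the coordinate ring below are checked on one-term
  functions: peel off one point of the support at a time.
\<close>

lemma finite_support_induct:
  fixes R :: "('r, 'k) ring_scheme" (structure)
  assumes "ring R" and "finite X" and "\<And>x. f x \<in> carrier R" and "{x. f x \<noteq> \<zero>} \<subseteq> X"
    and zero: "P (\<lambda>x. \<zero>)"
    and monomial: "\<And>c x. c \<in> carrier R \<Longrightarrow> x \<in> X \<Longrightarrow> P (monomial R c x)"
    and add: "\<And>g h. P g \<Longrightarrow> P h \<Longrightarrow> P (\<lambda>x. g x \<oplus> h x)"
  shows "P f"
proof -
  interpret ring R by fact
  from assms(2,3,4) monomial show ?thesis
  proof (induction X arbitrary: f)
    case empty
    then have "f = (\<lambda>x. \<zero>)" by auto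
    then show ?case using zero by simp
  next
    case (insert a X)
    let ?g = "f(a := \<zero>)"
    have "P ?g"
    proof (rule insert.IH)
      show "?g x \<in> carrier R" for x using insert.prems(1) by simp
      show "{x. ?g x \<noteq> \<zero>} \<subseteq> X" using insert.prems(2) by auto
      show "P (monomial R c x)" if "c \<in> carrier R" "x \<in> X" for c x
        using that insert.prems(3) by blast
    qed
    moreover have "P (monomial R (f a) a)"
      using insert.prems(1,3) by blast
    ultimately have "P (\<lambda>x. monomial R (f a) a x \<oplus> ?g x)"
      by (intro add)
    moreover have "(\<lambda>x. monomial R (f a) a x \<oplus> ?g x) = f"
      using insert.prems(1) by (auto simp: monomial_def fun_eq_iff)
    ultimately show ?case by simp
  qed
qed

lemma monomial_mult:
  fixes R :: "('r, 'k) ring_scheme" (structure) and M :: "('m, 'l) monoid_scheme"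
  assumes R: "ring R" and M: "Group.monoid M"
    and "c \<in> carrier R" "d \<in> carrier R" "x \<in> carrier M" "y \<in> carrier M"
  shows "monomial R c x \<otimes>\<^bsub>monoid_ring R M\<^esub> monomial R d y = monomial R (c \<otimes> d) (x \<otimes>\<^bsub>M\<^esub> y)"
proof
  fix z
  interpret ring R by (rule R)
  have "(monomial R c x \<otimes>\<^bsub>monoid_ring R M\<^esub> monomial R d y) z =
    (\<Oplus>u\<in>{x}. \<Oplus>v\<in>{y}. if u \<otimes>\<^bsub>M\<^esub> v = z then monomial R c x u \<otimes> monomial R d y v else \<zero>)"
    by (rule monoid_ring_mult_eq[OF R M monomial_closed[OF R M] monomial_closed[OF R M]])
      (use assms in \<open>auto simp: monomial_def\<close>)
  also have "\<dots> = monomial R (c \<otimes> d) (x \<otimes>\<^bsub>M\<^esub> y) z"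
    using assms by (simp add: monomial_def)
  finally show "(monomial R c x \<otimes>\<^bsub>monoid_ring R M\<^esub> monomial R d y) z =
    monomial R (c \<otimes> d) (x \<otimes>\<^bsub>M\<^esub> y) z" .
qed

text \<open>
  The linear extension of \<open>\<theta>\<close> along the change of scalars \<open>\<rho>\<close>. It carries the universal property of
  the monoid ring, which is needed once for the tensor algebra and once for the integral monoid
  ring that presents the tensor product.
\<close>

definition monoid_ring_eval ::
    "('r, 'k) ring_scheme \<Rightarrow> ('e, 'j) ring_scheme \<Rightarrow> ('r \<Rightarrow> 'e) \<Rightarrow> ('m \<Rightarrow> 'e) \<Rightarrow> ('m \<Rightarrow> 'r) \<Rightarrow> 'e" where
  "monoid_ring_eval R E \<rho> \<theta> f = (\<Oplus>\<^bsub>E\<^esub>m\<in>{m. f m \<noteq> \<zero>\<^bsub>R\<^esub>}. \<rho> (f m) \<otimes>\<^bsub>E\<^esub> \<theta> m)"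

text \<open>
  Additivity holds because the defining sum may be taken over any finite set containing the
  support. Both sides of the multiplicativity law are then biadditive, so it only needs to be
  checked on monomials, where it is the hypothesis that \<open>\<theta>\<close> is multiplicative and that its values
  commute with scalars.
\<close>

lemma monoid_ring_eval_hom:
  fixes R :: "('r, 'k) ring_scheme" and M :: "('m, 'l) monoid_scheme"
    and E :: "('e, 'j) ring_scheme"
  assumes R: "ring R" and M: "Group.monoid M" and E: "ring E"
    and rho: "\<rho> \<in> ring_hom R E"
    and theta: "\<And>m. m \<in> carrier M \<Longrightarrow> \<theta> m \<in> carrier E"
    and theta_one: "\<theta> \<one>\<^bsub>M\<^esub> = \<one>\<^bsub>E\<^esub>"
    and theta_mult: "\<And>m k. m \<in> carrier M \<Longrightarrow> k \<in> carrier M \<Longrightarrow>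
      \<theta> (m \<otimes>\<^bsub>M\<^esub> k) = \<theta> m \<otimes>\<^bsub>E\<^esub> \<theta> k"
    and comm: "\<And>r m. r \<in> carrier R \<Longrightarrow> m \<in> carrier M \<Longrightarrow>
      \<rho> r \<otimes>\<^bsub>E\<^esub> \<theta> m = \<theta> m \<otimes>\<^bsub>E\<^esub> \<rho> r"
  shows "monoid_ring_eval R E \<rho> \<theta> \<in> ring_hom (monoid_ring R M) E" (is "?ev \<in> _")
    and "c \<in> carrier R \<Longrightarrow> m \<in> carrier M \<Longrightarrow>
      monoid_ring_eval R E \<rho> \<theta> (monomial R c m) = \<rho> c \<otimes>\<^bsub>E\<^esub> \<theta> m"
proof -
  interpret R: ring R by (rule R)
  interpret M: Group.monoid M by (rule M)
  interpret E: ring E by (rule E)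
  interpret h: ring_hom_ring R E \<rho> by (rule ring_hom_ringI2[OF R E rho])
  let ?F = "monoid_ring R M"
  interpret F: ring ?F by (rule monoid_ring_ring[OF R M])
  note D = monoid_ring_carrierD[OF R M] and simps = monoid_ring_simps[OF R M]
  have eq: "?ev f = (\<Oplus>\<^bsub>E\<^esub>m\<in>X. \<rho> (f m) \<otimes>\<^bsub>E\<^esub> \<theta> m)"
    if "f \<in> carrier ?F" "finite X" "{m. f m \<noteq> \<zero>\<^bsub>R\<^esub>} \<subseteq> X" "X \<subseteq> carrier M" for f X
    unfolding monoid_ring_eval_def
  proof (rule E.add.finprod_mono_neutral_cong_left)
    show "(\<lambda>m. \<rho> (f m) \<otimes>\<^bsub>E\<^esub> \<theta> m) \<in> X \<rightarrow> carrier E"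
      using D(1)[OF that(1)] that(4) theta by (intro Pi_I E.m_closed h.hom_closed) blast+
    show "\<rho> (f m) \<otimes>\<^bsub>E\<^esub> \<theta> m = \<zero>\<^bsub>E\<^esub>" if "m \<in> X - {m. f m \<noteq> \<zero>\<^bsub>R\<^esub>}" for m
      using that \<open>X \<subseteq> carrier M\<close> theta by auto
  qed (use that in auto)
  have cl: "?ev f \<in> carrier E" if "f \<in> carrier ?F" for f
    unfolding monoid_ring_eval_def using D[OF that] theta by (intro E.finsum_closed) auto
  have add: "?ev (f \<oplus>\<^bsub>?F\<^esub> g) = ?ev f \<oplus>\<^bsub>E\<^esub> ?ev g"
    if fg: "f \<in> carrier ?F" "g \<in> carrier ?F" for f g
  proof -
    let ?X = "{m. f m \<noteq> \<zero>\<^bsub>R\<^esub>} \<union> {m. g m \<noteq> \<zero>\<^bsub>R\<^esub>}"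
    note Df = D[OF fg(1)] and Dg = D[OF fg(2)]
    have X: "m \<in> carrier M" if "m \<in> ?X" for m using that Df(2) Dg(2) by blast
    have cf: "\<rho> (f m) \<otimes>\<^bsub>E\<^esub> \<theta> m \<in> carrier E" "\<rho> (g m) \<otimes>\<^bsub>E\<^esub> \<theta> m \<in> carrier E"
      "\<rho> ((f \<oplus>\<^bsub>?F\<^esub> g) m) \<otimes>\<^bsub>E\<^esub> \<theta> m = \<rho> (f m) \<otimes>\<^bsub>E\<^esub> \<theta> m \<oplus>\<^bsub>E\<^esub> \<rho> (g m) \<otimes>\<^bsub>E\<^esub> \<theta> m"
      if "m \<in> ?X" for m
      using Df(1)[of m] Dg(1)[of m] theta[OF X[OF that]] by (simp_all add: simps E.l_distr)
    have "?ev (f \<oplus>\<^bsub>?F\<^esub> g) = (\<Oplus>\<^bsub>E\<^esub>m\<in>?X. \<rho> ((f \<oplus>\<^bsub>?F\<^esub> g) m) \<otimes>\<^bsub>E\<^esub> \<theta> m)"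
      by (rule eq[OF F.a_closed[OF fg]]) (use Df Dg in \<open>auto simp: simps\<close>)
    also have "\<dots> = (\<Oplus>\<^bsub>E\<^esub>m\<in>?X. \<rho> (f m) \<otimes>\<^bsub>E\<^esub> \<theta> m \<oplus>\<^bsub>E\<^esub> \<rho> (g m) \<otimes>\<^bsub>E\<^esub> \<theta> m)"
      using cf by (intro E.finsum_cong') auto
    also have "\<dots> = (\<Oplus>\<^bsub>E\<^esub>m\<in>?X. \<rho> (f m) \<otimes>\<^bsub>E\<^esub> \<theta> m) \<oplus>\<^bsub>E\<^esub> (\<Oplus>\<^bsub>E\<^esub>m\<in>?X. \<rho> (g m) \<otimes>\<^bsub>E\<^esub> \<theta> m)"
      using cf by (intro E.finsum_addf) auto
    also have "\<dots> = ?ev f \<oplus>\<^bsub>E\<^esub> ?ev g"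
      using Df Dg fg eq[of f ?X] eq[of g ?X] by auto
    finally show ?thesis .
  qed
  have mon: "?ev (monomial R c m) = \<rho> c \<otimes>\<^bsub>E\<^esub> \<theta> m" if "c \<in> carrier R" "m \<in> carrier M" for c m
  proof -
    have "{k. monomial R c m k \<noteq> \<zero>\<^bsub>R\<^esub>} \<subseteq> {m}" by (auto simp: monomial_def)
    from eq[OF monomial_closed[OF R M that] _ this] show ?thesis
      using that theta by (simp add: monomial_def)
  qed
  note mc = monomial_closed[OF R M]
  have z: "?ev (\<lambda>x. \<zero>\<^bsub>R\<^esub>) = \<zero>\<^bsub>E\<^esub>"
    by (simp add: monoid_ring_eval_def)
  have zc: "(\<lambda>x. \<zero>\<^bsub>R\<^esub>) \<in> carrier ?F" using F.zero_closed by (simp add: simps)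
  have ac: "(\<lambda>x. g x \<oplus>\<^bsub>R\<^esub> h x) \<in> carrier ?F" if "g \<in> carrier ?F" "h \<in> carrier ?F" for g h
    using F.a_closed[OF that] by (simp add: simps)
  have mult1: "?ev (monomial R c m \<otimes>\<^bsub>?F\<^esub> g) = ?ev (monomial R c m) \<otimes>\<^bsub>E\<^esub> ?ev g"
    if cm: "c \<in> carrier R" "m \<in> carrier M" and g: "g \<in> carrier ?F" for c m g
  proof -
    have "g \<in> carrier ?F \<and> ?ev (monomial R c m \<otimes>\<^bsub>?F\<^esub> g) = ?ev (monomial R c m) \<otimes>\<^bsub>E\<^esub> ?ev g"
    proof (rule finite_support_induct[OF R D(3)[OF g] D(1)[OF g] order.refl], goal_cases)
      case 1
      then show ?case
        using F.r_null[OF mc[OF cm]] z cl[OF mc[OF cm]] zc by (simp add: simps)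
    next
      case (2 d k)
      then have dk: "d \<in> carrier R" "k \<in> carrier M" using D(2)[OF g] by auto
      have "\<rho> (c \<otimes>\<^bsub>R\<^esub> d) \<otimes>\<^bsub>E\<^esub> \<theta> (m \<otimes>\<^bsub>M\<^esub> k) = \<rho> c \<otimes>\<^bsub>E\<^esub> (\<rho> d \<otimes>\<^bsub>E\<^esub> \<theta> m) \<otimes>\<^bsub>E\<^esub> \<theta> k"
        using cm dk theta by (simp add: theta_mult E.m_assoc)
      also have "\<dots> = \<rho> c \<otimes>\<^bsub>E\<^esub> (\<theta> m \<otimes>\<^bsub>E\<^esub> \<rho> d) \<otimes>\<^bsub>E\<^esub> \<theta> k"
        using cm dk by (simp add: comm)
      also have "\<dots> = (\<rho> c \<otimes>\<^bsub>E\<^esub> \<theta> m) \<otimes>\<^bsub>E\<^esub> (\<rho> d \<otimes>\<^bsub>E\<^esub> \<theta> k)"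
        using cm dk theta by (simp add: E.m_assoc)
      finally show ?case
        using cm dk by (simp add: monomial_mult[OF R M] mon mc)
    next
      case (3 g h)
      then have gh: "g \<in> carrier ?F" "h \<in> carrier ?F" by auto
      have "?ev (monomial R c m \<otimes>\<^bsub>?F\<^esub> (g \<oplus>\<^bsub>?F\<^esub> h)) =
        ?ev (monomial R c m) \<otimes>\<^bsub>E\<^esub> ?ev (g \<oplus>\<^bsub>?F\<^esub> h)"
        using 3 mc[OF cm] cl by (simp add: F.r_distr add E.r_distr)
      then show ?case using ac[OF gh] by (simp add: simps)
    qed
    then show ?thesis ..
  qed
  have mult: "?ev (f \<otimes>\<^bsub>?F\<^esub> g) = ?ev f \<otimes>\<^bsub>E\<^esub> ?ev g"
    if f: "f \<in> carrier ?F" and g: "g \<in> carrier ?F" for f g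
  proof -
    have "f \<in> carrier ?F \<and> ?ev (f \<otimes>\<^bsub>?F\<^esub> g) = ?ev f \<otimes>\<^bsub>E\<^esub> ?ev g"
    proof (rule finite_support_induct[OF R D(3)[OF f] D(1)[OF f] order.refl], goal_cases)
      case 1
      then show ?case using F.l_null[OF g] z cl[OF g] zc by (simp add: simps)
    next
      case (2 d k)
      then show ?case using D(2)[OF f] mult1 g mc by auto
    next
      case (3 f h)
      then have fh: "f \<in> carrier ?F" "h \<in> carrier ?F" by auto
      have "?ev ((f \<oplus>\<^bsub>?F\<^esub> h) \<otimes>\<^bsub>?F\<^esub> g) = ?ev (f \<oplus>\<^bsub>?F\<^esub> h) \<otimes>\<^bsub>E\<^esub> ?ev g"
        using 3 g cl by (simp add: F.l_distr add E.l_distr)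
      then show ?case using ac[OF fh] by (simp add: simps)
    qed
    then show ?thesis ..
  qed
  show "?ev \<in> ring_hom ?F E"
  proof (rule ring_hom_memI)
    show "?ev \<one>\<^bsub>?F\<^esub> = \<one>\<^bsub>E\<^esub>"
      unfolding simps by (subst mon) (auto simp: theta_one)
  qed (auto simp: cl add mult)
  show "?ev (monomial R c m) = \<rho> c \<otimes>\<^bsub>E\<^esub> \<theta> m" if "c \<in> carrier R" "m \<in> carrier M"
    by (rule mon[OF that])
qed

text \<open>
  A ring homomorphism that vanishes on \<open>I\<close> is constant on every coset of \<open>I\<close>, so its image on a
  coset is a singleton.
\<close>

lemma ring_hom_factor:
  fixes R (structure) and S (structure)
  assumes "ideal I R" and S: "ring S" and h: "h \<in> ring_hom R S"
    and kill: "\<And>x. x \<in> I \<Longrightarrow> h x = \<zero>\<^bsub>S\<^esub>"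
  shows "(\<lambda>X. the_elem (h ` X)) \<in> ring_hom (R Quot I) S"
    and "x \<in> carrier R \<Longrightarrow> the_elem (h ` (I +>\<^bsub>R\<^esub> x)) = h x"
proof -
  interpret ideal I R by fact
  interpret S: ring S by (rule S)
  interpret h: ring_hom_ring R S h by (rule ring_hom_ringI2[OF ring_axioms S h])
  interpret p: ring_hom_ring R "R Quot I" "(+>) I" by (rule rcos_ring_hom_ring)
  have el: "the_elem (h ` (I +> x)) = h x" if x: "x \<in> carrier R" for x
  proof -
    have "h y = h x" if y: "y \<in> I +> x" for y
    proof -
      obtain k where k: "k \<in> I" "y = k \<oplus> x" using y by (auto simp: a_r_coset_def')
      then show ?thesis using x by (simp add: kill)
    qed
    moreover have "x \<in> I +> x" using x by (rule a_rcos_self)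
    ultimately have "h ` (I +> x) = {h x}" by blast
    then show ?thesis by simp
  qed
  have cos: "\<exists>x \<in> carrier R. X = I +> x" if "X \<in> carrier (R Quot I)" for X
    using that unfolding FactRing_def A_RCOSETS_def' by auto
  show "(\<lambda>X. the_elem (h ` X)) \<in> ring_hom (R Quot I) S"
  proof (rule ring_hom_memI)
    fix X Y assume "X \<in> carrier (R Quot I)" "Y \<in> carrier (R Quot I)"
    then obtain x y where x: "x \<in> carrier R" "X = I +> x" and y: "y \<in> carrier R" "Y = I +> y"
      using cos by metis
    have "X \<otimes>\<^bsub>R Quot I\<^esub> Y = I +> (x \<otimes> y)" "X \<oplus>\<^bsub>R Quot I\<^esub> Y = I +> (x \<oplus> y)"
      unfolding x y p.hom_mult[OF x(1) y(1)] p.hom_add[OF x(1) y(1)] by (rule refl)+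
    then show "the_elem (h ` (X \<otimes>\<^bsub>R Quot I\<^esub> Y)) = the_elem (h ` X) \<otimes>\<^bsub>S\<^esub> the_elem (h ` Y)"
      "the_elem (h ` (X \<oplus>\<^bsub>R Quot I\<^esub> Y)) = the_elem (h ` X) \<oplus>\<^bsub>S\<^esub> the_elem (h ` Y)"
      using x y el[of x] el[of y] el[of "x \<otimes> y"] el[of "x \<oplus> y"] by (simp_all del: p.hom_mult p.hom_add)
  next
    fix X assume "X \<in> carrier (R Quot I)"
    then obtain x where "x \<in> carrier R" "X = I +> x" using cos by metis
    then show "the_elem (h ` X) \<in> carrier S" using el by simp
  next
    have "\<one>\<^bsub>R Quot I\<^esub> = I +> \<one>" by (simp only: p.hom_one)
    then show "the_elem (h ` \<one>\<^bsub>R Quot I\<^esub>) = \<one>\<^bsub>S\<^esub>"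
      using el[OF one_closed] by (simp del: p.hom_one)
  qed
  show "the_elem (h ` (I +> x)) = h x" if "x \<in> carrier R" using el that .
qed

section \<open>The exterior algebra in coordinates\<close>

definition signed :: "('a, 'm) ring_scheme \<Rightarrow> bool \<Rightarrow> 'a \<Rightarrow> 'a" where
  "signed R b x = (if b then \<ominus>\<^bsub>R\<^esub> x else x)"

lemma (in ring) signed_simps [simp]:
  "x \<in> carrier R \<Longrightarrow> signed R b x \<in> carrier R"
  "signed R b \<zero> = \<zero>"
  "signed R False x = x"
  "x \<in> carrier R \<Longrightarrow> signed R b (signed R c x) = signed R (b \<noteq> c) x"
  "x \<in> carrier R \<Longrightarrow> y \<in> carrier R \<Longrightarrow> signed R b x \<otimes> y = signed R b (x \<otimes> y)"
  "x \<in> carrier R \<Longrightarrow> y \<in> carrier R \<Longrightarrow> x \<otimes> signed R b y = signed R b (x \<otimes> y)"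
  "x \<in> carrier R \<Longrightarrow> signed R b x = \<zero> \<longleftrightarrow> x = \<zero>"
  by (auto simp: signed_def l_minus r_minus)

lemma (in ring) signed_add:
  "x \<in> carrier R \<Longrightarrow> y \<in> carrier R \<Longrightarrow> signed R b (x \<oplus> y) = signed R b x \<oplus> signed R b y"
  by (auto simp: signed_def minus_add)

text \<open>
  The parity of the permutation that sorts the increasing word of \<open>S\<close> followed by that of \<open>T\<close>;
  thus \<open>e\<^sub>S e\<^sub>T = \<plusminus> e\<^bsub>S \<union> T\<^esub>\<close> with minus exactly when this holds. The number of inversions is additive
  in either argument, which makes the sign a 2-cocycle and hence the product associative.
\<close>

definition odd_inversions :: "nat set \<Rightarrow> nat set \<Rightarrow> bool" where
  "odd_inversions S T \<longleftrightarrow> odd (card {(i, j). i \<in> S \<and> j \<in> T \<and> j < i})"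

lemma odd_inversions_empty [simp]: "odd_inversions {} T = False" "odd_inversions S {} = False"
  by (auto simp: odd_inversions_def)

lemma odd_inversions_Un_left:
  assumes "finite S" "finite S'" "finite T" "S \<inter> S' = {}"
  shows "odd_inversions (S \<union> S') T \<longleftrightarrow> odd_inversions S T \<noteq> odd_inversions S' T"
proof -
  let ?I = "\<lambda>S. {(i, j). i \<in> S \<and> j \<in> T \<and> j < i}"
  have fin: "finite (?I S)" "finite (?I S')"
    using assms by (auto intro: finite_subset[of _ "S \<times> T"] finite_subset[of _ "S' \<times> T"])
  have "?I (S \<union> S') = ?I S \<union> ?I S'" "?I S \<inter> ?I S' = {}" using assms(4) by auto
  then have "card (?I (S \<union> S')) = card (?I S) + card (?I S')"
    using card_Un_disjoint[OF fin] by simp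
  then show ?thesis by (auto simp: odd_inversions_def)
qed

lemma odd_inversions_Un_right:
  assumes "finite S" "finite T" "finite T'" "T \<inter> T' = {}"
  shows "odd_inversions S (T \<union> T') \<longleftrightarrow> odd_inversions S T \<noteq> odd_inversions S T'"
proof -
  let ?I = "\<lambda>T. {(i, j). i \<in> S \<and> j \<in> T \<and> j < i}"
  have fin: "finite (?I T)" "finite (?I T')"
    using assms by (auto intro: finite_subset[of _ "S \<times> T"] finite_subset[of _ "S \<times> T'"])
  have "?I (T \<union> T') = ?I T \<union> ?I T'" "?I T \<inter> ?I T' = {}" using assms(4) by auto
  then have "card (?I (T \<union> T')) = card (?I T) + card (?I T')"
    using card_Un_disjoint[OF fin] by simp
  then show ?thesis by (auto simp: odd_inversions_def)
qed

text \<open>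
  Every pair in \<open>S \<times> T\<close> is an inversion for exactly one of the two orders, so the two inversion
  numbers add up to \<open>card S * card T\<close>.
\<close>

lemma odd_inversions_commute:
  assumes "finite S" "finite T" "S \<inter> T = {}"
  shows "odd_inversions S T \<noteq> odd_inversions T S \<longleftrightarrow> odd (card S) \<and> odd (card T)"
proof -
  let ?I = "{(i, j). i \<in> S \<and> j \<in> T \<and> j < i}" and ?J = "{(i, j). i \<in> T \<and> j \<in> S \<and> j < i}"
  have fin: "finite ?I" "finite (prod.swap ` ?J)"
    using assms by (auto intro: finite_subset[of _ "S \<times> T"] finite_subset[of _ "T \<times> S"])
  have "i \<noteq> j" if "i \<in> S" "j \<in> T" for i j using assms(3) that by blast
  then have "?I \<union> prod.swap ` ?J = S \<times> T" "?I \<inter> prod.swap ` ?J = {}"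
    by (auto simp: image_iff split: prod.splits) (metis linorder_neqE_nat)
  then have "card ?I + card (prod.swap ` ?J) = card S * card T"
    using card_Un_disjoint[OF fin] by (simp add: card_cartesian_product)
  moreover have "card (prod.swap ` ?J) = card ?J"
    by (intro card_image) (auto simp: inj_on_def)
  ultimately have "odd (card ?I + card ?J) \<longleftrightarrow> odd (card S * card T)" by simp
  then show ?thesis unfolding odd_inversions_def by auto
qed

text \<open>
  The ring \<open>E\<close> is \<open>\<Lambda>(A\<^sup>n)\<close> written in the basis \<open>e\<^sub>S\<close>: a function \<open>f\<close> stands for the sum of all \<open>f S e\<^sub>S\<close> with
  \<open>S \<subseteq> {1..n}\<close>, so \<open>monomial A a S\<close> is \<open>a e\<^sub>S\<close>. Functions vanish off the subsets of \<open>{1..n}\<close>, which makes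
  equality in \<open>E\<close> equality of functions.
\<close>

locale exterior_coordinates = ring A for A :: "('a, 'm) ring_scheme" (structure) +
  fixes n :: nat
begin

definition E :: "(nat set \<Rightarrow> 'a) ring" where
  "E = \<lparr>carrier = {f. (\<forall>S. f S \<in> carrier A) \<and> (\<forall>S. \<not> S \<subseteq> {1..n} \<longrightarrow> f S = \<zero>)},
    monoid.mult = (\<lambda>f g U. if U \<subseteq> {1..n}
      then \<Oplus>S\<in>Pow U. signed A (odd_inversions S (U - S)) (f S \<otimes> g (U - S)) else \<zero>),
    one = monomial A \<one> {}, zero = (\<lambda>S. \<zero>), add = (\<lambda>f g S. f S \<oplus> g S)\<rparr>"

lemma E_mult: "(f \<otimes>\<^bsub>E\<^esub> g) U = (if U \<subseteq> {1..n}
    then \<Oplus>S\<in>Pow U. signed A (odd_inversions S (U - S)) (f S \<otimes> g (U - S)) else \<zero>)"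
  and E_add: "(f \<oplus>\<^bsub>E\<^esub> g) S = f S \<oplus> g S"
  and E_zero: "\<zero>\<^bsub>E\<^esub> S = \<zero>"
  and E_one: "\<one>\<^bsub>E\<^esub> = monomial A \<one> {}"
  by (simp_all add: E_def)

lemma E_carrier_iff:
  "f \<in> carrier E \<longleftrightarrow> (\<forall>S. f S \<in> carrier A) \<and> (\<forall>S. \<not> S \<subseteq> {1..n} \<longrightarrow> f S = \<zero>)"
  by (simp add: E_def)

lemma E_coeff: "f \<in> carrier E \<Longrightarrow> f S \<in> carrier A"
  by (simp add: E_carrier_iff)

lemma E_outside: "f \<in> carrier E \<Longrightarrow> \<not> S \<subseteq> {1..n} \<Longrightarrow> f S = \<zero>"
  by (simp add: E_carrier_iff)

lemma E_monomial: "a \<in> carrier A \<Longrightarrow> S \<subseteq> {1..n} \<Longrightarrow> monomial A a S \<in> carrier E"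
  by (auto simp: E_carrier_iff monomial_def)

lemma E_induct [consumes 1, case_names zero monomial add]:
  assumes "f \<in> carrier E" and "P \<zero>\<^bsub>E\<^esub>"
    and mon: "\<And>a S. a \<in> carrier A \<Longrightarrow> S \<subseteq> {1..n} \<Longrightarrow> P (monomial A a S)"
    and add: "\<And>g h. g \<in> carrier E \<Longrightarrow> h \<in> carrier E \<Longrightarrow> P g \<Longrightarrow> P h \<Longrightarrow> P (g \<oplus>\<^bsub>E\<^esub> h)"
  shows "P f"
proof -
  have "f \<in> carrier E \<and> P f"
  proof (rule finite_support_induct[OF ring_axioms, where X = "Pow {1..n}"])
    show "(\<lambda>x. \<zero>) \<in> carrier E \<and> P (\<lambda>x. \<zero>)"
      using assms(2) by (simp add: E_def)
    show "(\<lambda>x. g x \<oplus> h x) \<in> carrier E \<and> P (\<lambda>x. g x \<oplus> h x)"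
      if "g \<in> carrier E \<and> P g" "h \<in> carrier E \<and> P h" for g h
      using that add[of g h] by (simp add: E_def)
  qed (use assms(1) mon E_monomial in \<open>auto simp: E_carrier_iff\<close>)
  then show ?thesis ..
qed

lemma E_term_closed:
  assumes "f \<in> carrier E" "g \<in> carrier E"
  shows "signed A b (f S \<otimes> g T) \<in> carrier A"
  using assms by (simp add: E_coeff)

lemma E_m_closed: "f \<in> carrier E \<Longrightarrow> g \<in> carrier E \<Longrightarrow> f \<otimes>\<^bsub>E\<^esub> g \<in> carrier E"
  unfolding E_carrier_iff[of "f \<otimes>\<^bsub>E\<^esub> g"] E_mult
  using E_term_closed by (auto intro!: finsum_closed)

lemma E_l_distr:
  assumes "f \<in> carrier E" "g \<in> carrier E" "h \<in> carrier E"
  shows "(f \<oplus>\<^bsub>E\<^esub> g) \<otimes>\<^bsub>E\<^esub> h = f \<otimes>\<^bsub>E\<^esub> h \<oplus>\<^bsub>E\<^esub> g \<otimes>\<^bsub>E\<^esub> h"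
proof
  fix U
  have "(\<Oplus>S\<in>Pow U. signed A (odd_inversions S (U - S)) ((f S \<oplus> g S) \<otimes> h (U - S))) =
    (\<Oplus>S\<in>Pow U. signed A (odd_inversions S (U - S)) (f S \<otimes> h (U - S)) \<oplus>
      signed A (odd_inversions S (U - S)) (g S \<otimes> h (U - S)))"
    using assms by (intro finsum_cong') (auto simp: E_coeff l_distr signed_add)
  then show "((f \<oplus>\<^bsub>E\<^esub> g) \<otimes>\<^bsub>E\<^esub> h) U = (f \<otimes>\<^bsub>E\<^esub> h \<oplus>\<^bsub>E\<^esub> g \<otimes>\<^bsub>E\<^esub> h) U"
    unfolding E_add E_mult using assms by (simp add: finsum_addf E_term_closed)
qed

lemma E_r_distr:
  assumes "f \<in> carrier E" "g \<in> carrier E" "h \<in> carrier E"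
  shows "h \<otimes>\<^bsub>E\<^esub> (f \<oplus>\<^bsub>E\<^esub> g) = h \<otimes>\<^bsub>E\<^esub> f \<oplus>\<^bsub>E\<^esub> h \<otimes>\<^bsub>E\<^esub> g"
proof
  fix U
  have "(\<Oplus>S\<in>Pow U. signed A (odd_inversions S (U - S)) (h S \<otimes> (f (U - S) \<oplus> g (U - S)))) =
    (\<Oplus>S\<in>Pow U. signed A (odd_inversions S (U - S)) (h S \<otimes> f (U - S)) \<oplus>
      signed A (odd_inversions S (U - S)) (h S \<otimes> g (U - S)))"
    using assms by (intro finsum_cong') (auto simp: E_coeff r_distr signed_add)
  then show "(h \<otimes>\<^bsub>E\<^esub> (f \<oplus>\<^bsub>E\<^esub> g)) U = (h \<otimes>\<^bsub>E\<^esub> f \<oplus>\<^bsub>E\<^esub> h \<otimes>\<^bsub>E\<^esub> g) U"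
    unfolding E_add E_mult using assms by (simp add: finsum_addf E_term_closed)
qed

lemma E_mult_monomial:
  assumes f: "f \<in> carrier E" and a: "a \<in> carrier A" and T: "T \<subseteq> {1..n}"
  shows "(f \<otimes>\<^bsub>E\<^esub> monomial A a T) U =
    (if U \<subseteq> {1..n} \<and> T \<subseteq> U then signed A (odd_inversions (U - T) T) (f (U - T) \<otimes> a) else \<zero>)"
proof (cases "U \<subseteq> {1..n}")
  case U: True
  then have fin: "finite (Pow U)" by (auto intro: finite_subset)
  have c: "f S \<in> carrier A" for S using f by (rule E_coeff)
  show ?thesis
  proof (cases "T \<subseteq> U")
    case True
    have "(f \<otimes>\<^bsub>E\<^esub> monomial A a T) U = (\<Oplus>S\<in>Pow U. if U - T = S
        then signed A (odd_inversions S (U - S)) (f S \<otimes> a) else \<zero>)"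
      unfolding E_mult using U True c a
      by (simp, intro finsum_cong') (auto simp: monomial_def)
    also have "\<dots> = signed A (odd_inversions (U - T) (U - (U - T))) (f (U - T) \<otimes> a)"
      using fin c a by (intro finsum_singleton) auto
    finally show ?thesis using U True by (simp add: double_diff)
  next
    case False
    then have "signed A (odd_inversions S (U - S)) (f S \<otimes> monomial A a T (U - S)) = \<zero>" for S
      using c by (auto simp: monomial_def)
    then show ?thesis using False unfolding E_mult by simp
  qed
qed (simp add: E_mult)

lemma E_monomial_mult:
  assumes f: "f \<in> carrier E" and a: "a \<in> carrier A" and T: "T \<subseteq> {1..n}"
  shows "(monomial A a T \<otimes>\<^bsub>E\<^esub> f) U =
    (if U \<subseteq> {1..n} \<and> T \<subseteq> U then signed A (odd_inversions T (U - T)) (a \<otimes> f (U - T)) else \<zero>)"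
proof (cases "U \<subseteq> {1..n}")
  case U: True
  then have fin: "finite (Pow U)" by (auto intro: finite_subset)
  have c: "f S \<in> carrier A" for S using f by (rule E_coeff)
  show ?thesis
  proof (cases "T \<subseteq> U")
    case True
    have "(monomial A a T \<otimes>\<^bsub>E\<^esub> f) U = (\<Oplus>S\<in>Pow U. if T = S
        then signed A (odd_inversions S (U - S)) (a \<otimes> f (U - S)) else \<zero>)"
      unfolding E_mult using U True c a
      by (simp, intro finsum_cong') (auto simp: monomial_def)
    also have "\<dots> = signed A (odd_inversions T (U - T)) (a \<otimes> f (U - T))"
      using fin c a True by (intro finsum_singleton) auto
    finally show ?thesis using U True by simp
  next
    case False
    then have "signed A (odd_inversions S (U - S)) (monomial A a T S \<otimes> f (U - S)) = \<zero>"
      if "S \<in> Pow U" for S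
      using c that by (auto simp: monomial_def)
    then have "(\<Oplus>S\<in>Pow U. signed A (odd_inversions S (U - S)) (monomial A a T S \<otimes> f (U - S))) = \<zero>"
      by (intro add.finprod_one_eqI)
    then show ?thesis using False unfolding E_mult by simp
  qed
qed (simp add: E_mult)

lemma E_monomial_monomial:
  assumes a: "a \<in> carrier A" "S \<subseteq> {1..n}" and b: "b \<in> carrier A" "T \<subseteq> {1..n}"
  shows "monomial A a S \<otimes>\<^bsub>E\<^esub> monomial A b T =
    (if S \<inter> T = {} then monomial A (signed A (odd_inversions S T) (a \<otimes> b)) (S \<union> T) else \<zero>\<^bsub>E\<^esub>)"
proof
  fix U
  have *: "T \<subseteq> U \<and> U - T = S \<longleftrightarrow> S \<inter> T = {} \<and> U = S \<union> T" by blast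
  show "(monomial A a S \<otimes>\<^bsub>E\<^esub> monomial A b T) U = (if S \<inter> T = {}
      then monomial A (signed A (odd_inversions S T) (a \<otimes> b)) (S \<union> T) else \<zero>\<^bsub>E\<^esub>) U"
    unfolding E_mult_monomial[OF E_monomial[OF a] b]
    using * assms by (cases "T \<subseteq> U \<and> U - T = S") (auto simp: monomial_def E_zero)
qed

lemma E_null:
  assumes "f \<in> carrier E"
  shows "f \<otimes>\<^bsub>E\<^esub> \<zero>\<^bsub>E\<^esub> = \<zero>\<^bsub>E\<^esub>" "\<zero>\<^bsub>E\<^esub> \<otimes>\<^bsub>E\<^esub> f = \<zero>\<^bsub>E\<^esub>"
  using assms by (auto simp: fun_eq_iff E_mult E_zero E_coeff)

lemma E_add_closed: "f \<in> carrier E \<Longrightarrow> g \<in> carrier E \<Longrightarrow> f \<oplus>\<^bsub>E\<^esub> g \<in> carrier E"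
  by (auto simp: E_carrier_iff E_add)

lemma E_zero_closed: "\<zero>\<^bsub>E\<^esub> \<in> carrier E"
  by (auto simp: E_carrier_iff E_zero)

text \<open>
  Both sides are the sorted product on \<open>S \<union> T \<union> V\<close>, with the sign of the inversions between the
  three pairs of sets, if these are disjoint; otherwise both sides vanish.
\<close>

lemma E_assoc_monomial:
  assumes a: "a \<in> carrier A" "S \<subseteq> {1..n}" and b: "b \<in> carrier A" "T \<subseteq> {1..n}"
    and c: "c \<in> carrier A" "V \<subseteq> {1..n}"
  shows "monomial A a S \<otimes>\<^bsub>E\<^esub> monomial A b T \<otimes>\<^bsub>E\<^esub> monomial A c V =
    monomial A a S \<otimes>\<^bsub>E\<^esub> (monomial A b T \<otimes>\<^bsub>E\<^esub> monomial A c V)"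
proof -
  have fin: "finite S" "finite T" "finite V" using assms by (auto intro: finite_subset)
  show ?thesis
  proof (cases "S \<inter> T = {} \<and> S \<inter> V = {} \<and> T \<inter> V = {}")
    case True
    then show ?thesis
      using assms fin
      by (simp add: E_monomial_monomial Int_Un_distrib Int_Un_distrib2 m_assoc Un_assoc
          odd_inversions_Un_left odd_inversions_Un_right)
        (cases "odd_inversions S T"; cases "odd_inversions T V"; simp)
  next
    case False
    then show ?thesis
      using assms by (auto simp: E_monomial_monomial E_null E_monomial Int_Un_distrib Int_Un_distrib2)
  qed
qed

lemma E_assoc:
  assumes f: "f \<in> carrier E" and g: "g \<in> carrier E" and h: "h \<in> carrier E"
  shows "f \<otimes>\<^bsub>E\<^esub> g \<otimes>\<^bsub>E\<^esub> h = f \<otimes>\<^bsub>E\<^esub> (g \<otimes>\<^bsub>E\<^esub> h)"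
proof -
  note simps = E_null E_m_closed E_l_distr E_r_distr E_add_closed E_zero_closed E_monomial
  have 1: "monomial A a S \<otimes>\<^bsub>E\<^esub> monomial A b T \<otimes>\<^bsub>E\<^esub> h =
    monomial A a S \<otimes>\<^bsub>E\<^esub> (monomial A b T \<otimes>\<^bsub>E\<^esub> h)"
    if "a \<in> carrier A" "S \<subseteq> {1..n}" "b \<in> carrier A" "T \<subseteq> {1..n}" for a b S T
    using h by (induction h rule: E_induct) (simp_all add: simps that E_assoc_monomial del: One_nat_def)
  have 2: "monomial A a S \<otimes>\<^bsub>E\<^esub> g \<otimes>\<^bsub>E\<^esub> h = monomial A a S \<otimes>\<^bsub>E\<^esub> (g \<otimes>\<^bsub>E\<^esub> h)"
    if "a \<in> carrier A" "S \<subseteq> {1..n}" for a S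
    using g by (induction g rule: E_induct) (simp_all add: simps that 1 h del: One_nat_def)
  show ?thesis
    using f by (induction f rule: E_induct) (simp_all add: simps 2 g h del: One_nat_def)
qed

lemma E_ring: "ring E"
proof (rule ringI)
  show "abelian_group E"
  proof (rule abelian_groupI)
    fix f assume f: "f \<in> carrier E"
    show "\<exists>g\<in>carrier E. g \<oplus>\<^bsub>E\<^esub> f = \<zero>\<^bsub>E\<^esub>"
      using f by (intro bexI[of _ "\<lambda>S. \<ominus> f S"]) (auto simp: E_carrier_iff E_add E_zero fun_eq_iff l_neg)
  qed (auto simp: E_add_closed E_zero_closed, auto simp: fun_eq_iff E_add E_zero E_coeff a_ac)
  show "Group.monoid E"
  proof (rule monoidI)
    fix f assume f: "f \<in> carrier E"
    show "\<one>\<^bsub>E\<^esub> \<otimes>\<^bsub>E\<^esub> f = f" "f \<otimes>\<^bsub>E\<^esub> \<one>\<^bsub>E\<^esub> = f"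
      using f E_outside[OF f]
      by (auto simp: E_one fun_eq_iff E_monomial_mult E_mult_monomial E_coeff)
  qed (auto simp: E_m_closed E_assoc E_one E_monomial)
qed (auto intro: E_l_distr E_r_distr)

end

section \<open>The center and essentiality in coordinates\<close>

lemma (in ring) center_subset: "center R \<subseteq> carrier R"
  by (auto simp: center_def)

lemma (in ring) center_carrier: "c \<in> center R \<Longrightarrow> c \<in> carrier R"
  by (simp add: center_def)

lemma (in ring) center_closed:
  "\<zero> \<in> center R" "\<one> \<in> center R"
  "c \<in> center R \<Longrightarrow> d \<in> center R \<Longrightarrow> c \<oplus> d \<in> center R"
  "c \<in> center R \<Longrightarrow> d \<in> center R \<Longrightarrow> c \<otimes> d \<in> center R"
  "c \<in> center R \<Longrightarrow> signed R b c \<in> center R"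
proof -
  interpret C: cring "center_ring R" by (rule center_ring_cring) (rule ring_axioms)
  show "\<zero> \<in> center R" "\<one> \<in> center R"
    "c \<in> center R \<Longrightarrow> d \<in> center R \<Longrightarrow> c \<oplus> d \<in> center R"
    "c \<in> center R \<Longrightarrow> d \<in> center R \<Longrightarrow> c \<otimes> d \<in> center R"
    using C.zero_closed C.one_closed C.a_closed[of c d] C.m_closed[of c d]
    by (simp_all add: center_ring_def)
  show "c \<in> center R \<Longrightarrow> signed R b c \<in> center R"
    by (auto simp: center_def signed_def l_minus r_minus)
qed

lemma (in ring) center_nat_multiple: "[k] \<cdot> \<one> \<in> center R" for k :: nat
  by (induction k) (auto intro: center_closed)

lemma (in ring) signed_eq_iff:
  assumes "x \<in> carrier R"
  shows "signed R b x = signed R c x \<longleftrightarrow> b = c \<or> x \<oplus> x = \<zero>"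
proof -
  have "\<ominus> x = x \<longleftrightarrow> x \<oplus> x = \<zero>"
    using assms by (metis minus_equality r_neg)
  then show ?thesis by (auto simp: signed_def)
qed

lemma (in ring) signed_double_eq_zero_iff:
  assumes "x \<in> carrier R"
  shows "signed R b x \<oplus> signed R b x = \<zero> \<longleftrightarrow> x \<oplus> x = \<zero>"
  using assms signed_simps(7)[of "x \<oplus> x" b] by (simp add: signed_add)

text \<open>
  One central multiplier can move finitely many elements into the center without killing them
  all: each step repairs one element outside the center, and elements already in the center
  stay there.
\<close>

lemma (in ring) centrally_essential_common_multiplier:
  assumes ce: "centrally_essential R"
    and "finite X" and "f \<in> X \<rightarrow> carrier R" and "\<exists>x\<in>X. f x \<noteq> \<zero>"
  shows "\<exists>c\<in>center R. (\<forall>x\<in>X. f x \<otimes> c \<in> center R) \<and> (\<exists>x\<in>X. f x \<otimes> c \<noteq> \<zero>)"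
  using assms(3,4)
proof (induction "card {x \<in> X. f x \<notin> center R}" arbitrary: f rule: less_induct)
  case less
  note f = \<open>f \<in> X \<rightarrow> carrier R\<close>
  show ?case
  proof (cases "\<forall>x\<in>X. f x \<in> center R")
    case True
    moreover have "f x \<otimes> \<one> = f x" if "x \<in> X" for x using f that by (intro r_one) blast
    ultimately show ?thesis
      using less.prems(2) by (intro bexI[of _ \<one>]) (auto simp: center_closed)
  next
    case False
    then obtain x where x: "x \<in> X" "f x \<notin> center R" by blast
    then have "f x \<noteq> \<zero>" "f x \<in> carrier R" using center_closed(1) f by auto
    then obtain c where c: "c \<in> center R" "f x \<otimes> c \<noteq> \<zero>" "f x \<otimes> c \<in> center R"
      using ce unfolding centrally_essential_iff[OF ring_axioms] by blast
    have cc: "c \<in> carrier R" using c(1) center_subset by blast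
    let ?g = "\<lambda>x. f x \<otimes> c"
    have "{y \<in> X. ?g y \<notin> center R} \<subset> {y \<in> X. f y \<notin> center R}"
      using x c center_closed(4) by auto
    then have "card {y \<in> X. ?g y \<notin> center R} < card {y \<in> X. f y \<notin> center R}"
      using \<open>finite X\<close> by (intro psubset_card_mono) auto
    moreover have "?g \<in> X \<rightarrow> carrier R" "\<exists>x\<in>X. ?g x \<noteq> \<zero>"
      using f cc x c by auto
    ultimately obtain d where d: "d \<in> center R" "\<forall>x\<in>X. ?g x \<otimes> d \<in> center R"
        "\<exists>x\<in>X. ?g x \<otimes> d \<noteq> \<zero>"
      using less.hyps[of ?g] by blast
    have "?g y \<otimes> d = f y \<otimes> (c \<otimes> d)" if "y \<in> X" for y
      using that f cc d(1) center_subset by (intro m_assoc) auto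
    then show ?thesis using d c(1) by (intro bexI[of _ "c \<otimes> d"]) (auto intro: center_closed)
  qed
qed

context exterior_coordinates
begin

interpretation E: ring E by (rule E_ring)

text \<open>
  Commuting with all \<open>a e\<^bsub>{}\<^esub>\<close> says that the coefficients are central. Moving \<open>e\<^sub>i\<close> past \<open>e\<^sub>S\<close> with \<open>i \<notin> S\<close>
  costs the sign \<open>(-1)\<close> once for each element of \<open>S\<close>, which forces \<open>2 f S = 0\<close> for odd \<open>card S\<close>; only
  for \<open>S = {1..n}\<close> is there no such \<open>i\<close>. Conversely, two monomials on disjoint sets fail to commute only if both sets
  have odd size, and then the first set is not all of \<open>{1..n}\<close>.
\<close>

lemma center_E_iff:
  assumes f: "f \<in> carrier E"
  shows "f \<in> center E \<longleftrightarrow>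
    (\<forall>S. f S \<in> center A) \<and> (\<forall>S. odd (card S) \<and> S \<noteq> {1..n} \<longrightarrow> f S \<oplus> f S = \<zero>)"
proof (intro iffI conjI allI impI)
  note c = E_coeff[OF f]
  fix S
  assume "f \<in> center E"
  then have comm: "f \<otimes>\<^bsub>E\<^esub> g = g \<otimes>\<^bsub>E\<^esub> f" if "g \<in> carrier E" for g
    using that by (simp add: center_def)
  show "f S \<in> center A"
  proof (cases "S \<subseteq> {1..n}")
    case True
    have "f S \<otimes> a = a \<otimes> f S" if a: "a \<in> carrier A" for a
      using fun_cong[OF comm[OF E_monomial[OF a, of "{}"]], of S] True a c
      by (simp add: E_mult_monomial E_monomial_mult f)
    then show ?thesis using c by (simp add: center_def)
  qed (simp add: E_outside[OF f] center_closed)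
  assume S: "odd (card S) \<and> S \<noteq> {1..n}"
  show "f S \<oplus> f S = \<zero>"
  proof (cases "S \<subseteq> {1..n}")
    case True
    then obtain i where i: "i \<in> {1..n}" "i \<notin> S" using S by blast
    have fin: "finite S" using True by (rule finite_subset) simp
    have "signed A (odd_inversions S {i}) (f S) = signed A (odd_inversions {i} S) (f S)"
      using fun_cong[OF comm[OF E_monomial[OF one_closed, of "{i}"]], of "insert i S"] True c i
      by (simp add: E_mult_monomial E_monomial_mult f)
    moreover have "odd_inversions S {i} \<noteq> odd_inversions {i} S"
      using odd_inversions_commute[of S "{i}"] fin i S by auto
    ultimately show ?thesis using signed_eq_iff[OF c[of S]] by metis
  qed (simp add: E_outside[OF f])
next
  note c = E_coeff[OF f]
  assume coeffs: "(\<forall>S. f S \<in> center A) \<and> (\<forall>S. odd (card S) \<and> S \<noteq> {1..n} \<longrightarrow> f S \<oplus> f S = \<zero>)"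
  have "f \<otimes>\<^bsub>E\<^esub> g = g \<otimes>\<^bsub>E\<^esub> f" if "g \<in> carrier E" for g
    using that
  proof (induction g rule: E_induct)
    case (monomial b T)
    show ?case
    proof
      fix U
      show "(f \<otimes>\<^bsub>E\<^esub> monomial A b T) U = (monomial A b T \<otimes>\<^bsub>E\<^esub> f) U"
      proof (cases "U \<subseteq> {1..n} \<and> T \<subseteq> U")
        case True
        let ?S = "U - T"
        have fin: "finite U" "finite T" using True by (auto intro: finite_subset)
        have fb: "f ?S \<otimes> b = b \<otimes> f ?S" and cb: "b \<otimes> f ?S \<in> carrier A"
          using coeffs monomial c by (auto simp: center_def)
        have "b \<otimes> f ?S \<oplus> b \<otimes> f ?S = \<zero>"
          if "odd_inversions ?S T \<noteq> odd_inversions T ?S"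
        proof -
          have odd: "odd (card ?S)" "odd (card T)"
            using odd_inversions_commute[of ?S T] fin that by auto
          then have "T \<noteq> {}" by auto
          then have "?S \<noteq> {1..n}" using True by blast
          then have "f ?S \<oplus> f ?S = \<zero>" using odd coeffs by blast
          then show "b \<otimes> f ?S \<oplus> b \<otimes> f ?S = \<zero>"
            using c monomial by (simp flip: r_distr)
        qed
        then show ?thesis
          using True monomial f signed_eq_iff[OF cb, of "odd_inversions ?S T" "odd_inversions T ?S"] fb
          by (auto simp: E_mult_monomial E_monomial_mult)
      next
        case False
        then show ?thesis using f monomial by (simp only: E_mult_monomial E_monomial_mult if_False)
      qed
    qed
  qed (simp_all add: f E.l_distr E.r_distr)
  then show "f \<in> center E" using f by (simp add: center_def)
qed

lemma E_mult_scalar: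
  assumes "f \<in> carrier E" "c \<in> carrier A"
  shows "(f \<otimes>\<^bsub>E\<^esub> monomial A c {}) U = f U \<otimes> c"
  using assms E_outside[OF assms(1)] by (simp add: E_mult_monomial E_coeff)

text \<open>
  Apply essentiality to \<open>r e\<^bsub>{1..n}\<^esub>\<close>: a multiplier acts on the top component only through its
  coefficient at the empty set, which lies in the center of \<open>A\<close>.
\<close>

lemma centrally_essential_coefficients:
  assumes "centrally_essential E"
  shows "centrally_essential A"
  unfolding centrally_essential_iff[OF ring_axioms]
proof (intro ballI impI)
  fix r assume r: "r \<in> carrier A" "r \<noteq> \<zero>"
  let ?f = "monomial A r {1..n}"
  have f: "?f \<in> carrier E" using r by (auto intro: E_monomial)
  moreover have "?f \<noteq> \<zero>\<^bsub>E\<^esub>" using r by (auto simp: fun_eq_iff E_zero monomial_def)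
  ultimately obtain z where z: "z \<in> center E" "?f \<otimes>\<^bsub>E\<^esub> z \<noteq> \<zero>\<^bsub>E\<^esub>" "?f \<otimes>\<^bsub>E\<^esub> z \<in> center E"
    using assms unfolding centrally_essential_iff[OF E_ring] by blast
  have zE: "z \<in> carrier E" using z(1) E.center_subset by blast
  have eq: "(?f \<otimes>\<^bsub>E\<^esub> z) U = (if U = {1..n} then r \<otimes> z {} else \<zero>)" for U
    using r zE by (auto simp: E_monomial_mult E_coeff)
  have "\<exists>U. (?f \<otimes>\<^bsub>E\<^esub> z) U \<noteq> \<zero>" using z(2) by (auto simp: fun_eq_iff E_zero)
  then have "r \<otimes> z {} \<noteq> \<zero>" unfolding eq by presburger
  moreover have "(?f \<otimes>\<^bsub>E\<^esub> z) {1..n} \<in> center A" "z {} \<in> center A"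
    using center_E_iff[OF zE] center_E_iff[OF E.m_closed[OF f zE]] z by blast+
  then have "r \<otimes> z {} \<in> center A" "z {} \<in> center A" unfolding eq by simp_all
  ultimately show "\<exists>c\<in>center A. r \<otimes> c \<noteq> \<zero> \<and> r \<otimes> c \<in> center A" by blast
qed

text \<open>
  For even \<open>n\<close> the element \<open>a e\<^sub>1\<close> has no nonzero central multiple. Multiplication by \<open>e\<^sub>1\<close> changes the
  parity of index sets, and for even \<open>n\<close> the exceptional set \<open>{1..n}\<close> is not odd. So for each
  coefficient \<open>z S\<close> of a central multiplier with \<open>1 \<notin> S\<close>, one of \<open>z S\<close> (if \<open>card S\<close> is odd) and the
  coefficient \<open>\<plusminus> a z S\<close> of the product (if \<open>card S\<close> is even) is killed by 2. Either way \<open>2 a z S = 0\<close>,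
  and \<open>a\<close> was chosen such that this implies \<open>a z S = 0\<close>.
\<close>

lemma not_centrally_essential_even:
  assumes n: "even n" "n \<ge> 1" and a: "a \<in> carrier A" "a \<noteq> \<zero>"
    and tf: "\<And>x. x \<in> carrier A \<Longrightarrow> a \<otimes> x \<oplus> a \<otimes> x = \<zero> \<Longrightarrow> a \<otimes> x = \<zero>"
  shows "\<not> centrally_essential E"
proof
  let ?f = "monomial A a {1}"
  assume "centrally_essential E"
  moreover have f: "?f \<in> carrier E" using a n by (auto intro: E_monomial)
  moreover have "?f \<noteq> \<zero>\<^bsub>E\<^esub>" using a by (auto simp: fun_eq_iff E_zero monomial_def)
  ultimately obtain z where z: "z \<in> center E" "?f \<otimes>\<^bsub>E\<^esub> z \<noteq> \<zero>\<^bsub>E\<^esub>" "?f \<otimes>\<^bsub>E\<^esub> z \<in> center E"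
    unfolding centrally_essential_iff[OF E_ring] by blast
  have zE: "z \<in> carrier E" using z(1) E.center_subset by blast
  obtain U where U: "(?f \<otimes>\<^bsub>E\<^esub> z) U \<noteq> \<zero>" using z(2) by (auto simp: fun_eq_iff E_zero)
  let ?S = "U - {1}"
  have "{1} \<subseteq> {1..n}" using n by simp
  note eq = E_monomial_mult[OF zE a(1) this]
  have U1: "U \<subseteq> {1..n}" "1 \<in> U" using U unfolding eq by (auto split: if_splits)
  have fin: "finite U" using U1(1) by (rule finite_subset) simp
  have cz: "a \<otimes> z ?S \<in> carrier A" using a zE by (simp add: E_coeff)
  have val: "(?f \<otimes>\<^bsub>E\<^esub> z) U = signed A (odd_inversions {1} ?S) (a \<otimes> z ?S)"
    unfolding eq using U1 by simp
  have "a \<otimes> z ?S \<oplus> a \<otimes> z ?S = \<zero>"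
  proof (cases "odd (card U)")
    case True
    then have "U \<noteq> {1..n}" using n by auto
    then have "(?f \<otimes>\<^bsub>E\<^esub> z) U \<oplus> (?f \<otimes>\<^bsub>E\<^esub> z) U = \<zero>"
      using True z(3) center_E_iff[OF E.m_closed[OF f zE]] by blast
    then show ?thesis unfolding val signed_double_eq_zero_iff[OF cz] .
  next
    case False
    moreover have "card ?S = card U - 1" using U1 fin by simp
    moreover have "card U > 0" using U1 fin by (auto simp: card_gt_0_iff)
    ultimately have "odd (card ?S)" by simp
    moreover have "1 \<in> {1..n}" using n by simp
    then have "?S \<noteq> {1..n}" by blast
    ultimately have "z ?S \<oplus> z ?S = \<zero>" using z(1) center_E_iff[OF zE] by blast
    then show ?thesis using a zE by (simp add: E_coeff flip: r_distr)
  qed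
  then have "a \<otimes> z ?S = \<zero>" using tf zE by (simp add: E_coeff)
  then show False using U unfolding val by simp
qed

lemma scalar_central:
  assumes "c \<in> center A"
  shows "monomial A c {} \<in> center E"
  using assms center_subset
  by (subst center_E_iff[OF E_monomial]) (auto simp: monomial_def center_closed)

lemma even_monomial_central:
  assumes "T \<subseteq> {1..n}" "even (card T)"
  shows "monomial A \<one> T \<in> center E"
  using assms
  by (subst center_E_iff[OF E_monomial]) (auto simp: monomial_def center_closed)

text \<open>
  What keeps \<open>g\<close> from being central are its components on odd \<open>S \<noteq> {1..n}\<close>. Take such an \<open>S\<close> of least
  size and multiply by \<open>e\<^sub>T\<close> for the complement \<open>T\<close>. As \<open>n\<close> is odd, \<open>T\<close> is even, so \<open>e\<^sub>T\<close> is central and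
  preserves parity. Only components on subsets of \<open>S\<close> survive; by minimality the only odd one is
  \<open>S\<close> itself, which ends up in the top component.
\<close>

lemma central_multiple_odd:
  assumes n: "odd n" and g: "g \<in> carrier E" "g \<noteq> \<zero>\<^bsub>E\<^esub>" and gc: "\<And>S. g S \<in> center A"
  shows "\<exists>z\<in>center E. g \<otimes>\<^bsub>E\<^esub> z \<noteq> \<zero>\<^bsub>E\<^esub> \<and> g \<otimes>\<^bsub>E\<^esub> z \<in> center E"
proof (cases "\<exists>S. odd (card S) \<and> S \<noteq> {1..n} \<and> g S \<noteq> \<zero>")
  case False
  then have "g \<in> center E" using gc g by (subst center_E_iff) auto
  then show ?thesis using g by (intro bexI[of _ "\<one>\<^bsub>E\<^esub>"]) (auto simp: E.center_closed)
next
  case True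
  then obtain S where S: "odd (card S) \<and> S \<noteq> {1..n} \<and> g S \<noteq> \<zero>"
    and least: "\<And>S'. odd (card S') \<and> S' \<noteq> {1..n} \<and> g S' \<noteq> \<zero> \<Longrightarrow> card S \<le> card S'"
    using ex_has_least_nat[of "\<lambda>S. odd (card S) \<and> S \<noteq> {1..n} \<and> g S \<noteq> \<zero>" _ card] by metis
  have sub: "S \<subseteq> {1..n}" using E_outside[OF g(1)] S by blast
  then have fin: "finite S" by (rule finite_subset) simp
  let ?T = "{1..n} - S" and ?z = "monomial A \<one> ({1..n} - S)"
  have cT: "card ?T + card S = n" using sub by (simp add: card_Diff_subset fin card_mono[of "{1..n}" S, simplified])
  then have "even (card ?T)" using n S by (metis even_add)
  then have z: "?z \<in> center E" by (intro even_monomial_central) auto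
  have eq: "(g \<otimes>\<^bsub>E\<^esub> ?z) U =
      (if U \<subseteq> {1..n} \<and> ?T \<subseteq> U then signed A (odd_inversions (U - ?T) ?T) (g (U - ?T)) else \<zero>)" for U
    using g(1) by (subst E_mult_monomial) (auto simp: E_coeff)
  have zE: "?z \<in> carrier E" using z E.center_subset by blast
  have "g \<otimes>\<^bsub>E\<^esub> ?z \<in> center E"
  proof (subst center_E_iff[OF E.m_closed[OF g(1) zE]], intro conjI allI impI)
    show "(g \<otimes>\<^bsub>E\<^esub> ?z) U \<in> center A" for U
      unfolding eq using gc center_closed by auto
    fix U assume U: "odd (card U) \<and> U \<noteq> {1..n}"
    have "g (U - ?T) = \<zero>" if UT: "U \<subseteq> {1..n}" "?T \<subseteq> U"
    proof (rule ccontr)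
      assume nz: "g (U - ?T) \<noteq> \<zero>"
      have "finite U" using UT(1) by (rule finite_subset) simp
      then have "card (U - ?T) + card ?T = card U"
        using UT card_Diff_subset[of ?T U] card_mono[of U ?T] by (simp add: finite_subset[of ?T U])
      then have "odd (card (U - ?T))" using U \<open>even (card ?T)\<close> by (metis even_add)
      moreover have ss: "U - ?T \<subset> S" using UT U by blast
      then have "card (U - ?T) < card S" by (rule psubset_card_mono[OF fin])
      moreover have "U - ?T \<noteq> {1..n}" using ss sub by blast
      ultimately show False using least[of "U - ?T"] nz by auto
    qed
    then show "(g \<otimes>\<^bsub>E\<^esub> ?z) U \<oplus> (g \<otimes>\<^bsub>E\<^esub> ?z) U = \<zero>" unfolding eq by auto
  qed
  moreover have "{1..n} - ?T = S" using sub by blast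
  then have "(g \<otimes>\<^bsub>E\<^esub> ?z) {1..n} \<noteq> \<zero>"
    unfolding eq using S g(1) by (simp add: E_coeff del: One_nat_def)
  then have "g \<otimes>\<^bsub>E\<^esub> ?z \<noteq> \<zero>\<^bsub>E\<^esub>" by (auto simp: E_zero)
  ultimately show ?thesis using z by blast
qed

text \<open>
  The last nonzero element among \<open>g, 2 g, 4 g, \<dots>\<close> is killed by 2, so its odd components satisfy the
  condition for being central.
\<close>

lemma central_multiple_two_power:
  assumes s: "[((2::nat) ^ m)] \<cdot> \<one> = \<zero>"
    and g: "g \<in> carrier E" "g \<noteq> \<zero>\<^bsub>E\<^esub>" and gc: "\<And>S. g S \<in> center A"
  shows "\<exists>z\<in>center E. g \<otimes>\<^bsub>E\<^esub> z \<noteq> \<zero>\<^bsub>E\<^esub> \<and> g \<otimes>\<^bsub>E\<^esub> z \<in> center E"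
proof -
  let ?t = "\<lambda>k::nat. [((2::nat) ^ k)] \<cdot> \<one>"
  let ?z = "\<lambda>k. monomial A (?t k) {}"
  have t: "?t k \<in> carrier A" for k by simp
  have zc: "?z k \<in> center E" for k by (intro scalar_central center_nat_multiple)
  have zE: "?z k \<in> carrier E" for k using zc E.center_subset by blast
  have eq: "(g \<otimes>\<^bsub>E\<^esub> ?z k) U = g U \<otimes> ?t k" for k U
    by (rule E_mult_scalar[OF g(1) t])
  define k where "k = (LEAST k. g \<otimes>\<^bsub>E\<^esub> ?z k = \<zero>\<^bsub>E\<^esub>)"
  have "g \<otimes>\<^bsub>E\<^esub> ?z m = \<zero>\<^bsub>E\<^esub>" using g(1) by (auto simp: fun_eq_iff eq[of m, unfolded s] s E_zero E_coeff)
  then have k: "g \<otimes>\<^bsub>E\<^esub> ?z k = \<zero>\<^bsub>E\<^esub>" unfolding k_def by (rule LeastI)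
  have "g \<otimes>\<^bsub>E\<^esub> ?z 0 = g"
    using g(1) eq[of 0] by (intro ext) (simp add: E_coeff)
  then have "k \<noteq> 0" using k g(2) by metis
  then obtain j where j: "k = Suc j" using not0_implies_Suc by blast
  have "g \<otimes>\<^bsub>E\<^esub> ?z j \<noteq> \<zero>\<^bsub>E\<^esub>"
    using not_less_Least[of j "\<lambda>k. g \<otimes>\<^bsub>E\<^esub> ?z k = \<zero>\<^bsub>E\<^esub>"] unfolding k_def[symmetric] j by simp
  moreover have "?t k = ?t j \<oplus> ?t j" unfolding j
    by (simp add: add.nat_pow_mult mult_2)
  then have "g U \<otimes> ?t j \<oplus> g U \<otimes> ?t j = \<zero>" for U
    using eq[of k U] g(1) t unfolding k E_zero by (simp add: E_coeff flip: r_distr)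
  then have "g \<otimes>\<^bsub>E\<^esub> ?z j \<in> center E"
    using gc center_nat_multiple zE g(1)
    by (subst center_E_iff) (auto simp: eq center_closed)
  ultimately show ?thesis using zc by blast
qed

lemma centrally_essential_E:
  assumes ce: "centrally_essential A" and "odd n \<or> (\<exists>m. [((2::nat) ^ m)] \<cdot> \<one> = \<zero>)"
  shows "centrally_essential E"
  unfolding centrally_essential_iff[OF E_ring]
proof (intro ballI impI)
  fix f assume f: "f \<in> carrier E" "f \<noteq> \<zero>\<^bsub>E\<^esub>"
  obtain S where "f S \<noteq> \<zero>" using f(2) by (auto simp: fun_eq_iff E_zero)
  moreover from this have "S \<in> Pow {1..n}" using E_outside[OF f(1)] by blast
  ultimately have "\<exists>S\<in>Pow {1..n}. f S \<noteq> \<zero>" by blast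
  then obtain c where c: "c \<in> center A" "\<forall>S\<in>Pow {1..n}. f S \<otimes> c \<in> center A"
      "\<exists>S\<in>Pow {1..n}. f S \<otimes> c \<noteq> \<zero>"
    using centrally_essential_common_multiplier[OF ce, of "Pow {1..n}" f] E_coeff[OF f(1)] by auto
  have cA: "c \<in> carrier A" using c(1) center_subset by blast
  let ?c = "monomial A c {}" and ?g = "f \<otimes>\<^bsub>E\<^esub> monomial A c {}"
  have cE: "?c \<in> carrier E" using cA by (simp add: E_monomial)
  have g: "?g \<in> carrier E" using f cE by simp
  have val: "?g S = f S \<otimes> c" for S by (rule E_mult_scalar[OF f(1) cA])
  have gc: "?g S \<in> center A" for S
    using c(2) E_outside[OF f(1), of S] cA by (cases "S \<subseteq> {1..n}") (auto simp: val center_closed)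
  have "?g \<noteq> \<zero>\<^bsub>E\<^esub>" using c(3) by (auto simp: fun_eq_iff E_zero val)
  then obtain z where z: "z \<in> center E" "?g \<otimes>\<^bsub>E\<^esub> z \<noteq> \<zero>\<^bsub>E\<^esub>" "?g \<otimes>\<^bsub>E\<^esub> z \<in> center E"
    using central_multiple_odd[OF _ g _ gc] central_multiple_two_power[OF _ g _ gc] assms(2) by blast
  have "?g \<otimes>\<^bsub>E\<^esub> z = f \<otimes>\<^bsub>E\<^esub> (?c \<otimes>\<^bsub>E\<^esub> z)"
    using f(1) cE z(1) E.center_subset by (intro E.m_assoc) auto
  then show "\<exists>z\<in>center E. f \<otimes>\<^bsub>E\<^esub> z \<noteq> \<zero>\<^bsub>E\<^esub> \<and> f \<otimes>\<^bsub>E\<^esub> z \<in> center E"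
    using z E.center_closed(4)[OF scalar_central[OF c(1)] z(1)] by auto
qed

end

section \<open>Normal ordering of words in anticommuting letters\<close>

text \<open>
  The sorted form of a word in letters with \<open>t\<^sub>i t\<^sub>i = 0\<close> and \<open>t\<^sub>i t\<^sub>j = - t\<^sub>j t\<^sub>i\<close>: \<open>None\<close> if the word is zero
  because a letter repeats, otherwise a flag for the minus sign and the sorted word. It is computed
  on words alone, so the same form serves in the exterior algebra and in its coordinate ring.
\<close>

fun insert_letter :: "nat \<Rightarrow> nat list \<Rightarrow> (bool \<times> nat list) option" where
  "insert_letter i [] = Some (False, [i])"
| "insert_letter i (j # l) = (if i < j then Some (False, i # j # l) else if i = j then None
    else map_option (\<lambda>(b, l'). (\<not> b, j # l')) (insert_letter i l))"

fun normal_order :: "nat list \<Rightarrow> (bool \<times> nat list) option" where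
  "normal_order [] = Some (False, [])"
| "normal_order (i # w) = (case normal_order w of None \<Rightarrow> None
    | Some (b, l) \<Rightarrow> map_option (\<lambda>(b', l'). (b \<noteq> b', l')) (insert_letter i l))"

lemma insert_letter_set: "insert_letter i l = Some (b, l') \<Longrightarrow> set l' = insert i (set l)"
  by (induction i l arbitrary: b l' rule: insert_letter.induct) (auto split: if_splits)

lemma insert_letter_sorted:
  assumes "insert_letter i l = Some (b, l')" "sorted_wrt (<) l"
  shows "sorted_wrt (<) l' \<and> set l' = insert i (set l)"
  using assms
proof (induction i l arbitrary: b l' rule: insert_letter.induct)
  case (2 i j l)
  show ?case
  proof (cases "i < j")
    case True
    have "i < x" if "x \<in> set l" for x
    proof -
      have "j < x" using 2(3) that by simp
      with True show ?thesis by simp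
    qed
    then show ?thesis using 2(2,3) True by auto
  next
    case False
    with 2(2) have ne: "i \<noteq> j" by (auto split: if_splits)
    with 2(2) False obtain b0 l0 where l0: "insert_letter i l = Some (b0, l0)" "l' = j # l0" by auto
    then show ?thesis using 2(1)[OF False ne l0(1)] 2(3) False ne by auto
  qed
qed auto

lemma normal_order_sorted:
  assumes "normal_order w = Some (b, l)"
  shows "sorted_wrt (<) l \<and> set l = set w"
  using assms
proof (induction w arbitrary: b l)
  case (Cons i w)
  then obtain b0 l0 b1 where "normal_order w = Some (b0, l0)" "insert_letter i l0 = Some (b1, l)"
    by (auto split: option.splits)
  then show ?case using Cons.IH insert_letter_sorted by fastforce
qed auto

lemma sorted_list_of_set_of_sorted:
  assumes "sorted_wrt (<) (l :: nat list)"
  shows "sorted_list_of_set (set l) = l"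
  using assms by (intro sorted_list_of_set.idem_if_sorted_distinct) (simp_all add: strict_sorted_iff)

locale anticommuting_family = ring R for R (structure) +
  fixes X :: "nat set" and t :: "nat \<Rightarrow> 'a"
  assumes t_closed: "i \<in> X \<Longrightarrow> t i \<in> carrier R"
    and t_square: "i \<in> X \<Longrightarrow> t i \<otimes> t i = \<zero>"
    and t_anticommute: "i \<in> X \<Longrightarrow> j \<in> X \<Longrightarrow> i \<noteq> j \<Longrightarrow> t i \<otimes> t j = \<ominus> (t j \<otimes> t i)"
begin

fun word_product :: "nat list \<Rightarrow> 'a" where
  "word_product [] = \<one>"
| "word_product (i # w) = t i \<otimes> word_product w"

lemma word_product_closed: "set w \<subseteq> X \<Longrightarrow> word_product w \<in> carrier R"
  by (induction w) (auto simp: t_closed)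

lemma word_product_append:
  "set u \<subseteq> X \<Longrightarrow> set v \<subseteq> X \<Longrightarrow> word_product (u @ v) = word_product u \<otimes> word_product v"
  by (induction u) (auto simp: t_closed word_product_closed m_assoc)

lemma word_product_insert_letter:
  assumes "i \<in> X" "set l \<subseteq> X"
  shows "t i \<otimes> word_product l =
    (case insert_letter i l of None \<Rightarrow> \<zero> | Some (b, l') \<Rightarrow> signed R b (word_product l'))"
  using assms
proof (induction l)
  case (Cons j l)
  then have ij: "i \<in> X" "j \<in> X" "set l \<subseteq> X" by auto
  note cl = t_closed[OF ij(1)] t_closed[OF ij(2)] word_product_closed[OF ij(3)]
  consider "i < j" | "i = j" | "j < i" by linarith
  then show ?case
  proof cases
    case 2
    then show ?thesis using cl t_square[OF ij(2)] by (simp flip: m_assoc)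
  next
    case 3
    have swap: "t i \<otimes> (t j \<otimes> word_product l) = \<ominus> (t j \<otimes> (t i \<otimes> word_product l))"
      using cl t_anticommute[OF ij(1,2)] 3 by (simp add: l_minus flip: m_assoc)
    then show ?thesis
    proof (cases "insert_letter i l")
      case None
      then show ?thesis using 3 cl Cons.IH[OF ij(1,3)] swap by simp
    next
      case (Some p)
      obtain b l' where p: "p = (b, l')" by (cases p)
      have "set l' \<subseteq> X" using ij Some p insert_letter_set by auto
      then have "word_product l' \<in> carrier R" by (rule word_product_closed)
      then have "\<ominus> (t j \<otimes> signed R b (word_product l')) = signed R (\<not> b) (t j \<otimes> word_product l')"
        using cl by (simp add: signed_def r_minus)
      then show ?thesis using 3 cl Cons.IH[OF ij(1,3)] Some p swap by simp
    qed
  qed simp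
qed (simp add: t_closed)

lemma word_product_normal_order:
  assumes "set w \<subseteq> X"
  shows "word_product w =
    (case normal_order w of None \<Rightarrow> \<zero> | Some (b, l) \<Rightarrow> signed R b (word_product l))"
  using assms
proof (induction w)
  case (Cons i w)
  then have i: "i \<in> X" "set w \<subseteq> X" by auto
  show ?case
  proof (cases "normal_order w")
    case None
    then show ?thesis using Cons.IH[OF i(2)] t_closed[OF i(1)] by simp
  next
    case (Some p)
    obtain b l where p: "p = (b, l)" by (cases p)
    have l: "sorted_wrt (<) l \<and> set l = set w" using normal_order_sorted Some p by simp
    then have cl: "word_product l \<in> carrier R" "set l \<subseteq> X" using i word_product_closed by auto
    have "word_product (i # w) = signed R b (t i \<otimes> word_product l)"
      using Cons.IH[OF i(2)] Some p cl t_closed[OF i(1)] by simp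
    also have "\<dots> = (case normal_order (i # w) of None \<Rightarrow> \<zero> | Some (b, l) \<Rightarrow> signed R b (word_product l))"
    proof (cases "insert_letter i l")
      case None
      then show ?thesis using Some p word_product_insert_letter[OF i(1) cl(2)] by simp
    next
      case (Some q)
      obtain b' l' where q: "q = (b', l')" by (cases q)
      have "word_product l' \<in> carrier R"
        using insert_letter_sorted[of i l b' l'] l Some q i by (intro word_product_closed) auto
      then show ?thesis using \<open>normal_order w = Some p\<close> p Some q
          word_product_insert_letter[OF i(1) cl(2)] by simp
    qed
    finally show ?thesis .
  qed
qed simp

end

section \<open>Coordinates on the exterior algebra of the center\<close>

lemma odd_inversions_singleton_below: "\<forall>j\<in>T. i < j \<Longrightarrow> \<not> odd_inversions {i} T"
proof -
  assume "\<forall>j\<in>T. i < j"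
  then have "{(k, j). k \<in> {i} \<and> j \<in> T \<and> j < k} = {}" by force
  then show ?thesis unfolding odd_inversions_def by (simp only: card.empty) simp
qed

context exterior_coordinates
begin

interpretation E: ring E by (rule E_ring)

lemma signed_E_monomial:
  assumes "a \<in> carrier A" "S \<subseteq> {1..n}"
  shows "signed E b (monomial A a S) = monomial A (signed A b a) S"
proof -
  have "monomial A (\<ominus> a) S \<oplus>\<^bsub>E\<^esub> monomial A a S = \<zero>\<^bsub>E\<^esub>"
    using assms by (auto simp: fun_eq_iff E_add E_zero monomial_def l_neg)
  then show ?thesis
    using assms E.minus_equality by (simp add: signed_def E_monomial del: One_nat_def)
qed

lemma E_generators: "anticommuting_family E {1..n} (\<lambda>i. monomial A \<one> {i})"
proof (intro anticommuting_family.intro E_ring anticommuting_family_axioms.intro)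
  fix i j assume i: "i \<in> {1..n}" and j: "j \<in> {1..n}" and "i \<noteq> j"
  have "odd_inversions {i} {j} \<noteq> odd_inversions {j} {i}"
    using odd_inversions_commute[of "{i}" "{j}"] \<open>i \<noteq> j\<close> by simp
  then show "monomial A \<one> {i} \<otimes>\<^bsub>E\<^esub> monomial A \<one> {j} =
    \<ominus>\<^bsub>E\<^esub> (monomial A \<one> {j} \<otimes>\<^bsub>E\<^esub> monomial A \<one> {i})"
    using i j \<open>i \<noteq> j\<close> signed_E_monomial[of "signed A (odd_inversions {j} {i}) \<one>" "{i, j}" True]
    by (simp add: E_monomial_monomial insert_commute signed_def)
qed (auto simp: E_monomial E_monomial_monomial)

interpretation x: anticommuting_family E "{1..n}" "\<lambda>i. monomial A \<one> {i}" by (rule E_generators)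

lemma E_word_product_sorted:
  assumes "sorted_wrt (<) l" "set l \<subseteq> {1..n}"
  shows "x.word_product l = monomial A \<one> (set l)"
  using assms
proof (induction l)
  case (Cons i l)
  then show ?case
    using odd_inversions_singleton_below[of "set l" i]
    by (auto simp: E_monomial_monomial signed_def simp del: One_nat_def)
qed (simp add: E_one)

lemma E_word_product_central_coeff:
  assumes "set w \<subseteq> {1..n}"
  shows "x.word_product w S \<in> center A"
proof (cases "normal_order w")
  case None
  then show ?thesis
    using x.word_product_normal_order[OF assms] by (simp add: E_zero center_closed)
next
  case (Some p)
  obtain b l where p: "p = (b, l)" by (cases p)
  have l: "sorted_wrt (<) l \<and> set l = set w" using normal_order_sorted Some p by simp
  have "x.word_product w = signed E b (monomial A \<one> (set w))"
    using x.word_product_normal_order[OF assms] Some p l E_word_product_sorted[of l] assms by simp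
  then show ?thesis
    using signed_E_monomial[OF one_closed assms] by (simp add: monomial_def center_closed)
qed

lemma scalar_hom: "(\<lambda>c. monomial A c {}) \<in> ring_hom A E"
  by (rule ring_hom_memI)
    (auto simp: E_monomial E_monomial_monomial E_one, auto simp: fun_eq_iff monomial_def E_add)

lemma E_scalar_mult:
  assumes "f \<in> carrier E" "c \<in> carrier A"
  shows "(monomial A c {} \<otimes>\<^bsub>E\<^esub> f) U = c \<otimes> f U"
  using assms E_outside[OF assms(1)] by (simp add: E_monomial_mult E_coeff)

lemma scalar_commute:
  assumes "f \<in> carrier E" "\<And>S. f S \<in> center A" "a \<in> carrier A"
  shows "monomial A a {} \<otimes>\<^bsub>E\<^esub> f = f \<otimes>\<^bsub>E\<^esub> monomial A a {}"
  using assms by (auto simp: fun_eq_iff E_scalar_mult E_mult_scalar center_def)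

text \<open>
  Only index sets with two elements can occur in the square, and there the two summands
  \<open>g{i} g{j} e\<^sub>i e\<^sub>j\<close> and \<open>g{j} g{i} e\<^sub>j e\<^sub>i\<close> cancel since the coefficients commute. This holds also in
  characteristic 2.
\<close>

lemma degree_one_square:
  assumes g: "g \<in> carrier E" and gc: "\<And>S. g S \<in> center A" and deg: "\<And>S. g S \<noteq> \<zero> \<Longrightarrow> card S = 1"
  shows "g \<otimes>\<^bsub>E\<^esub> g = \<zero>\<^bsub>E\<^esub>"
proof
  fix U
  note c = E_coeff[OF g]
  let ?term = "\<lambda>S. signed A (odd_inversions S (U - S)) (g S \<otimes> g (U - S))"
  have tc: "?term S \<in> carrier A" for S using c by simp
  have "(\<Oplus>S\<in>Pow U. ?term S) = \<zero>" if U: "U \<subseteq> {1..n}"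
  proof (cases "card U = 2")
    case True
    then obtain i j where ij: "U = {i, j}" "i \<noteq> j" by (auto simp: card_2_iff)
    have "(\<Oplus>S\<in>Pow U. ?term S) = (\<Oplus>S\<in>{{i}, {j}}. ?term S)"
    proof (rule add.finprod_mono_neutral_cong_right)
      fix S assume S: "S \<in> Pow U - {{i}, {j}}"
      then have "S = {} \<or> S = U" using ij by blast
      then have "card S \<noteq> 1" using True by auto
      then have "g S = \<zero>" using deg by blast
      then show "?term S = \<zero>" using c by simp
    qed (use ij tc in auto)
    also have "\<dots> = ?term {i} \<oplus> ?term {j}"
      using ij c by (subst finsum_insert) auto
    also have "\<dots> = signed A (odd_inversions {i} {j}) (g {i} \<otimes> g {j}) \<oplus>
        signed A (odd_inversions {j} {i}) (g {j} \<otimes> g {i})"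
    proof -
      have "U - {i} = {j}" "U - {j} = {i}" using ij by auto
      then show ?thesis by simp
    qed
    also have "g {j} \<otimes> g {i} = g {i} \<otimes> g {j}" using gc[of "{i}"] c by (auto simp: center_def)
    also have "signed A (odd_inversions {i} {j}) (g {i} \<otimes> g {j}) \<oplus>
        signed A (odd_inversions {j} {i}) (g {i} \<otimes> g {j}) = \<zero>"
      using odd_inversions_commute[of "{i}" "{j}"] ij(2) c by (auto simp: signed_def l_neg r_neg)
    finally show ?thesis .
  next
    case False
    have "?term S = \<zero>" if "S \<in> Pow U" for S
    proof (rule ccontr)
      assume "?term S \<noteq> \<zero>"
      then have "g S \<noteq> \<zero>" "g (U - S) \<noteq> \<zero>" using c by auto
      then have "card S = 1" "card (U - S) = 1" using deg by auto
      moreover have "card S + card (U - S) = card U"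
        using that U finite_subset[OF U] by (simp add: card_Diff_subset card_mono finite_subset)
      ultimately show False using False by simp
    qed
    then show ?thesis by (intro add.finprod_one_eqI)
  qed
  then show "(g \<otimes>\<^bsub>E\<^esub> g) U = \<zero>\<^bsub>E\<^esub> U" by (simp add: E_mult E_zero)
qed

text \<open>
  Short names for the stages of the presentation of \<open>\<Lambda>(C\<^sup>n)\<close> by words: scalars, tensor algebra,
  ideal generated by the squares of vectors, quotient.
\<close>

definition C :: "('a, 'm) ring_scheme" where "C = center_ring A"
definition T :: "(nat list \<Rightarrow> 'a) ring" where "T = tensor_algebra C n"
definition I :: "(nat list \<Rightarrow> 'a) set" where "I = exterior_ideal C n"
definition L :: "(nat list \<Rightarrow> 'a) set ring" where "L = exterior_algebra C n"

lemma C_simps [simp]: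
  "carrier C = center A" "\<one>\<^bsub>C\<^esub> = \<one>" "\<zero>\<^bsub>C\<^esub> = \<zero>" "x \<oplus>\<^bsub>C\<^esub> y = x \<oplus> y" "x \<otimes>\<^bsub>C\<^esub> y = x \<otimes> y"
  "monomial C = monomial A"
  by (simp_all add: C_def center_ring_def monomial_def fun_eq_iff)

lemma C_ring: "ring C"
  unfolding C_def using center_ring_cring[OF ring_axioms] by (rule cring.axioms)

lemma L_eq: "L = T Quot I" and T_eq: "T = monoid_ring C (word_monoid n)"
  by (simp_all add: L_def T_def I_def exterior_algebra_def tensor_algebra_def)

lemma T_ring: "ring T" and L_ring: "ring L" and I_ideal: "ideal I T"
  using C_ring
  by (auto simp: T_def L_def I_def intro: tensor_algebra_ring exterior_algebra_ring exterior_ideal_ideal)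

interpretation T: ring T by (rule T_ring)

lemma words [simp]:
  "carrier (word_monoid n) = lists {1..n}" "\<one>\<^bsub>word_monoid n\<^esub> = []" "u \<otimes>\<^bsub>word_monoid n\<^esub> v = u @ v"
  by (simp_all add: word_monoid_def)

lemma T_monomial: "c \<in> center A \<Longrightarrow> set w \<subseteq> {1..n} \<Longrightarrow> monomial A c w \<in> carrier T"
  unfolding T_eq using monomial_closed[OF C_ring word_monoid_monoid, of c w n] by (simp add: lists_eq_set)

lemma T_mult:
  assumes "c \<in> center A" "d \<in> center A" "set u \<subseteq> {1..n}" "set v \<subseteq> {1..n}"
  shows "monomial A c u \<otimes>\<^bsub>T\<^esub> monomial A d v = monomial A (c \<otimes> d) (u @ v)"
  unfolding T_eq using monomial_mult[OF C_ring word_monoid_monoid, of c d u n v] assms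
  by (simp add: lists_eq_set)

lemma T_add: "f \<oplus>\<^bsub>T\<^esub> g = (\<lambda>w. f w \<oplus> g w)" and T_zero: "\<zero>\<^bsub>T\<^esub> = (\<lambda>w. \<zero>)"
  and T_one: "\<one>\<^bsub>T\<^esub> = monomial A \<one> []"
  unfolding T_eq monoid_ring_simps[OF C_ring word_monoid_monoid] by simp_all

lemma T_induct [consumes 1, case_names zero monomial add]:
  assumes f: "f \<in> carrier T" and "P \<zero>\<^bsub>T\<^esub>"
    and mon: "\<And>c w. c \<in> center A \<Longrightarrow> set w \<subseteq> {1..n} \<Longrightarrow> f w \<noteq> \<zero> \<Longrightarrow> P (monomial A c w)"
    and add: "\<And>g h. g \<in> carrier T \<Longrightarrow> h \<in> carrier T \<Longrightarrow> P g \<Longrightarrow> P h \<Longrightarrow> P (g \<oplus>\<^bsub>T\<^esub> h)"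
  shows "P f"
proof -
  note D = monoid_ring_carrierD[OF C_ring word_monoid_monoid f[unfolded T_eq]]
  have "f \<in> carrier T \<and> P f"
  proof (rule finite_support_induct[OF C_ring D(3) D(1) order.refl])
    show "(\<lambda>x. \<zero>\<^bsub>C\<^esub>) \<in> carrier T \<and> P (\<lambda>x. \<zero>\<^bsub>C\<^esub>)"
      using assms(2) T.zero_closed by (simp add: T_zero)
    show "(\<lambda>x. g x \<oplus>\<^bsub>C\<^esub> h x) \<in> carrier T \<and> P (\<lambda>x. g x \<oplus>\<^bsub>C\<^esub> h x)"
      if "g \<in> carrier T \<and> P g" "h \<in> carrier T \<and> P h" for g h
      using that add[of g h] T.a_closed[of g h] by (simp add: T_add)
    show "monomial C c w \<in> carrier T \<and> P (monomial C c w)"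
      if "c \<in> carrier C" "w \<in> {w. f w \<noteq> \<zero>\<^bsub>C\<^esub>}" for c w
    proof -
      have "set w \<subseteq> {1..n}" using that(2) D(2) by auto
      then show ?thesis using that mon T_monomial by simp
    qed
  qed
  then show ?thesis ..
qed

text \<open>
  The homomorphism from \<open>T\<close> to \<open>E\<close> that sends the \<open>i\<close>-th basis vector to \<open>e\<^sub>i\<close>; it will descend to \<open>L\<close>.
\<close>

definition coord :: "(nat list \<Rightarrow> 'a) \<Rightarrow> nat set \<Rightarrow> 'a" where
  "coord = monoid_ring_eval C E (\<lambda>c. monomial A c {}) x.word_product"

lemma coord_hom: "coord \<in> ring_hom T E"
  and coord_monomial: "c \<in> center A \<Longrightarrow> set w \<subseteq> {1..n} \<Longrightarrow>
    coord (monomial A c w) = monomial A c {} \<otimes>\<^bsub>E\<^esub> x.word_product w"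
proof -
  have rho: "(\<lambda>c. monomial A c {}) \<in> ring_hom C E"
    using ring_hom_memE[OF scalar_hom] by (intro ring_hom_memI) (auto simp: center_carrier)
  note facts = C_ring word_monoid_monoid[of n] E_ring rho
  have 1: "x.word_product m \<in> carrier E" if "m \<in> carrier (word_monoid n)" for m
    using that by (intro x.word_product_closed) auto
  have 2: "x.word_product (m \<otimes>\<^bsub>word_monoid n\<^esub> k) = x.word_product m \<otimes>\<^bsub>E\<^esub> x.word_product k"
    if "m \<in> carrier (word_monoid n)" "k \<in> carrier (word_monoid n)" for m k
    using that x.word_product_append[of m k] by (simp add: lists_eq_set)
  have 3: "monomial A c {} \<otimes>\<^bsub>E\<^esub> x.word_product m = x.word_product m \<otimes>\<^bsub>E\<^esub> monomial A c {}"
    if "c \<in> carrier C" "m \<in> carrier (word_monoid n)" for c m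
    using that center_subset
    by (intro scalar_commute 1 E_word_product_central_coeff) auto
  show "coord \<in> ring_hom T E"
    unfolding coord_def T_eq
    by (rule monoid_ring_eval_hom(1)[OF facts 1 _ 2 3]) auto
  show "coord (monomial A c w) = monomial A c {} \<otimes>\<^bsub>E\<^esub> x.word_product w"
    if "c \<in> center A" "set w \<subseteq> {1..n}"
    using monoid_ring_eval_hom(2)[OF facts 1 _ 2 3, of c w] that
    unfolding coord_def by (simp add: lists_eq_set)
qed

interpretation coord: ring_hom_ring T E coord
  by (intro ring_hom_ringI2 T_ring E_ring coord_hom)

lemma coord_central:
  assumes "f \<in> carrier T"
  shows "coord f S \<in> center A"
  using assms
proof (induction f rule: T_induct)
  case (monomial c w)
  then show ?case
    using E_word_product_central_coeff[of w S] x.word_product_closed[of w]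
    by (auto simp: center_carrier coord_monomial E_scalar_mult center_closed)
qed (simp_all add: E_zero E_add center_closed)

lemma coord_degree_one:
  assumes "v \<in> degree_one_part C n" "coord v S \<noteq> \<zero>"
  shows "card S = 1"
proof -
  have v: "v \<in> carrier T" "\<And>w. v w \<noteq> \<zero> \<Longrightarrow> length w = 1"
    using assms(1) by (auto simp: degree_one_part_def T_def)
  have "coord v S = \<zero> \<or> card S = 1"
    using v(1)
  proof (induction v rule: T_induct)
    case (monomial c w)
    then obtain i where w: "w = [i]" using v(2)[of w] by (auto simp: length_Suc_conv)
    then show ?case using monomial
      by (auto simp: coord_monomial E_monomial E_monomial_monomial center_carrier)
        (auto simp: monomial_def)
  qed (auto simp: E_zero E_add coord.hom_closed E_coeff)
  then show ?thesis using assms(2) by blast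
qed

lemma coord_kills_ideal:
  assumes "f \<in> I"
  shows "coord f = \<zero>\<^bsub>E\<^esub>"
proof -
  have "{v \<otimes>\<^bsub>T\<^esub> v | v. v \<in> degree_one_part C n} \<subseteq> a_kernel T E coord"
  proof clarify
    fix v assume v: "v \<in> degree_one_part C n"
    then have vT: "v \<in> carrier T" by (simp add: degree_one_part_def T_def)
    have "coord v \<otimes>\<^bsub>E\<^esub> coord v = \<zero>\<^bsub>E\<^esub>"
      using coord_central[OF vT] coord_degree_one[OF v] vT by (intro degree_one_square) auto
    then show "v \<otimes>\<^bsub>T\<^esub> v \<in> a_kernel T E coord"
      unfolding a_kernel_def'
      using T.m_closed[OF vT vT] coord.hom_mult[OF vT vT] by (intro CollectI conjI) simp_all
  qed
  then have "I \<subseteq> a_kernel T E coord"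
    unfolding I_def exterior_ideal_def T_def[symmetric]
    by (intro T.genideal_minimal coord.kernel_is_ideal)
  then show ?thesis using assms unfolding a_kernel_def' by blast
qed

definition ext_coord :: "(nat list \<Rightarrow> 'a) set \<Rightarrow> nat set \<Rightarrow> 'a" where
  "ext_coord X = the_elem (coord ` X)"

lemma ext_coord_hom: "ext_coord \<in> ring_hom L E"
  and ext_coord_coset: "f \<in> carrier T \<Longrightarrow> ext_coord (I +>\<^bsub>T\<^esub> f) = coord f"
  using ring_hom_factor[OF I_ideal E_ring coord_hom coord_kills_ideal]
  unfolding L_eq ext_coord_def by auto

lemma proj_hom_ring: "ring_hom_ring T L ((+>\<^bsub>T\<^esub>) I)"
  unfolding L_eq by (rule ideal.rcos_ring_hom_ring[OF I_ideal])

interpretation L: ring L by (rule L_ring)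
interpretation proj: ring_hom_ring T L "(+>\<^bsub>T\<^esub>) I" by (rule proj_hom_ring)

lemma L_cases:
  assumes "X \<in> carrier L"
  obtains f where "f \<in> carrier T" "X = I +>\<^bsub>T\<^esub> f"
  using assms unfolding L_eq FactRing_def A_RCOSETS_def' by auto

lemma ext_coord_central: "X \<in> carrier L \<Longrightarrow> ext_coord X S \<in> center A"
  by (elim L_cases) (simp add: ext_coord_coset coord_central)

definition gen :: "nat \<Rightarrow> (nat list \<Rightarrow> 'a) set" where
  "gen i = I +>\<^bsub>T\<^esub> monomial A \<one> [i]"

lemma degree_one_square_in_ideal:
  assumes "v \<in> degree_one_part C n"
  shows "(I +>\<^bsub>T\<^esub> v) \<otimes>\<^bsub>L\<^esub> (I +>\<^bsub>T\<^esub> v) = \<zero>\<^bsub>L\<^esub>"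
proof -
  interpret I: ideal I T by (rule I_ideal)
  have v: "v \<in> carrier T" using assms by (simp add: degree_one_part_def T_def)
  have "{v \<otimes>\<^bsub>T\<^esub> v | v. v \<in> degree_one_part C n} \<subseteq> I"
    unfolding I_def exterior_ideal_def T_def[symmetric]
    by (rule T.genideal_self) (auto simp: degree_one_part_def T_def[symmetric])
  then have "v \<otimes>\<^bsub>T\<^esub> v \<in> I" using assms by blast
  then have "I +>\<^bsub>T\<^esub> (v \<otimes>\<^bsub>T\<^esub> v) = I"
    by (rule I.a_rcos_const)
  moreover have "\<zero>\<^bsub>L\<^esub> = I" unfolding L_eq FactRing_def by simp
  ultimately show ?thesis unfolding proj.hom_mult[OF v v] by simp
qed

lemma monomial_degree_one: "i \<in> {1..n} \<Longrightarrow> monomial A \<one> [i] \<in> degree_one_part C n"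
  using T_monomial[of \<one> "[i]"]
  by (auto simp: degree_one_part_def T_def[symmetric] center_closed) (auto simp: monomial_def split: if_splits)

text \<open>
  Anticommutativity is the polarization of \<open>v v = 0\<close> at \<open>v = t\<^sub>i + t\<^sub>j\<close>.
\<close>

lemma L_generators: "anticommuting_family L {1..n} gen"
proof (intro anticommuting_family.intro L_ring anticommuting_family_axioms.intro)
  have m: "monomial A \<one> [i] \<in> carrier T" if "i \<in> {1..n}" for i
    using that by (intro T_monomial) (auto simp: center_closed)
  show cl: "gen i \<in> carrier L" if "i \<in> {1..n}" for i
    using m[OF that] by (simp add: gen_def)
  show sq: "gen i \<otimes>\<^bsub>L\<^esub> gen i = \<zero>\<^bsub>L\<^esub>" if "i \<in> {1..n}" for i
    unfolding gen_def by (intro degree_one_square_in_ideal monomial_degree_one that)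
  fix i j assume i: "i \<in> {1..n}" and j: "j \<in> {1..n}" and "i \<noteq> j"
  let ?v = "monomial A \<one> [i] \<oplus>\<^bsub>T\<^esub> monomial A \<one> [j]"
  have "?v \<in> degree_one_part C n"
    using monomial_degree_one[OF i] monomial_degree_one[OF j] T.a_closed[OF m[OF i] m[OF j]]
    by (auto simp: degree_one_part_def T_def[symmetric] T_add) (auto simp: monomial_def split: if_splits)
  then have "(gen i \<oplus>\<^bsub>L\<^esub> gen j) \<otimes>\<^bsub>L\<^esub> (gen i \<oplus>\<^bsub>L\<^esub> gen j) = \<zero>\<^bsub>L\<^esub>"
    using degree_one_square_in_ideal[of ?v] m i j by (simp add: gen_def)
  then have "gen i \<otimes>\<^bsub>L\<^esub> gen j \<oplus>\<^bsub>L\<^esub> gen j \<otimes>\<^bsub>L\<^esub> gen i = \<zero>\<^bsub>L\<^esub>"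
    using cl[OF i] cl[OF j] sq[OF i] sq[OF j] by (simp add: L.l_distr L.r_distr L.a_comm)
  then show "gen i \<otimes>\<^bsub>L\<^esub> gen j = \<ominus>\<^bsub>L\<^esub> (gen j \<otimes>\<^bsub>L\<^esub> gen i)"
    using cl[OF i] cl[OF j] by (intro L.minus_equality[symmetric]) auto
qed

interpretation y: anticommuting_family L "{1..n}" gen by (rule L_generators)

abbreviation scalar :: "'a \<Rightarrow> (nat list \<Rightarrow> 'a) set" where
  "scalar c \<equiv> I +>\<^bsub>T\<^esub> monomial A c []"

lemma scalar_ext_hom: "scalar \<in> ring_hom C L"
proof (rule ring_hom_memI)
  show "scalar c \<in> carrier L" if "c \<in> carrier C" for c
    using that by (simp add: T_monomial)
  show "scalar (c \<otimes>\<^bsub>C\<^esub> d) = scalar c \<otimes>\<^bsub>L\<^esub> scalar d" if "c \<in> carrier C" "d \<in> carrier C" for c d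
    using that T_mult[of c d "[]" "[]"] by (simp add: T_monomial flip: proj.hom_mult)
  have "monomial A (c \<oplus> d) [] = monomial A c [] \<oplus>\<^bsub>T\<^esub> monomial A d []"
    if "c \<in> center A" "d \<in> center A" for c d :: 'a
    using that by (auto simp: T_add monomial_def)
  then show "scalar (c \<oplus>\<^bsub>C\<^esub> d) = scalar c \<oplus>\<^bsub>L\<^esub> scalar d" if "c \<in> carrier C" "d \<in> carrier C" for c d
    using that by (simp add: T_monomial)
  show "scalar \<one>\<^bsub>C\<^esub> = \<one>\<^bsub>L\<^esub>"
    using proj.hom_one by (simp add: T_one)
qed

interpretation scalar: ring_hom_ring C L scalar
  by (intro ring_hom_ringI2 C_ring L_ring scalar_ext_hom)

definition basis :: "nat set \<Rightarrow> (nat list \<Rightarrow> 'a) set" where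
  "basis S = y.word_product (sorted_list_of_set S)"

lemma basis_closed: "S \<subseteq> {1..n} \<Longrightarrow> basis S \<in> carrier L"
  unfolding basis_def using finite_subset[of S "{1..n}"] by (intro y.word_product_closed) auto

lemma proj_monomial:
  assumes "c \<in> center A" "set w \<subseteq> {1..n}"
  shows "I +>\<^bsub>T\<^esub> monomial A c w = scalar c \<otimes>\<^bsub>L\<^esub> y.word_product w"
proof -
  have "I +>\<^bsub>T\<^esub> monomial A \<one> w = y.word_product w"
    using assms(2)
  proof (induction w)
    case (Cons i w)
    have "monomial A \<one> (i # w) = monomial A \<one> [i] \<otimes>\<^bsub>T\<^esub> monomial A \<one> w"
      using Cons.prems T_mult[of \<one> \<one> "[i]" w] by (simp add: center_closed)
    moreover have "I +>\<^bsub>T\<^esub> monomial A \<one> [i] = gen i" by (simp add: gen_def)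
    ultimately show ?case
      using Cons by (simp add: T_monomial center_closed)
  qed (use proj.hom_one in \<open>simp add: T_one\<close>)
  moreover have "monomial A c w = monomial A c [] \<otimes>\<^bsub>T\<^esub> monomial A \<one> w"
    using assms T_mult[of c \<one> "[]" w] by (auto simp: center_closed center_carrier)
  ultimately show ?thesis using assms by (simp add: T_monomial center_closed)
qed

lemma ext_coord_scalar_basis:
  assumes "c \<in> center A" "S \<subseteq> {1..n}"
  shows "ext_coord (scalar c \<otimes>\<^bsub>L\<^esub> basis S) = monomial A c S"
proof -
  let ?l = "sorted_list_of_set S"
  have fin: "finite S" using assms(2) by (rule finite_subset) simp
  have l: "set ?l \<subseteq> {1..n}" "sorted_wrt (<) ?l" "set ?l = S" using fin assms(2) by auto
  have c: "c \<in> carrier A" using assms(1) center_subset by blast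
  have "ext_coord (scalar c \<otimes>\<^bsub>L\<^esub> basis S) = coord (monomial A c ?l)"
    unfolding basis_def proj_monomial[OF assms(1) l(1), symmetric]
    by (rule ext_coord_coset) (rule T_monomial[OF assms(1) l(1)])
  also have "\<dots> = monomial A c S"
    using c assms(2) unfolding coord_monomial[OF assms(1) l(1)] E_word_product_sorted[OF l(2,1)] l(3)
    by (simp add: E_monomial_monomial)
  finally show ?thesis .
qed

text \<open>
  The products \<open>e\<^sub>S\<close> span \<open>\<Lambda>(C\<^sup>n)\<close>, because normal ordering turns each word into zero or \<open>\<plusminus> e\<^sub>S\<close>. Their
  linear independence is not shown separately: it comes out of the existence of coordinates.
\<close>

lemma L_induct [consumes 1, case_names zero basis add]:
  assumes X: "X \<in> carrier L" and zero: "P \<zero>\<^bsub>L\<^esub>"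
    and bas: "\<And>c S. c \<in> center A \<Longrightarrow> S \<subseteq> {1..n} \<Longrightarrow> P (scalar c \<otimes>\<^bsub>L\<^esub> basis S)"
    and add: "\<And>Y Z. Y \<in> carrier L \<Longrightarrow> Z \<in> carrier L \<Longrightarrow> P Y \<Longrightarrow> P Z \<Longrightarrow> P (Y \<oplus>\<^bsub>L\<^esub> Z)"
  shows "P X"
proof -
  obtain f where f: "f \<in> carrier T" and X: "X = I +>\<^bsub>T\<^esub> f" using X by (rule L_cases)
  show ?thesis unfolding X using f
  proof (induction f rule: T_induct)
    case zero
    then show ?case using assms(2) by simp
  next
    case (add g h)
    then show ?case using assms(4) by simp
  next
    case (monomial c w)
    have sc: "scalar c \<in> carrier L" using monomial(1) scalar.hom_closed[of c] by simp
    show ?case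
    proof (cases "normal_order w")
      case None
      then show ?thesis
        using y.word_product_normal_order[OF monomial(2)] sc \<open>P \<zero>\<^bsub>L\<^esub>\<close>
        unfolding proj_monomial[OF monomial(1,2)] by simp
    next
      case (Some p)
      obtain b l where p: "p = (b, l)" by (cases p)
      have l: "sorted_wrt (<) l \<and> set l = set w" using normal_order_sorted Some p by simp
      then have "l = sorted_list_of_set (set w)" using sorted_list_of_set_of_sorted[of l] by simp
      then have bw: "y.word_product w = signed L b (basis (set w))"
        using y.word_product_normal_order[OF monomial(2)] Some p by (simp add: basis_def)
      have "\<ominus>\<^bsub>C\<^esub> c = \<ominus> c" using monomial(1) center_closed(5)[of c True]
        by (intro abelian_group.minus_equality[OF ring.is_abelian_group[OF C_ring]])
          (auto simp: signed_def l_neg center_carrier)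
      then have "scalar (signed A b c) = signed L b (scalar c)"
        using scalar.hom_a_inv[of c] monomial(1) by (auto simp: signed_def)
      then have "I +>\<^bsub>T\<^esub> monomial A c w = scalar (signed A b c) \<otimes>\<^bsub>L\<^esub> basis (set w)"
        unfolding proj_monomial[OF monomial(1,2)] bw
        using sc basis_closed[OF monomial(2)] by simp
      then show ?thesis using bas center_closed(5)[OF monomial(1)] monomial(2) by simp
    qed
  qed
qed

end

section \<open>Coordinates on the tensor product\<close>

lemma (in ring) int_multiple_hom: "(\<lambda>k. [k] \<cdot> \<one>) \<in> ring_hom int_ring R"
proof (rule ring_hom_memI)
  fix k l :: int
  have "([k] \<cdot> \<one>) \<otimes> ([l] \<cdot> \<one>) = [k] \<cdot> ([l] \<cdot> \<one>)"
    by (simp add: add_pow_ldistr_int)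
  then show "[(k \<otimes>\<^bsub>int_ring\<^esub> l)] \<cdot> \<one> = ([k] \<cdot> \<one>) \<otimes> ([l] \<cdot> \<one>)"
    by (simp add: add.int_pow_pow mult.commute)
qed (simp_all add: add.int_pow_mult)

lemma centrally_essential_iso_imp:
  assumes R: "ring R" and S: "ring S" and h: "h \<in> ring_iso R S" and ce: "centrally_essential R"
  shows "centrally_essential S"
  unfolding centrally_essential_iff[OF S]
proof (intro ballI impI)
  interpret h: ring_hom_ring R S h
    using h by (intro ring_hom_ringI2 R S) (simp add: ring_iso_def)
  have bij: "bij_betw h (carrier R) (carrier S)" using h by (simp add: ring_iso_def)
  have inj: "x = y" if "h x = h y" "x \<in> carrier R" "y \<in> carrier R" for x y
    using bij that by (auto simp: bij_betw_def inj_on_def)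
  have onto: "\<exists>x\<in>carrier R. h x = y" if "y \<in> carrier S" for y
    using bij that by (metis bij_betw_def imageE)
  have cen: "h c \<in> center S" if c: "c \<in> center R" for c
  proof -
    have cR: "c \<in> carrier R" using c by (rule h.R.center_carrier)
    have "h c \<otimes>\<^bsub>S\<^esub> y = y \<otimes>\<^bsub>S\<^esub> h c" if y: "y \<in> carrier S" for y
    proof -
      obtain x where x: "x \<in> carrier R" "h x = y" using onto[OF y] by blast
      then have "h (c \<otimes>\<^bsub>R\<^esub> x) = h (x \<otimes>\<^bsub>R\<^esub> c)" using c by (simp add: center_def)
      then show ?thesis using x cR by simp
    qed
    then show ?thesis using cR by (simp add: center_def)
  qed
  fix y assume "y \<in> carrier S" and nz: "y \<noteq> \<zero>\<^bsub>S\<^esub>"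
  then obtain x where x: "x \<in> carrier R" "h x = y" using onto by blast
  then have "x \<noteq> \<zero>\<^bsub>R\<^esub>" using nz by auto
  then obtain c where c: "c \<in> center R" "x \<otimes>\<^bsub>R\<^esub> c \<noteq> \<zero>\<^bsub>R\<^esub>" "x \<otimes>\<^bsub>R\<^esub> c \<in> center R"
    using ce x(1) unfolding centrally_essential_iff[OF R] by blast
  have cR: "c \<in> carrier R" using c(1) by (rule h.R.center_carrier)
  have eq: "y \<otimes>\<^bsub>S\<^esub> h c = h (x \<otimes>\<^bsub>R\<^esub> c)" using x cR by simp
  moreover have "h (x \<otimes>\<^bsub>R\<^esub> c) \<noteq> \<zero>\<^bsub>S\<^esub>"
    using inj[of "x \<otimes>\<^bsub>R\<^esub> c" "\<zero>\<^bsub>R\<^esub>"] c(2) x(1) cR by auto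
  ultimately show "\<exists>d\<in>center S. y \<otimes>\<^bsub>S\<^esub> d \<noteq> \<zero>\<^bsub>S\<^esub> \<and> y \<otimes>\<^bsub>S\<^esub> d \<in> center S"
    using cen[OF c(1)] cen[OF c(3)] by (intro bexI[of _ "h c"]) simp_all
qed

lemma centrally_essential_iso:
  assumes R: "ring R" and S: "ring S" and h: "h \<in> ring_iso R S"
  shows "centrally_essential R \<longleftrightarrow> centrally_essential S"
  using centrally_essential_iso_imp[OF R S h]
    centrally_essential_iso_imp[OF S R ring_iso_set_sym[OF R h]] by blast

context exterior_coordinates
begin

interpretation E: ring E by (rule E_ring)
interpretation L: ring L by (rule L_ring)
interpretation ext: ring_hom_ring L E ext_coord
  by (intro ring_hom_ringI2 L_ring E_ring ext_coord_hom)

text \<open>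
  Short names for the presentation of \<open>\<Lambda>(A\<^sup>n)\<close> as a tensor product; \<open>pure a X\<close> below is the pure tensor
  of \<open>a\<close> and \<open>X\<close>.
\<close>

definition F :: "('a \<times> (nat list \<Rightarrow> 'a) set \<Rightarrow> int) ring" where
  "F = monoid_ring int_ring (A \<times>\<times> L)"
definition J :: "('a \<times> (nat list \<Rightarrow> 'a) set \<Rightarrow> int) set" where
  "J = Idl\<^bsub>F\<^esub> (tensor_relations C A (\<lambda>c. c) L scalar)"
definition Q :: "('a \<times> (nat list \<Rightarrow> 'a) set \<Rightarrow> int) set ring" where
  "Q = F Quot J"

lemma Q_eq: "exterior_algebra_nc A n = Q"
proof -
  have "exterior_scalar C n = scalar"
    by (simp add: exterior_scalar_def I_def T_def fun_eq_iff)
  then show ?thesis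
    by (simp add: exterior_algebra_nc_def algebra_tensor_product_def Q_def J_def F_def L_def
        flip: C_def)
qed

lemma int_ring_ring: "ring int_ring"
  using int_is_cring by (rule cring.axioms)

lemma AL_monoid: "Group.monoid (A \<times>\<times> L)"
  by (rule DirProd_monoid) (rule monoid_axioms L.monoid_axioms)+

lemma F_ring: "ring F"
  unfolding F_def by (rule monoid_ring_ring[OF int_ring_ring AL_monoid])

interpretation F: ring F by (rule F_ring)

abbreviation d :: "'a \<Rightarrow> (nat list \<Rightarrow> 'a) set \<Rightarrow> 'a \<times> (nat list \<Rightarrow> 'a) set \<Rightarrow> int" where
  "d a X \<equiv> monomial int_ring 1 (a, X)"

lemma F_monomial: "a \<in> carrier A \<Longrightarrow> X \<in> carrier L \<Longrightarrow> monomial int_ring k (a, X) \<in> carrier F"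
  unfolding F_def by (rule monomial_closed[OF int_ring_ring AL_monoid]) auto

lemma scalar_L: "c \<in> center A \<Longrightarrow> scalar c \<in> carrier L"
  using ring_hom_memE(1)[OF scalar_ext_hom, of c] by simp

lemma relations_closed: "tensor_relations C A (\<lambda>c. c) L scalar \<subseteq> carrier F"
  unfolding tensor_relations_def Let_def F_def[symmetric]
  by (auto simp: center_carrier scalar_L
      simp del: monoid.simps intro!: F.minus_closed F.a_closed F_monomial)

lemma J_ideal: "ideal J F"
  unfolding J_def by (rule F.genideal_ideal[OF relations_closed])

lemma Q_ring: "ring Q"
  unfolding Q_def by (rule ideal.quotient_is_ring[OF J_ideal])

interpretation Q: ring Q by (rule Q_ring)

lemma Q_proj: "ring_hom_ring F Q ((+>\<^bsub>F\<^esub>) J)"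
  unfolding Q_def by (rule ideal.rcos_ring_hom_ring[OF J_ideal])

interpretation proj: ring_hom_ring F Q "(+>\<^bsub>F\<^esub>) J" by (rule Q_proj)

definition pure :: "'a \<Rightarrow> (nat list \<Rightarrow> 'a) set \<Rightarrow> ('a \<times> (nat list \<Rightarrow> 'a) set \<Rightarrow> int) set" where
  "pure a X = J +>\<^bsub>F\<^esub> d a X"

lemma pure_closed: "a \<in> carrier A \<Longrightarrow> X \<in> carrier L \<Longrightarrow> pure a X \<in> carrier Q"
  by (simp add: pure_def F_monomial)

lemma proj_eqI:
  assumes "u \<in> carrier F" "v \<in> carrier F" "u \<ominus>\<^bsub>F\<^esub> v \<in> tensor_relations C A (\<lambda>c. c) L scalar"
  shows "J +>\<^bsub>F\<^esub> u = J +>\<^bsub>F\<^esub> v"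
proof -
  interpret J: ideal J F by (rule J_ideal)
  have "u \<ominus>\<^bsub>F\<^esub> v \<in> J"
    using F.genideal_self[OF relations_closed] assms(3) unfolding J_def by blast
  then show ?thesis using F.quotient_eq_iff_same_a_r_cos[OF J_ideal assms(1,2)] by blast
qed

lemma pure_add_left:
  assumes "a \<in> carrier A" "a' \<in> carrier A" "X \<in> carrier L"
  shows "pure (a \<oplus> a') X = pure a X \<oplus>\<^bsub>Q\<^esub> pure a' X"
proof -
  have "J +>\<^bsub>F\<^esub> d (a \<oplus> a') X = J +>\<^bsub>F\<^esub> (d a X \<oplus>\<^bsub>F\<^esub> d a' X)"
    using assms
    by (intro proj_eqI) (auto simp: F_monomial tensor_relations_def Let_def F_def[symmetric])
  then show ?thesis using assms by (simp add: pure_def F_monomial)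
qed

lemma pure_add_right:
  assumes "a \<in> carrier A" "X \<in> carrier L" "Y \<in> carrier L"
  shows "pure a (X \<oplus>\<^bsub>L\<^esub> Y) = pure a X \<oplus>\<^bsub>Q\<^esub> pure a Y"
proof -
  have "J +>\<^bsub>F\<^esub> d a (X \<oplus>\<^bsub>L\<^esub> Y) = J +>\<^bsub>F\<^esub> (d a X \<oplus>\<^bsub>F\<^esub> d a Y)"
    using assms
    by (intro proj_eqI) (auto simp: F_monomial tensor_relations_def Let_def F_def[symmetric])
  then show ?thesis using assms by (simp add: pure_def F_monomial)
qed

lemma pure_balanced:
  assumes "a \<in> carrier A" "c \<in> center A" "X \<in> carrier L"
  shows "pure (a \<otimes> c) X = pure a (scalar c \<otimes>\<^bsub>L\<^esub> X)"
  unfolding pure_def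
proof (rule proj_eqI)
  show "d (a \<otimes> c) X \<in> carrier F" "d a (scalar c \<otimes>\<^bsub>L\<^esub> X) \<in> carrier F"
    using assms by (simp_all add: F_monomial center_carrier scalar_L del: monoid.simps)
  show "d (a \<otimes> c) X \<ominus>\<^bsub>F\<^esub> d a (scalar c \<otimes>\<^bsub>L\<^esub> X) \<in> tensor_relations C A (\<lambda>c. c) L scalar"
    unfolding tensor_relations_def Let_def F_def[symmetric]
    by (rule UnI2, rule CollectI, intro exI[of _ a] exI[of _ X] exI[of _ c] conjI refl)
      (use assms in simp_all)
qed

lemma pure_zero:
  assumes "a \<in> carrier A" "X \<in> carrier L"
  shows "pure \<zero> X = \<zero>\<^bsub>Q\<^esub>" "pure a \<zero>\<^bsub>L\<^esub> = \<zero>\<^bsub>Q\<^esub>"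
proof -
  have idem: "q = \<zero>\<^bsub>Q\<^esub>" if "q \<in> carrier Q" "q = q \<oplus>\<^bsub>Q\<^esub> q" for q
    using that Q.add.r_cancel_one'[of q q] by blast
  show "pure \<zero> X = \<zero>\<^bsub>Q\<^esub>"
    using pure_add_left[of \<zero> \<zero> X] assms by (intro idem pure_closed) simp_all
  show "pure a \<zero>\<^bsub>L\<^esub> = \<zero>\<^bsub>Q\<^esub>"
    using pure_add_right[of a "\<zero>\<^bsub>L\<^esub>" "\<zero>\<^bsub>L\<^esub>"] assms by (intro idem pure_closed) simp_all
qed

text \<open>
  The homomorphism from \<open>F\<close> to \<open>E\<close> that sends the pair \<open>(a, X)\<close> to \<open>a\<close> times the coordinates of \<open>X\<close>. It is
  multiplicative because the coordinates of \<open>X\<close> are central in \<open>A\<close>.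
\<close>

definition pair_coord :: "('a \<times> (nat list \<Rightarrow> 'a) set \<Rightarrow> int) \<Rightarrow> nat set \<Rightarrow> 'a" where
  "pair_coord = monoid_ring_eval int_ring E (\<lambda>k. [k] \<cdot>\<^bsub>E\<^esub> \<one>\<^bsub>E\<^esub>)
    (\<lambda>(a, X). monomial A a {} \<otimes>\<^bsub>E\<^esub> ext_coord X)"

lemma E_scalar: "a \<in> carrier A \<Longrightarrow> monomial A a {} \<in> carrier E"
  by (simp add: E_monomial)

lemma E_scalar_ops:
  assumes "a \<in> carrier A" "b \<in> carrier A"
  shows "monomial A (a \<otimes> b) {} = monomial A a {} \<otimes>\<^bsub>E\<^esub> monomial A b {}"
    "monomial A (a \<oplus> b) {} = monomial A a {} \<oplus>\<^bsub>E\<^esub> monomial A b {}"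
  using ring_hom_memE(2,3)[OF scalar_hom] assms by auto

lemma pair_coord_hom: "pair_coord \<in> ring_hom F E"
  and pair_coord_d: "a \<in> carrier A \<Longrightarrow> X \<in> carrier L \<Longrightarrow>
    pair_coord (d a X) = monomial A a {} \<otimes>\<^bsub>E\<^esub> ext_coord X"
proof -
  let ?\<theta> = "\<lambda>(a, X). monomial A a {} \<otimes>\<^bsub>E\<^esub> ext_coord X"
  note facts = int_ring_ring AL_monoid E_ring E.int_multiple_hom
  have 1: "?\<theta> m \<in> carrier E" if "m \<in> carrier (A \<times>\<times> L)" for m
    using that by (auto simp: E_scalar)
  have 2: "?\<theta> \<one>\<^bsub>A \<times>\<times> L\<^esub> = \<one>\<^bsub>E\<^esub>"
    by (simp flip: E_one)
  have 3: "?\<theta> (m \<otimes>\<^bsub>A \<times>\<times> L\<^esub> k) = ?\<theta> m \<otimes>\<^bsub>E\<^esub> ?\<theta> k"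
    if mk: "m \<in> carrier (A \<times>\<times> L)" "k \<in> carrier (A \<times>\<times> L)" for m k
  proof -
    obtain a X b Y where eq: "m = (a, X)" "k = (b, Y)" by (cases m, cases k)
    then have ab: "a \<in> carrier A" "b \<in> carrier A" and XY: "X \<in> carrier L" "Y \<in> carrier L"
      using mk by auto
    note cl = E_scalar[OF ab(1)] E_scalar[OF ab(2)] ext.hom_closed[OF XY(1)] ext.hom_closed[OF XY(2)]
    have "monomial A b {} \<otimes>\<^bsub>E\<^esub> ext_coord X = ext_coord X \<otimes>\<^bsub>E\<^esub> monomial A b {}"
      using ab XY by (intro scalar_commute) (auto simp: ext_coord_central)
    then have "monomial A a {} \<otimes>\<^bsub>E\<^esub> (monomial A b {} \<otimes>\<^bsub>E\<^esub> ext_coord X) \<otimes>\<^bsub>E\<^esub> ext_coord Y =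
        monomial A a {} \<otimes>\<^bsub>E\<^esub> (ext_coord X \<otimes>\<^bsub>E\<^esub> monomial A b {}) \<otimes>\<^bsub>E\<^esub> ext_coord Y"
      by simp
    then show ?thesis
      using cl ab XY unfolding eq by (simp add: E_scalar_ops E.m_assoc)
  qed
  have 4: "([k] \<cdot>\<^bsub>E\<^esub> \<one>\<^bsub>E\<^esub>) \<otimes>\<^bsub>E\<^esub> ?\<theta> m = ?\<theta> m \<otimes>\<^bsub>E\<^esub> ([k] \<cdot>\<^bsub>E\<^esub> \<one>\<^bsub>E\<^esub>)"
    if "k \<in> carrier int_ring" "m \<in> carrier (A \<times>\<times> L)" for k m
    using 1[OF that(2)] by (simp add: E.add_pow_ldistr_int E.add_pow_rdistr_int)
  show "pair_coord \<in> ring_hom F E"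
    unfolding pair_coord_def F_def by (rule monoid_ring_eval_hom(1)[OF facts 1 2 3 4])
  show "pair_coord (d a X) = monomial A a {} \<otimes>\<^bsub>E\<^esub> ext_coord X" if "a \<in> carrier A" "X \<in> carrier L"
    using monoid_ring_eval_hom(2)[OF facts 1 2 3 4, of 1 "(a, X)"] that 1[of "(a, X)"]
    unfolding pair_coord_def by simp
qed

interpretation pair_coord: ring_hom_ring F E pair_coord
  by (intro ring_hom_ringI2 F_ring E_ring pair_coord_hom)

lemma ext_coord_scalar: "c \<in> center A \<Longrightarrow> ext_coord (scalar c) = monomial A c {}"
  using ext_coord_coset[OF T_monomial[of c "[]"]] coord_monomial[of c "[]"]
    anticommuting_family.word_product.simps(1)[OF E_generators]
  by (simp add: E_scalar center_carrier)

lemma pair_coord_kills: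
  assumes "f \<in> J"
  shows "pair_coord f = \<zero>\<^bsub>E\<^esub>"
proof -
  have diff: "u \<ominus>\<^bsub>F\<^esub> v \<in> a_kernel F E pair_coord"
    if "u \<in> carrier F" "v \<in> carrier F" "pair_coord u = pair_coord v" for u v
    unfolding a_kernel_def' using that by (auto simp: F.minus_eq E.r_neg)
  have "tensor_relations C A (\<lambda>c. c) L scalar \<subseteq> a_kernel F E pair_coord"
    unfolding tensor_relations_def Let_def F_def[symmetric]
  proof (intro Un_least subsetI; elim CollectE exE conjE; hypsubst)
    fix a a' X assume *: "a \<in> carrier A" "a' \<in> carrier A" "X \<in> carrier L"
    show "d (a \<oplus> a') X \<ominus>\<^bsub>F\<^esub> (d a X \<oplus>\<^bsub>F\<^esub> d a' X) \<in> a_kernel F E pair_coord"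
      using * by (intro diff) (auto simp: F_monomial pair_coord_d E_scalar_ops E.l_distr E_scalar)
  next
    fix a X Y assume *: "a \<in> carrier A" "X \<in> carrier L" "Y \<in> carrier L"
    show "d a (X \<oplus>\<^bsub>L\<^esub> Y) \<ominus>\<^bsub>F\<^esub> (d a X \<oplus>\<^bsub>F\<^esub> d a Y) \<in> a_kernel F E pair_coord"
      using * by (intro diff) (auto simp: F_monomial pair_coord_d E.r_distr E_scalar)
  next
    fix a X c assume *: "a \<in> carrier A" "X \<in> carrier L" "c \<in> carrier C"
    then have c: "c \<in> center A" by simp
    show "d (a \<otimes> c) X \<ominus>\<^bsub>F\<^esub> d a (scalar c \<otimes>\<^bsub>L\<^esub> X) \<in> a_kernel F E pair_coord"
      using *(1,2) c scalar_L[OF c] center_carrier[OF c] 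
      by (intro diff)
        (auto simp: F_monomial pair_coord_d E_scalar_ops ext_coord_scalar E.m_assoc E_scalar)
  qed
  then have "J \<subseteq> a_kernel F E pair_coord"
    unfolding J_def by (intro F.genideal_minimal pair_coord.kernel_is_ideal)
  then show ?thesis using assms unfolding a_kernel_def' by blast
qed

definition coords :: "('a \<times> (nat list \<Rightarrow> 'a) set \<Rightarrow> int) set \<Rightarrow> nat set \<Rightarrow> 'a" where
  "coords q = the_elem (pair_coord ` q)"

lemma coords_hom: "coords \<in> ring_hom Q E"
  and coords_coset: "f \<in> carrier F \<Longrightarrow> coords (J +>\<^bsub>F\<^esub> f) = pair_coord f"
  using ring_hom_factor[OF J_ideal E_ring pair_coord_hom pair_coord_kills]
  unfolding Q_def coords_def by auto

interpretation coords: ring_hom_ring Q E coords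
  by (intro ring_hom_ringI2 Q_ring E_ring coords_hom)

text \<open>
  The candidate for the inverse of \<open>coords\<close>. It is only shown to be additive and a left inverse,
  which gives injectivity of \<open>coords\<close>.
\<close>

definition combine :: "(nat set \<Rightarrow> 'a) \<Rightarrow> ('a \<times> (nat list \<Rightarrow> 'a) set \<Rightarrow> int) set" where
  "combine h = (\<Oplus>\<^bsub>Q\<^esub>S\<in>Pow {1..n}. pure (h S) (basis S))"

lemma combine_closed: "h \<in> carrier E \<Longrightarrow> combine h \<in> carrier Q"
  unfolding combine_def by (intro Q.finsum_closed) (auto intro!: pure_closed basis_closed simp: E_coeff)

lemma combine_add:
  assumes "g \<in> carrier E" "h \<in> carrier E"
  shows "combine (g \<oplus>\<^bsub>E\<^esub> h) = combine g \<oplus>\<^bsub>Q\<^esub> combine h"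
proof -
  have cl: "pure (f S) (basis S) \<in> carrier Q" if "f \<in> carrier E" "S \<in> Pow {1..n}" for f S
    using that by (intro pure_closed basis_closed) (auto simp: E_coeff)
  have "combine (g \<oplus>\<^bsub>E\<^esub> h) =
    (\<Oplus>\<^bsub>Q\<^esub>S\<in>Pow {1..n}. pure (g S) (basis S) \<oplus>\<^bsub>Q\<^esub> pure (h S) (basis S))"
    unfolding combine_def using assms cl
    by (intro Q.finsum_cong') (auto simp: E_add pure_add_left E_coeff basis_closed)
  also have "\<dots> = combine g \<oplus>\<^bsub>Q\<^esub> combine h"
    unfolding combine_def using assms cl by (intro Q.finsum_addf) auto
  finally show ?thesis .
qed

lemma combine_monomial:
  assumes "a \<in> carrier A" "S \<subseteq> {1..n}"
  shows "combine (monomial A a S) = pure a (basis S)"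
proof -
  have "combine (monomial A a S) = (\<Oplus>\<^bsub>Q\<^esub>U\<in>Pow {1..n}. if S = U then pure a (basis U) else \<zero>\<^bsub>Q\<^esub>)"
    unfolding combine_def using assms
    by (intro Q.finsum_cong')
      (auto simp: monomial_def pure_zero basis_closed intro!: pure_closed)
  also have "\<dots> = pure a (basis S)"
    using assms by (intro Q.finsum_singleton) (auto intro!: pure_closed basis_closed)
  finally show ?thesis .
qed

lemma combine_zero: "combine \<zero>\<^bsub>E\<^esub> = \<zero>\<^bsub>Q\<^esub>"
  unfolding combine_def E_zero
  by (rule Q.add.finprod_one_eqI) (simp add: pure_zero(1)[OF zero_closed basis_closed] del: One_nat_def)

text \<open>
  By additivity in \<open>X\<close> it suffices to take \<open>X = c e\<^sub>S\<close>, where the claim is the balancing relation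
  that moves \<open>c\<close> across the tensor sign.
\<close>

lemma combine_pure:
  assumes a: "a \<in> carrier A" and X: "X \<in> carrier L"
  shows "combine (monomial A a {} \<otimes>\<^bsub>E\<^esub> ext_coord X) = pure a X"
  using X
proof (induction X rule: L_induct)
  case zero
  then show ?case using a by (simp add: E_scalar combine_zero pure_zero(2)[OF a L.zero_closed])
next
  case (basis c S)
  then show ?case
    using a by (simp add: ext_coord_scalar_basis E_monomial_monomial center_carrier
        combine_monomial pure_balanced basis_closed del: One_nat_def)
next
  case (add X Y)
  then show ?case
    using a by (simp add: E_scalar E.r_distr combine_add pure_add_right)
qed

text \<open>
  Integer coefficients are reached from 1 by steps up and down; a step down needs that the inverse
  property passes to \<open>g\<close> from \<open>f\<close> and \<open>g + f\<close>.
\<close>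

lemma combine_pair_coord_diff:
  assumes f: "f \<in> carrier F" "combine (pair_coord f) = J +>\<^bsub>F\<^esub> f"
    and fg: "g \<in> carrier F" "combine (pair_coord (g \<oplus>\<^bsub>F\<^esub> f)) = J +>\<^bsub>F\<^esub> (g \<oplus>\<^bsub>F\<^esub> f)"
  shows "combine (pair_coord g) = J +>\<^bsub>F\<^esub> g"
proof -
  have "combine (pair_coord g) \<oplus>\<^bsub>Q\<^esub> (J +>\<^bsub>F\<^esub> f) = (J +>\<^bsub>F\<^esub> g) \<oplus>\<^bsub>Q\<^esub> (J +>\<^bsub>F\<^esub> f)"
    using assms by (simp add: combine_add)
  then show ?thesis
    using Q.add.right_cancel[of "J +>\<^bsub>F\<^esub> f" "combine (pair_coord g)" "J +>\<^bsub>F\<^esub> g"]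
      combine_closed[OF pair_coord.hom_closed[OF fg(1)]] proj.hom_closed[OF f(1)] proj.hom_closed[OF fg(1)]
    by blast
qed

text \<open>
  Pure tensors generate the tensor product additively, so the inverse property spreads from them
  to all cosets.
\<close>

lemma combine_pair_coord:
  assumes "f \<in> carrier F"
  shows "combine (pair_coord f) = J +>\<^bsub>F\<^esub> f"
proof -
  let ?P = "\<lambda>f. f \<in> carrier F \<and> combine (pair_coord f) = J +>\<^bsub>F\<^esub> f"
  note simps = monoid_ring_simps[OF int_ring_ring AL_monoid, folded F_def]
  note D = monoid_ring_carrierD[OF int_ring_ring AL_monoid assms[unfolded F_def]]
  have add: "?P (g \<oplus>\<^bsub>F\<^esub> h)" if "?P g" "?P h" for g h
    using that by (simp add: combine_add)
  have zero: "?P \<zero>\<^bsub>F\<^esub>" by (simp add: combine_zero)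
  have "?P f"
  proof (rule finite_support_induct[OF int_ring_ring D(3) D(1) order.refl])
    show "?P (\<lambda>x. \<zero>\<^bsub>int_ring\<^esub>)" using zero unfolding simps .
    show "?P (\<lambda>x. g x \<oplus>\<^bsub>int_ring\<^esub> h x)" if "?P g" "?P h" for g h
      using add[OF that] unfolding simps .
    fix k :: int and m assume "m \<in> {m. f m \<noteq> \<zero>\<^bsub>int_ring\<^esub>}"
    then have "m \<in> carrier (A \<times>\<times> L)" using D(2) by blast
    then obtain a X where m: "m = (a, X)" "a \<in> carrier A" "X \<in> carrier L" by (cases m) auto
    have one: "?P (monomial int_ring 1 m)"
      using m by (simp add: F_monomial pair_coord_d combine_pure) (simp add: pure_def)
    have plus: "monomial int_ring k m \<oplus>\<^bsub>F\<^esub> monomial int_ring l m = monomial int_ring (k + l) m"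
      for k l :: int
      unfolding simps by (simp add: monomial_def fun_eq_iff)
    show "?P (monomial int_ring k m)"
    proof (induction k rule: int_induct[where k = 0])
      case base
      have "monomial int_ring 0 m = \<zero>\<^bsub>F\<^esub>" unfolding simps by (simp add: monomial_def fun_eq_iff)
      then show ?case using zero by simp
    next
      case (step1 i)
      then show ?case using add[OF _ one, of "monomial int_ring i m"] by (simp add: plus)
    next
      case (step2 i)
      have sum: "monomial int_ring (i - 1) m \<oplus>\<^bsub>F\<^esub> monomial int_ring 1 m = monomial int_ring i m"
        using plus[of "i - 1" 1] by simp
      have cl: "monomial int_ring (i - 1) m \<in> carrier F" using m by (simp add: F_monomial)
      moreover have "combine (pair_coord (monomial int_ring (i - 1) m)) = J +>\<^bsub>F\<^esub> monomial int_ring (i - 1) m"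
        by (rule combine_pair_coord_diff[OF conjunct1[OF one] conjunct2[OF one] cl])
          (use step2 in \<open>simp only: sum\<close>)
      ultimately show ?case ..
    qed
  qed
  then show ?thesis ..
qed

text \<open>
  A left inverse makes \<open>coords\<close> injective, and it hits every \<open>a e\<^sub>S\<close>, namely as the image of the pure
  tensor of \<open>a\<close> and \<open>e\<^sub>S\<close>.
\<close>

lemma coords_iso: "coords \<in> ring_iso (exterior_algebra_nc A n) E"
proof -
  have inv: "combine (coords q) = q" if q: "q \<in> carrier Q" for q
  proof -
    obtain f where "f \<in> carrier F" "q = J +>\<^bsub>F\<^esub> f"
      using q unfolding Q_def FactRing_def A_RCOSETS_def' by auto
    then show ?thesis by (simp add: coords_coset combine_pair_coord)
  qed
  have "\<exists>q\<in>carrier Q. coords q = h" if "h \<in> carrier E" for h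
    using that
  proof (induction h rule: E_induct)
    case zero
    show ?case by (rule bexI[of _ "\<zero>\<^bsub>Q\<^esub>"]) auto
  next
    case (monomial a S)
    have bas: "basis S \<in> carrier L" using monomial(2) by (rule basis_closed)
    have "scalar \<one> = \<one>\<^bsub>L\<^esub>" using ring_hom_memE(4)[OF scalar_ext_hom] by simp
    then have "ext_coord (basis S) = monomial A \<one> S"
      using ext_coord_scalar_basis[OF center_closed(2) monomial(2)] bas by simp
    then have "coords (pure a (basis S)) = monomial A a S"
      using monomial bas
      by (simp add: pure_def coords_coset F_monomial pair_coord_d E_monomial_monomial del: One_nat_def)
    then show ?case using pure_closed[OF monomial(1) bas] by blast
  next
    case (add g h)
    then obtain p q where "p \<in> carrier Q" "q \<in> carrier Q" "coords p = g" "coords q = h" by blast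
    then show ?case by (intro bexI[of _ "p \<oplus>\<^bsub>Q\<^esub> q"]) auto
  qed
  then have "coords ` carrier Q = carrier E" by (auto simp: image_iff)
  moreover have "inj_on coords (carrier Q)" by (rule inj_on_inverseI[of _ combine]) (rule inv)
  ultimately show ?thesis
    using coords_hom by (simp add: Q_eq ring_iso_def bij_betw_def)
qed

lemma centrally_essential_exterior_algebra_iff:
  "centrally_essential (exterior_algebra_nc A n) \<longleftrightarrow> centrally_essential E"
  by (rule centrally_essential_iso[OF exterior_algebra_nc_ring[OF ring_axioms] E_ring coords_iso])

end

section \<open>Characteristic and the equivalences\<close>

lemma finite_imp_finite_characteristic:
  assumes "ring R" "finite (carrier R)"
  shows "\<exists>s. has_finite_characteristic R s"
proof -
  interpret ring R by fact
  let ?P = "\<lambda>k::nat. 0 < k \<and> [k] \<cdot>\<^bsub>R\<^esub> \<one>\<^bsub>R\<^esub> = \<zero>\<^bsub>R\<^esub>"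
  have "card (carrier R) > 0" using assms(2) zero_closed by (auto simp: card_gt_0_iff)
  then have "?P (card (carrier R))"
    using add.pow_order_eq_1[OF one_closed] by (simp add: order_def)
  then have "?P (LEAST k. ?P k)" by (rule LeastI)
  moreover have "\<not> ?P t" if "t < (LEAST k. ?P k)" for t using that by (rule not_less_Least)
  ultimately show ?thesis unfolding has_finite_characteristic_def by blast
qed

lemma two_power_times_odd: "s > 0 \<Longrightarrow> \<exists>k t. s = 2 ^ k * t \<and> odd (t :: nat)"
proof (induction s rule: less_induct)
  case (less s)
  show ?case
  proof (cases "even s")
    case True
    then obtain r where r: "s = 2 * r" by blast
    then obtain k t where "r = 2 ^ k * t" "odd t" using less.IH[of r] less.prems by auto
    then show ?thesis using r by (intro exI[of _ "Suc k"] exI[of _ t]) auto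
  next
    case False
    then show ?thesis by (intro exI[of _ 0] exI[of _ s]) auto
  qed
qed

text \<open>
  Write \<open>s = 2\<^sup>k t\<close> with \<open>t\<close> odd, so \<open>t > 1\<close>, and take \<open>a = 2\<^sup>k\<close>. It is nonzero since \<open>2\<^sup>k < s\<close>, and
  \<open>t a = 0\<close>. So an element of \<open>a A\<close> that is killed by 2 is killed by the coprime numbers 2 and \<open>t\<close>.
\<close>

lemma (in ring) two_torsion_free_multiple:
  assumes s: "has_finite_characteristic R s" and not2: "\<not> (\<exists>m::nat. s = 2 ^ m)"
  shows "\<exists>a\<in>carrier R. a \<noteq> \<zero> \<and> (\<forall>x\<in>carrier R. a \<otimes> x \<oplus> a \<otimes> x = \<zero> \<longrightarrow> a \<otimes> x = \<zero>)"
proof -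
  obtain k t where kt: "s = 2 ^ k * t" "odd t"
    using two_power_times_odd[of s] s by (auto simp: has_finite_characteristic_def)
  then obtain q where q: "t = 2 * q + 1" by (auto elim: oddE)
  have "t \<noteq> 1" using not2 kt by auto
  then have lt: "2 ^ k < s" using kt q by simp
  let ?a = "[((2::nat) ^ k)] \<cdot> \<one>"
  have "?a \<noteq> \<zero>" using s lt by (auto simp: has_finite_characteristic_def)
  moreover have "?a \<otimes> x = \<zero>" if x: "x \<in> carrier R" and tw: "?a \<otimes> x \<oplus> ?a \<otimes> x = \<zero>" for x
  proof -
    let ?y = "?a \<otimes> x"
    have y: "?y \<in> carrier R" using x by simp
    have "[t] \<cdot> ?a = \<zero>"
      using s by (simp add: add.nat_pow_pow kt(1) has_finite_characteristic_def mult.commute)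
    then have "[t] \<cdot> ?y = \<zero>" using x add_pow_ldistr[of ?a x t] by simp
    moreover have "[(2::nat)] \<cdot> ?y = \<zero>" using tw y by (simp add: numeral_2_eq_2)
    then have "[(2 * q)] \<cdot> ?y = \<zero>" using add.nat_pow_pow[OF y, of q 2] by simp
    then have "[t] \<cdot> ?y = ?y" using y unfolding q by (simp add: add.nat_pow_mult[symmetric])
    ultimately show ?thesis by simp
  qed
  ultimately show ?thesis by (intro bexI[of _ ?a]) auto
qed

theorem theorem1p4:
  fixes A :: "('a, 'm) ring_scheme" and n :: nat
  assumes "ring A" and "n \<ge> 1"
  shows "(finite (carrier A) \<longrightarrow> (\<exists>s. has_finite_characteristic A s)) \<and>
    (\<forall>s. has_finite_characteristic A s \<longrightarrow>
      (centrally_essential (exterior_algebra_nc A n) \<longleftrightarrow>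
        centrally_essential A \<and> ((\<exists>m::nat. s = 2 ^ m) \<or> odd n))) \<and>
    (ring_without_zero_divisors A \<longrightarrow>
      (centrally_essential (exterior_algebra_nc A n) \<longleftrightarrow>
        centrally_essential A \<and> (has_finite_characteristic A 2 \<or> odd n)))"
proof (intro conjI allI impI)
  interpret exterior_coordinates A n using assms(1) by (simp add: exterior_coordinates_def)
  note iff = centrally_essential_exterior_algebra_iff
  show "\<exists>s. has_finite_characteristic A s" if "finite (carrier A)"
    using assms(1) that by (rule finite_imp_finite_characteristic)
  show "centrally_essential (exterior_algebra_nc A n) \<longleftrightarrow>
      centrally_essential A \<and> ((\<exists>m::nat. s = 2 ^ m) \<or> odd n)"
    if s: "has_finite_characteristic A s" for s
  proof
    assume ce: "centrally_essential (exterior_algebra_nc A n)"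
    have "odd n" if "\<not> (\<exists>m::nat. s = 2 ^ m)"
      using two_torsion_free_multiple[OF s that] not_centrally_essential_even assms(2) ce
      unfolding iff by blast
    then show "centrally_essential A \<and> ((\<exists>m::nat. s = 2 ^ m) \<or> odd n)"
      using centrally_essential_coefficients ce unfolding iff by blast
  next
    assume *: "centrally_essential A \<and> ((\<exists>m::nat. s = 2 ^ m) \<or> odd n)"
    then have "odd n \<or> (\<exists>m. [((2::nat) ^ m)] \<cdot>\<^bsub>A\<^esub> \<one>\<^bsub>A\<^esub> = \<zero>\<^bsub>A\<^esub>)"
      using s by (auto simp: has_finite_characteristic_def)
    then show "centrally_essential (exterior_algebra_nc A n)"
      unfolding iff using * centrally_essential_E by blast
  qed
  show "centrally_essential (exterior_algebra_nc A n) \<longleftrightarrow>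
      centrally_essential A \<and> (has_finite_characteristic A 2 \<or> odd n)"
    if dom: "ring_without_zero_divisors A"
  proof
    assume ce: "centrally_essential (exterior_algebra_nc A n)"
    have "odd n" if "\<not> has_finite_characteristic A 2"
    proof (rule ccontr)
      assume "\<not> odd n"
      have nz: "\<one>\<^bsub>A\<^esub> \<noteq> \<zero>\<^bsub>A\<^esub>" using dom by (simp add: ring_without_zero_divisors_def)
      have "[t] \<cdot>\<^bsub>A\<^esub> \<one>\<^bsub>A\<^esub> \<noteq> \<zero>\<^bsub>A\<^esub>" if "0 < t \<and> t < 2" for t :: nat
      proof -
        have "t = 1" using that by simp
        then show ?thesis using nz by simp
      qed
      then have "[(2::nat)] \<cdot>\<^bsub>A\<^esub> \<one>\<^bsub>A\<^esub> \<noteq> \<zero>\<^bsub>A\<^esub>"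
        using \<open>\<not> has_finite_characteristic A 2\<close> unfolding has_finite_characteristic_def by simp
      then have two: "\<one>\<^bsub>A\<^esub> \<oplus>\<^bsub>A\<^esub> \<one>\<^bsub>A\<^esub> \<noteq> \<zero>\<^bsub>A\<^esub>"
        by (simp add: numeral_2_eq_2)
      have tf: "x = \<zero>\<^bsub>A\<^esub>" if "x \<in> carrier A" "x \<oplus>\<^bsub>A\<^esub> x = \<zero>\<^bsub>A\<^esub>" for x
      proof -
        have "(\<one>\<^bsub>A\<^esub> \<oplus>\<^bsub>A\<^esub> \<one>\<^bsub>A\<^esub>) \<otimes>\<^bsub>A\<^esub> x = \<zero>\<^bsub>A\<^esub>" using that by (simp add: l_distr)
        then show ?thesis
          using dom two that(1) a_closed[OF one_closed one_closed]
          unfolding ring_without_zero_divisors_def by blast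
      qed
      have "\<not> centrally_essential E"
      proof (rule not_centrally_essential_even[OF _ assms(2) one_closed nz])
        show "even n" using \<open>\<not> odd n\<close> by simp
        show "\<one>\<^bsub>A\<^esub> \<otimes>\<^bsub>A\<^esub> x = \<zero>\<^bsub>A\<^esub>"
          if "x \<in> carrier A" "\<one>\<^bsub>A\<^esub> \<otimes>\<^bsub>A\<^esub> x \<oplus>\<^bsub>A\<^esub> \<one>\<^bsub>A\<^esub> \<otimes>\<^bsub>A\<^esub> x = \<zero>\<^bsub>A\<^esub>" for x
          using that tf[of x] by simp
      qed
      then show False using ce unfolding iff by blast
    qed
    then show "centrally_essential A \<and> (has_finite_characteristic A 2 \<or> odd n)"
      using centrally_essential_coefficients ce unfolding iff by blast
  next
    assume *: "centrally_essential A \<and> (has_finite_characteristic A 2 \<or> odd n)"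
    then have "odd n \<or> (\<exists>m. [((2::nat) ^ m)] \<cdot>\<^bsub>A\<^esub> \<one>\<^bsub>A\<^esub> = \<zero>\<^bsub>A\<^esub>)"
      by (auto simp: has_finite_characteristic_def intro!: exI[of _ 1])
    then show "centrally_essential (exterior_algebra_nc A n)"
      unfolding iff using * centrally_essential_E by blast
  qed
qed

end
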